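(* Let $\mathcal{C}$ be an arbitrary category. The functor $i:\overline{\mathrm{Pro}}(\mathcal{C})\to\mathrm{Pro}(\mathcal{C})$ is (isomorphic to) a full subcategory inclusion, and is essentially surjective on objects. Thus it is an equivalence of categories.
   Context: Posets. A poset $T$ is viewed as a category with a single morphism $u\to v$ iff $u\ge v$. $T$ is cofinite if $\{z\in T: z\le x\}$ is finite for every $x\in T$; a directed set is a nonempty poset in which any two elements have a common upper bound. A cofinite directed set $A$ has infinite height if for every $a\in A$ there is $a'\in A$ with $a<a'$. A category $I$ is directed (cofiltered) if it is nonempty; for all objects $s,t$ there is an object $u$ with morphisms $u\to s$, $u\to t$; and for all parallel $f,g:s\to t$ there is $h:u\to s$ with $fh=gh$. $\mathrm{Pro}(\mathcal{C})$ has as objects diagrams $I\to\mathcal{C}$ with $I$ small and directed, and $\mathrm{Hom}_{\mathrm{Pro}(\mathcal{C})}(X,Y)=\lim_s\operatorname{colim}_t\mathrm{Hom}_{\mathcal{C}}(X_t,Y_s)$. The category $\overline{\mathrm{Pro}}(\mathcal{C})$. Objects are diagrams $F:A\to\mathcal{C}$ with $A$ a (small) cofinite directed set of infinite height. For objects $F:A\to\mathcal{C}$, $G:B\to\mathcal{C}$, a pre morphism from $F$ to $G$ is a pair $(\alpha,\phi)$ with $\alpha:B\to A$ a strictly increasing function and $\phi:F\circ\alpha\to G$ a natural transformation. Pre morphisms from $F$ to $G$ are partially ordered by: $(\alpha',\phi')\ge(\alpha,\phi)$ iff for every $b\in B$, $\alpha'(b)\ge\alpha(b)$ and $\phi'_b$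 equals the composite $F(\alpha'(b))\to F(\alpha(b))\xrightarrow{\phi_b}G(b)$. A morphism $F\to G$ in $\overline{\mathrm{Pro}}(\mathcal{C})$ is a connected component $[\alpha,\phi]$ of this poset. Composition of $[\alpha,\phi]:F\to G$ and $[\beta,\psi]:G\to H$ is $[\alpha\circ\beta,\psi\circ\phi_\beta]$. The functor $i$. It is the identity on objects, $i(F)=F$, and sends $[\alpha,\phi]:F\to G$ to the morphism in $\mathrm{Pro}(\mathcal{C})$ whose $b$-component, for each $b\in B$, is the class of $\phi_b:F(\alpha(b))\to G(b)$ in $\operatorname{colim}_{a\in A}\mathrm{Hom}_{\mathcal{C}}(F(a),G(b))$; this is well defined and functorial. *)

theory Defs
  imports
    "HOL-Library.FuncSet"
    "HOL-Library.Countable_Set"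
    "HOL-Library.Equipollence"
begin

section \<open>Categories, functors, equivalences\<close>

text \<open>
  Categories are given by families of hom-sets, which need not be disjoint. Composition is
  written in applicative order: \<open>Cmp C x y z g f\<close> is the composite of
  \<open>f : x \<rightarrow> y\<close> followed by \<open>g : y \<rightarrow> z\<close>.
\<close>

record ('o, 'm) category =
  Ob :: "'o set"
  Hom :: "'o \<Rightarrow> 'o \<Rightarrow> 'm set"
  Ident :: "'o \<Rightarrow> 'm"
  Cmp :: "'o \<Rightarrow> 'o \<Rightarrow> 'o \<Rightarrow> 'm \<Rightarrow> 'm \<Rightarrow> 'm"

locale category =
  fixes C :: "('o, 'm) category"
  assumes Hom_Ob: "f \<in> Hom C x y \<Longrightarrow> x \<in> Ob C \<and> y \<in> Ob C"
    and Ident_in_Hom: "x \<in> Ob C \<Longrightarrow> Ident C x \<in> Hom C x x"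
    and Cmp_in_Hom: "\<lbrakk>f \<in> Hom C x y; g \<in> Hom C y z\<rbrakk> \<Longrightarrow> Cmp C x y z g f \<in> Hom C x z"
    and Cmp_Ident_left: "f \<in> Hom C x y \<Longrightarrow> Cmp C x y y (Ident C y) f = f"
    and Cmp_Ident_right: "f \<in> Hom C x y \<Longrightarrow> Cmp C x x y f (Ident C x) = f"
    and Cmp_assoc: "\<lbrakk>f \<in> Hom C w x; g \<in> Hom C x y; h \<in> Hom C y z\<rbrakk> \<Longrightarrow>
      Cmp C w x z (Cmp C x y z h g) f = Cmp C w y z h (Cmp C w x y g f)"

record ('o1, 'm1, 'o2, 'm2) functor_data =
  omap :: "'o1 \<Rightarrow> 'o2"
  amap :: "'o1 \<Rightarrow> 'o1 \<Rightarrow> 'm1 \<Rightarrow> 'm2"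

locale cat_functor = src: category C + tgt: category D
  for C :: "('o1, 'm1) category" and D :: "('o2, 'm2) category" +
  fixes F :: "('o1, 'm1, 'o2, 'm2) functor_data"
  assumes omap_Ob: "x \<in> Ob C \<Longrightarrow> omap F x \<in> Ob D"
    and amap_Hom: "f \<in> Hom C x y \<Longrightarrow> amap F x y f \<in> Hom D (omap F x) (omap F y)"
    and amap_Ident: "x \<in> Ob C \<Longrightarrow> amap F x x (Ident C x) = Ident D (omap F x)"
    and amap_Cmp: "\<lbrakk>f \<in> Hom C x y; g \<in> Hom C y z\<rbrakk> \<Longrightarrow>
      amap F x z (Cmp C x y z g f) =
        Cmp D (omap F x) (omap F y) (omap F z) (amap F y z g) (amap F x y f)"

definition functor_id :: "('o, 'm, 'o, 'm) functor_data" where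
  "functor_id = \<lparr>omap = (\<lambda>x. x), amap = (\<lambda>x y f. f)\<rparr>"

definition functor_comp ::
  "('o2, 'm2, 'o3, 'm3) functor_data \<Rightarrow> ('o1, 'm1, 'o2, 'm2) functor_data
    \<Rightarrow> ('o1, 'm1, 'o3, 'm3) functor_data" where
  "functor_comp G F =
    \<lparr>omap = (\<lambda>x. omap G (omap F x)),
     amap = (\<lambda>x y f. amap G (omap F x) (omap F y) (amap F x y f))\<rparr>"

definition functor_eq ::
  "('o1, 'm1) category \<Rightarrow> ('o1, 'm1, 'o2, 'm2) functor_data
    \<Rightarrow> ('o1, 'm1, 'o2, 'm2) functor_data \<Rightarrow> bool" where
  "functor_eq C F G \<longleftrightarrow>
    (\<forall>x\<in>Ob C. omap F x = omap G x) \<and>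
    (\<forall>x\<in>Ob C. \<forall>y\<in>Ob C. \<forall>f\<in>Hom C x y. amap F x y f = amap G x y f)"

definition nat_trans ::
  "('o1, 'm1) category \<Rightarrow> ('o2, 'm2) category \<Rightarrow> ('o1, 'm1, 'o2, 'm2) functor_data
    \<Rightarrow> ('o1, 'm1, 'o2, 'm2) functor_data \<Rightarrow> ('o1 \<Rightarrow> 'm2) \<Rightarrow> bool" where
  "nat_trans C D F G \<phi> \<longleftrightarrow>
    (\<forall>x\<in>Ob C. \<phi> x \<in> Hom D (omap F x) (omap G x)) \<and>
    (\<forall>x\<in>Ob C. \<forall>y\<in>Ob C. \<forall>f\<in>Hom C x y.
      Cmp D (omap F x) (omap F y) (omap G y) (\<phi> y) (amap F x y f) =
      Cmp D (omap F x) (omap G x) (omap G y) (amap G x y f) (\<phi> x))"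

definition iso_arrow :: "('o, 'm) category \<Rightarrow> 'o \<Rightarrow> 'o \<Rightarrow> 'm \<Rightarrow> bool" where
  "iso_arrow C x y f \<longleftrightarrow> f \<in> Hom C x y \<and>
    (\<exists>g\<in>Hom C y x. Cmp C x y x g f = Ident C x \<and> Cmp C y x y f g = Ident C y)"

definition isomorphic_objects :: "('o, 'm) category \<Rightarrow> 'o \<Rightarrow> 'o \<Rightarrow> bool" where
  "isomorphic_objects C x y \<longleftrightarrow> (\<exists>f. iso_arrow C x y f)"

definition naturally_isomorphic ::
  "('o1, 'm1) category \<Rightarrow> ('o2, 'm2) category \<Rightarrow> ('o1, 'm1, 'o2, 'm2) functor_data
    \<Rightarrow> ('o1, 'm1, 'o2, 'm2) functor_data \<Rightarrow> bool" where
  "naturally_isomorphic C D F G \<longleftrightarrow>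
    (\<exists>\<phi>. nat_trans C D F G \<phi> \<and> (\<forall>x\<in>Ob C. iso_arrow D (omap F x) (omap G x) (\<phi> x)))"

definition category_isomorphism ::
  "('o1, 'm1) category \<Rightarrow> ('o2, 'm2) category \<Rightarrow> ('o1, 'm1, 'o2, 'm2) functor_data \<Rightarrow> bool" where
  "category_isomorphism C D F \<longleftrightarrow> cat_functor C D F \<and>
    (\<exists>G. cat_functor D C G \<and> functor_eq C (functor_comp G F) functor_id \<and>
         functor_eq D (functor_comp F G) functor_id)"

definition equivalence_of_categories ::
  "('o1, 'm1) category \<Rightarrow> ('o2, 'm2) category \<Rightarrow> ('o1, 'm1, 'o2, 'm2) functor_data \<Rightarrow> bool" where
  "equivalence_of_categories C D F \<longleftrightarrow> cat_functor C D F \<and>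
    (\<exists>G. cat_functor D C G \<and> naturally_isomorphic C C functor_id (functor_comp G F) \<and>
         naturally_isomorphic D D (functor_comp F G) functor_id)"

definition essentially_surjective ::
  "('o1, 'm1) category \<Rightarrow> ('o2, 'm2) category \<Rightarrow> ('o1, 'm1, 'o2, 'm2) functor_data \<Rightarrow> bool" where
  "essentially_surjective C D F \<longleftrightarrow>
    (\<forall>d\<in>Ob D. \<exists>c\<in>Ob C. isomorphic_objects D (omap F c) d)"

definition full_subcategory :: "('o, 'm) category \<Rightarrow> 'o set \<Rightarrow> ('o, 'm) category" where
  "full_subcategory D S =
    \<lparr>Ob = S,
     Hom = (\<lambda>x y. if x \<in> S \<and> y \<in> S then Hom D x y else {}),
     Ident = Ident D,
     Cmp = Cmp D\<rparr>"

text \<open>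
  \<open>F\<close> is, up to isomorphism, a full subcategory inclusion: it is an isomorphism onto a full
  subcategory followed by the inclusion functor, whose underlying data are those of
  \<open>functor_id\<close>.
\<close>

definition full_subcategory_inclusion_upto_iso ::
  "('o1, 'm1) category \<Rightarrow> ('o2, 'm2) category \<Rightarrow> ('o1, 'm1, 'o2, 'm2) functor_data \<Rightarrow> bool" where
  "full_subcategory_inclusion_upto_iso C D F \<longleftrightarrow> cat_functor C D F \<and>
    (\<exists>S J. S \<subseteq> Ob D \<and> category_isomorphism C (full_subcategory D S) J \<and>
           functor_eq C F (functor_comp functor_id J))"

section \<open>Diagrams\<close>

text \<open>
  The type \<open>'u\<close> of indices plays the role of the universe: a set is small iff its
  cardinality is less than that of \<open>'u\<close>. If \<open>'u\<close> has the cardinality of a Grothendieck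
  universe, this is smallness with respect to that universe.

  Index categories and diagrams have default values outside their carriers, so that equality
  in HOL is equality of the mathematical objects.
\<close>

definition small :: "'u itself \<Rightarrow> 'x set \<Rightarrow> bool" where
  "small _ S \<longleftrightarrow> S \<prec> (UNIV :: 'u set)"

definition arrows :: "('o, 'm) category \<Rightarrow> ('o \<times> 'o \<times> 'm) set" where
  "arrows I = {(s, t, f). f \<in> Hom I s t}"

definition extensional_category :: "('o, 'm) category \<Rightarrow> bool" where
  "extensional_category I \<longleftrightarrow>
    Ident I \<in> extensional (Ob I) \<and>
    (\<forall>s t u f g. \<not> (f \<in> Hom I s t \<and> g \<in> Hom I t u) \<longrightarrow> Cmp I s t u g f = undefined)"

definition extensional_functor ::
  "('o1, 'm1) category \<Rightarrow> ('o1, 'm1, 'o2, 'm2) functor_data \<Rightarrow> bool" where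
  "extensional_functor I X \<longleftrightarrow>
    omap X \<in> extensional (Ob I) \<and>
    (\<forall>s t f. f \<notin> Hom I s t \<longrightarrow> amap X s t f = undefined)"

definition directed_category :: "('o, 'm) category \<Rightarrow> bool" where
  "directed_category I \<longleftrightarrow>
    Ob I \<noteq> {} \<and>
    (\<forall>s\<in>Ob I. \<forall>t\<in>Ob I. \<exists>u\<in>Ob I. Hom I u s \<noteq> {} \<and> Hom I u t \<noteq> {}) \<and>
    (\<forall>s\<in>Ob I. \<forall>t\<in>Ob I. \<forall>f\<in>Hom I s t. \<forall>g\<in>Hom I s t.
      \<exists>u\<in>Ob I. \<exists>h\<in>Hom I u s. Cmp I u s t f h = Cmp I u s t g h)"

definition small_directed_category :: "('u, 'u) category \<Rightarrow> bool" where
  "small_directed_category I \<longleftrightarrow>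
    category I \<and> extensional_category I \<and>
    small TYPE('u) (Ob I) \<and> small TYPE('u) (arrows I) \<and> directed_category I"

text \<open>
  A poset is given by its order relation \<open>r\<close>, where \<open>(x, y) \<in> r\<close> means \<open>x \<le> y\<close>; its
  carrier is \<open>Field r\<close>.
\<close>

definition cofinite_poset :: "'u rel \<Rightarrow> bool" where
  "cofinite_poset r \<longleftrightarrow> (\<forall>x\<in>Field r. finite {z\<in>Field r. (z, x) \<in> r})"

definition directed_set :: "'u rel \<Rightarrow> bool" where
  "directed_set r \<longleftrightarrow> Partial_order r \<and> Field r \<noteq> {} \<and>
    (\<forall>x\<in>Field r. \<forall>y\<in>Field r. \<exists>z\<in>Field r. (x, z) \<in> r \<and> (y, z) \<in> r)"

definition infinite_height :: "'u rel \<Rightarrow> bool" where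
  "infinite_height r \<longleftrightarrow> (\<forall>a\<in>Field r. \<exists>a'\<in>Field r. (a, a') \<in> r \<and> a \<noteq> a')"

definition small_cofinite_directed_set :: "'u rel \<Rightarrow> bool" where
  "small_cofinite_directed_set r \<longleftrightarrow>
    directed_set r \<and> cofinite_poset r \<and> infinite_height r \<and> small TYPE('u) (Field r)"

definition strictly_increasing :: "'u rel \<Rightarrow> 'u rel \<Rightarrow> ('u \<Rightarrow> 'u) \<Rightarrow> bool" where
  "strictly_increasing s r \<alpha> \<longleftrightarrow> \<alpha> \<in> Field s \<rightarrow>\<^sub>E Field r \<and>
    (\<forall>b b'. (b, b') \<in> s \<and> b \<noteq> b' \<longrightarrow> (\<alpha> b, \<alpha> b') \<in> r \<and> \<alpha> b \<noteq> \<alpha> b')"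

text \<open>
  The single morphism \<open>u \<rightarrow> v\<close> of a poset category, which exists iff \<open>u \<ge> v\<close>. Only its
  being unique matters; it is encoded by its source.
\<close>

definition poset_arrow :: "'u \<Rightarrow> 'u \<Rightarrow> 'u" where
  "poset_arrow u v = u"

definition poset_category :: "'u rel \<Rightarrow> ('u, 'u) category" where
  "poset_category r =
    \<lparr>Ob = Field r,
     Hom = (\<lambda>u v. if (v, u) \<in> r then {poset_arrow u v} else {}),
     Ident = (\<lambda>u\<in>Field r. poset_arrow u u),
     Cmp = (\<lambda>u v w g f. if (v, u) \<in> r \<and> (w, v) \<in> r \<and> f = poset_arrow u v \<and> g = poset_arrow v w
                        then poset_arrow u w else undefined)\<rparr>"

definition poset_functor :: "('u \<Rightarrow> 'u) \<Rightarrow> ('u, 'u, 'u, 'u) functor_data" where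
  "poset_functor \<alpha> = \<lparr>omap = \<alpha>, amap = (\<lambda>b b' _. poset_arrow (\<alpha> b) (\<alpha> b'))\<rparr>"

text \<open>
  The smallest equivalence relation on \<open>S\<close> containing the part of \<open>R\<close> that lies in \<open>S\<close>.
\<close>

definition generated_equiv :: "'x set \<Rightarrow> 'x rel \<Rightarrow> 'x rel" where
  "generated_equiv S R = (let Q = R \<inter> S \<times> S in (Q \<union> Q\<inverse>)\<^sup>* \<inter> S \<times> S)"

section \<open>The category of pro-objects\<close>

type_synonym ('u, 'o, 'm) pro_object =
  "('u, 'u) category \<times> ('u, 'u, 'o, 'm) functor_data"

text \<open>
  For a diagram \<open>X\<close> on \<open>I\<close> and an object \<open>y\<close> of \<open>C\<close>, the set \<open>colim_Hom C I X y\<close> is the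
  colimit over \<open>t\<close> of \<open>Hom C (X t) y\<close>, that is, the quotient of the disjoint union of these
  sets by the equivalence relation generated by identifying \<open>f : X t \<rightarrow> y\<close> with
  \<open>f \<circ> X h\<close> for \<open>h : t' \<rightarrow> t\<close>.
\<close>

definition colim_points ::
  "('o, 'm) category \<Rightarrow> ('u, 'u) category \<Rightarrow> ('u, 'u, 'o, 'm) functor_data \<Rightarrow> 'o \<Rightarrow> ('u \<times> 'm) set" where
  "colim_points C I X y = (SIGMA t:Ob I. Hom C (omap X t) y)"

definition colim_equiv ::
  "('o, 'm) category \<Rightarrow> ('u, 'u) category \<Rightarrow> ('u, 'u, 'o, 'm) functor_data \<Rightarrow> 'o \<Rightarrow> ('u \<times> 'm) rel" where
  "colim_equiv C I X y = generated_equiv (colim_points C I X y)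
    {((t, f), (t', Cmp C (omap X t') (omap X t) y f (amap X t' t h))) | t f t' h.
      f \<in> Hom C (omap X t) y \<and> h \<in> Hom I t' t}"

definition colim_Hom ::
  "('o, 'm) category \<Rightarrow> ('u, 'u) category \<Rightarrow> ('u, 'u, 'o, 'm) functor_data \<Rightarrow> 'o \<Rightarrow> ('u \<times> 'm) set set" where
  "colim_Hom C I X y = colim_points C I X y // colim_equiv C I X y"

definition colim_class ::
  "('o, 'm) category \<Rightarrow> ('u, 'u) category \<Rightarrow> ('u, 'u, 'o, 'm) functor_data \<Rightarrow> 'o
    \<Rightarrow> 'u \<Rightarrow> 'm \<Rightarrow> ('u \<times> 'm) set" where
  "colim_class C I X y t f = colim_equiv C I X y `` {(t, f)}"

text \<open>
  The map \<open>colim_Hom C I X y \<rightarrow> colim_Hom C I X y'\<close> induced by \<open>g : y \<rightarrow> y'\<close>. Here and below,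
  functions on quotients are defined by taking the union of the values at all representatives;
  these values are classes and all coincide.
\<close>

definition colim_post ::
  "('o, 'm) category \<Rightarrow> ('u, 'u) category \<Rightarrow> ('u, 'u, 'o, 'm) functor_data \<Rightarrow> 'o \<Rightarrow> 'o
    \<Rightarrow> 'm \<Rightarrow> ('u \<times> 'm) set \<Rightarrow> ('u \<times> 'm) set" where
  "colim_post C I X y y' g c =
    (\<Union>(t, f)\<in>c. colim_class C I X y' t (Cmp C (omap X t) y y' g f))"

text \<open>
  A morphism from \<open>X\<close> to \<open>Y\<close> is an element of the limit over \<open>s\<close> of \<open>colim_Hom C I X (Y s)\<close>,
  that is, a compatible family.
\<close>

definition pro_Hom ::
  "('o, 'm) category \<Rightarrow> ('u, 'o, 'm) pro_object \<Rightarrow> ('u, 'o, 'm) pro_object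
    \<Rightarrow> ('u \<Rightarrow> ('u \<times> 'm) set) set" where
  "pro_Hom C = (\<lambda>(I, X) (J, Y).
    {p \<in> (\<Pi>\<^sub>E s\<in>Ob J. colim_Hom C I X (omap Y s)).
      \<forall>s\<in>Ob J. \<forall>s'\<in>Ob J. \<forall>k\<in>Hom J s s'.
        colim_post C I X (omap Y s) (omap Y s') (amap Y s s' k) (p s) = p s'})"

definition pro_Ident ::
  "('o, 'm) category \<Rightarrow> ('u, 'o, 'm) pro_object \<Rightarrow> 'u \<Rightarrow> ('u \<times> 'm) set" where
  "pro_Ident C = (\<lambda>(I, X).
    \<lambda>s\<in>Ob I. colim_class C I X (omap X s) s (Ident C (omap X s)))"

text \<open>
  If the component \<open>q r\<close> is represented by \<open>g : Y s \<rightarrow> Z r\<close>, then the \<open>r\<close>-component of the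
  composite of \<open>p\<close> and \<open>q\<close> is the image of \<open>p s\<close> under \<open>g\<close>.
\<close>

definition pro_Cmp ::
  "('o, 'm) category \<Rightarrow> ('u, 'o, 'm) pro_object \<Rightarrow> ('u, 'o, 'm) pro_object \<Rightarrow> ('u, 'o, 'm) pro_object
    \<Rightarrow> ('u \<Rightarrow> ('u \<times> 'm) set) \<Rightarrow> ('u \<Rightarrow> ('u \<times> 'm) set) \<Rightarrow> 'u \<Rightarrow> ('u \<times> 'm) set" where
  "pro_Cmp C = (\<lambda>(I, X) (J, Y) (K, Z) q p.
    \<lambda>r\<in>Ob K. \<Union>(s, g)\<in>q r. colim_post C I X (omap Y s) (omap Z r) g (p s))"

definition pro_objects :: "('o, 'm) category \<Rightarrow> ('u, 'o, 'm) pro_object set" where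
  "pro_objects C =
    {(I, X). small_directed_category I \<and> cat_functor I C X \<and> extensional_functor I X}"

definition Pro ::
  "'u itself \<Rightarrow> ('o, 'm) category
    \<Rightarrow> (('u, 'o, 'm) pro_object, 'u \<Rightarrow> ('u \<times> 'm) set) category" where
  "Pro _ C =
    \<lparr>Ob = pro_objects C,
     Hom = (\<lambda>X Y. if X \<in> pro_objects C \<and> Y \<in> pro_objects C then pro_Hom C X Y else {}),
     Ident = pro_Ident C,
     Cmp = pro_Cmp C\<rparr>"

section \<open>The category of diagrams on cofinite directed sets of infinite height\<close>

type_synonym ('u, 'o, 'm) probar_object = "'u rel \<times> ('u, 'u, 'o, 'm) functor_data"

type_synonym ('u, 'm) pre_morphism = "('u \<Rightarrow> 'u) \<times> ('u \<Rightarrow> 'm)"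

definition pre_morphisms ::
  "('o, 'm) category \<Rightarrow> ('u, 'o, 'm) probar_object \<Rightarrow> ('u, 'o, 'm) probar_object
    \<Rightarrow> ('u, 'm) pre_morphism set" where
  "pre_morphisms C = (\<lambda>(r, F) (s, G).
    {(\<alpha>, \<phi>). strictly_increasing s r \<alpha> \<and> \<phi> \<in> extensional (Field s) \<and>
      nat_trans (poset_category s) C (functor_comp F (poset_functor \<alpha>)) G \<phi>})"

text \<open>A pair \<open>(p, p')\<close> lies in \<open>pre_morphism_le C (r, F) (s, G)\<close> iff \<open>p' \<ge> p\<close>.\<close>

definition pre_morphism_le ::
  "('o, 'm) category \<Rightarrow> ('u, 'o, 'm) probar_object \<Rightarrow> ('u, 'o, 'm) probar_object
    \<Rightarrow> ('u, 'm) pre_morphism rel" where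
  "pre_morphism_le C = (\<lambda>(r, F) (s, G).
    {((\<alpha>, \<phi>), (\<alpha>', \<phi>')). \<forall>b\<in>Field s. (\<alpha> b, \<alpha>' b) \<in> r \<and>
      \<phi>' b = Cmp C (omap F (\<alpha>' b)) (omap F (\<alpha> b)) (omap G b)
               (\<phi> b) (amap F (\<alpha>' b) (\<alpha> b) (poset_arrow (\<alpha>' b) (\<alpha> b)))})"

text \<open>Being in the same connected component of the poset of pre morphisms.\<close>

definition pre_morphism_equiv ::
  "('o, 'm) category \<Rightarrow> ('u, 'o, 'm) probar_object \<Rightarrow> ('u, 'o, 'm) probar_object
    \<Rightarrow> ('u, 'm) pre_morphism rel" where
  "pre_morphism_equiv C X Y = generated_equiv (pre_morphisms C X Y) (pre_morphism_le C X Y)"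

definition pre_morphism_class ::
  "('o, 'm) category \<Rightarrow> ('u, 'o, 'm) probar_object \<Rightarrow> ('u, 'o, 'm) probar_object
    \<Rightarrow> ('u, 'm) pre_morphism \<Rightarrow> ('u, 'm) pre_morphism set" where
  "pre_morphism_class C X Y p = pre_morphism_equiv C X Y `` {p}"

definition probar_Hom ::
  "('o, 'm) category \<Rightarrow> ('u, 'o, 'm) probar_object \<Rightarrow> ('u, 'o, 'm) probar_object
    \<Rightarrow> ('u, 'm) pre_morphism set set" where
  "probar_Hom C X Y = pre_morphisms C X Y // pre_morphism_equiv C X Y"

definition probar_Ident ::
  "('o, 'm) category \<Rightarrow> ('u, 'o, 'm) probar_object \<Rightarrow> ('u, 'm) pre_morphism set" where
  "probar_Ident C = (\<lambda>(r, F).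
    pre_morphism_class C (r, F) (r, F)
      (\<lambda>a\<in>Field r. a, \<lambda>a\<in>Field r. Ident C (omap F a)))"

definition probar_Cmp ::
  "('o, 'm) category \<Rightarrow> ('u, 'o, 'm) probar_object \<Rightarrow> ('u, 'o, 'm) probar_object
    \<Rightarrow> ('u, 'o, 'm) probar_object \<Rightarrow> ('u, 'm) pre_morphism set \<Rightarrow> ('u, 'm) pre_morphism set
    \<Rightarrow> ('u, 'm) pre_morphism set" where
  "probar_Cmp C = (\<lambda>(r, F) (s, G) (t, H) Q P.
    \<Union>(\<alpha>, \<phi>)\<in>P. \<Union>(\<beta>, \<psi>)\<in>Q.
      pre_morphism_class C (r, F) (t, H)
        (\<lambda>c\<in>Field t. \<alpha> (\<beta> c),
         \<lambda>c\<in>Field t. Cmp C (omap F (\<alpha> (\<beta> c))) (omap G (\<beta> c)) (omap H c) (\<psi> c) (\<phi> (\<beta> c))))"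

definition probar_objects :: "('o, 'm) category \<Rightarrow> ('u, 'o, 'm) probar_object set" where
  "probar_objects C =
    {(r, F). small_cofinite_directed_set r \<and> cat_functor (poset_category r) C F \<and>
      extensional_functor (poset_category r) F}"

definition ProBar ::
  "'u itself \<Rightarrow> ('o, 'm) category
    \<Rightarrow> (('u, 'o, 'm) probar_object, ('u, 'm) pre_morphism set) category" where
  "ProBar _ C =
    \<lparr>Ob = probar_objects C,
     Hom = (\<lambda>X Y. if X \<in> probar_objects C \<and> Y \<in> probar_objects C then probar_Hom C X Y else {}),
     Ident = probar_Ident C,
     Cmp = probar_Cmp C\<rparr>"

definition pro_incl ::
  "'u itself \<Rightarrow> ('o, 'm) category
    \<Rightarrow> (('u, 'o, 'm) probar_object, ('u, 'm) pre_morphism set,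
        ('u, 'o, 'm) pro_object, 'u \<Rightarrow> ('u \<times> 'm) set) functor_data" where
  "pro_incl _ C =
    \<lparr>omap = (\<lambda>(r, F). (poset_category r, F)),
     amap = (\<lambda>(r, F) (s, G) P. \<lambda>b\<in>Field s.
       \<Union>(\<alpha>, \<phi>)\<in>P. colim_class C (poset_category r) F (omap G b) (\<alpha> b) (\<phi> b))\<rparr>"

end

theory Submission
  imports Defs "HOL-Algebra.Free_Abelian_Groups"
begin

text \<open>
  A morphism of pro-objects between diagrams on cofinite directed sets is a compatible family of
  classes. Representatives of these classes can be chosen coherently by recursion along the
  cofinite index set of the target, since each index has only finitely many predecessors; so every
  morphism comes from a pre morphism. The same recursion, applied to the common restrictions of
  two pre morphisms with equal classes, yields a common upper bound of them. Hence the functor is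
  fully faithful, and it is injective on objects. For essential surjectivity, a small directed
  category \<open>I\<close> receives a cofinal functor from the finite subsets of the set of its arrows
  (enlarged by a copy of \<open>nat\<close>), because every finite diagram in \<open>I\<close> has a cone.
\<close>

section \<open>Fully faithful functors\<close>

text \<open>Two points shape the development. First, connected components of pre morphisms are
  awkward to compose directly. The map \<open>components\<close> sends a pre morphism to its
  compatible family of classes, and two pre morphisms turn out to be connected iff their families
  agree. Well-definedness of composition in \<open>ProBar\<close> and all of its category laws are
  then imported from \<open>Pro\<close> instead of being proved with zigzags. Second, size: a poset
  of infinite height is infinite, so for countable \<open>'u\<close> no index poset of that kind is
  small, \<open>ProBar\<close> has no objects, and essential surjectivity fails whenever
  \<open>Pro\<close> has one. Uncountability of \<open>'u\<close> makes \<open>nat\<close> small,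
  and with it the set of finite subsets that serves as index set.\<close>

lemma category_full_subcategory:
  assumes "category D" "S \<subseteq> Ob D"
  shows "category (full_subcategory D S)"
proof -
  interpret category D by fact
  show ?thesis
    using assms(2)
    by unfold_locales
      (auto simp: full_subcategory_def Ident_in_Hom Cmp_Ident_left Cmp_Ident_right Cmp_assoc
        intro: Cmp_in_Hom split: if_splits)
qed

locale fully_faithful_functor = cat_functor C D F
  for C :: "('o1, 'm1) category" and D :: "('o2, 'm2) category"
    and F :: "('o1, 'm1, 'o2, 'm2) functor_data" +
  assumes amap_bij: "\<lbrakk>x \<in> Ob C; y \<in> Ob C\<rbrakk> \<Longrightarrow>
    bij_betw (amap F x y) (Hom C x y) (Hom D (omap F x) (omap F y))"
begin

definition lift :: "'o1 \<Rightarrow> 'o1 \<Rightarrow> 'm2 \<Rightarrow> 'm1" where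
  "lift x y = inv_into (Hom C x y) (amap F x y)"

lemma lift_in_Hom:
  "\<lbrakk>g \<in> Hom D (omap F x) (omap F y); x \<in> Ob C; y \<in> Ob C\<rbrakk> \<Longrightarrow> lift x y g \<in> Hom C x y"
  unfolding lift_def using amap_bij[of x y] by (metis bij_betw_imp_surj_on inv_into_into)

lemma amap_lift:
  "\<lbrakk>g \<in> Hom D (omap F x) (omap F y); x \<in> Ob C; y \<in> Ob C\<rbrakk> \<Longrightarrow> amap F x y (lift x y g) = g"
  unfolding lift_def using amap_bij[of x y] by (metis bij_betw_imp_surj_on f_inv_into_f)

lemma amap_inject:
  "\<lbrakk>amap F x y f = amap F x y f'; f \<in> Hom C x y; f' \<in> Hom C x y\<rbrakk> \<Longrightarrow> f = f'"
  using amap_bij[of x y] src.Hom_Ob by (metis bij_betw_imp_inj_on inj_onD)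

lemma lift_amap: "f \<in> Hom C x y \<Longrightarrow> lift x y (amap F x y f) = f"
  using src.Hom_Ob by (meson amap_Hom amap_inject amap_lift lift_in_Hom)

text \<open>Injectivity on objects gives a strict inverse on the image. On arrows the inverse is
  \<open>lift\<close>, and its composition law is checked after applying \<open>F\<close>, which is
  faithful. The isomorphism onto the subcategory is \<open>F\<close> itself with its target cut down
  to \<open>?S\<close>.\<close>

lemma full_subcategory_inclusion_upto_iso_if_inj:
  assumes inj: "inj_on (omap F) (Ob C)"
  shows "full_subcategory_inclusion_upto_iso C D F"
proof -
  let ?S = "omap F ` Ob C"
  let ?D = "full_subcategory D ?S"
  let ?g = "inv_into (Ob C) (omap F)"
  let ?G = "\<lparr>omap = ?g, amap = (\<lambda>x y. lift (?g x) (?g y))\<rparr>"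
  have S: "?S \<subseteq> Ob D" by (auto intro: omap_Ob)
  have D': "category ?D" by (rule category_full_subcategory[OF tgt.category_axioms S])
  have gF: "?g (omap F x) = x" if "x \<in> Ob C" for x using inj that by simp
  have Fg: "omap F (?g x) = x" "?g x \<in> Ob C" if "x \<in> ?S" for x
    using that by (auto simp: inj)
  have F: "cat_functor C ?D F"
    using src.Hom_Ob amap_Hom
    by (intro cat_functor.intro D' src.category_axioms cat_functor_axioms.intro)
      (auto simp: full_subcategory_def amap_Ident amap_Cmp split: if_splits)
  have G: "cat_functor ?D C ?G"
  proof (intro cat_functor.intro D' src.category_axioms cat_functor_axioms.intro)
    fix x y z f h assume "f \<in> Hom ?D x y" "h \<in> Hom ?D y z"
    then have S: "x \<in> ?S" "y \<in> ?S" "z \<in> ?S" and f: "f \<in> Hom D x y" and h: "h \<in> Hom D y z"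
      by (auto simp: full_subcategory_def split: if_splits)
    have lf: "lift (?g x) (?g y) f \<in> Hom C (?g x) (?g y)"
      and lh: "lift (?g y) (?g z) h \<in> Hom C (?g y) (?g z)"
      using f h S by (simp_all only: lift_in_Hom Fg)
    have "lift (?g x) (?g z) (Cmp D x y z h f) =
        Cmp C (?g x) (?g y) (?g z) (lift (?g y) (?g z) h) (lift (?g x) (?g y) f)"
    proof (rule amap_inject[of "?g x" "?g z"])
      show "Cmp C (?g x) (?g y) (?g z) (lift (?g y) (?g z) h) (lift (?g x) (?g y) f) \<in> Hom C (?g x) (?g z)"
        using lf lh by (rule src.Cmp_in_Hom)
      have c: "Cmp D x y z h f \<in> Hom D (omap F (?g x)) (omap F (?g z))"
        using f h S by (simp only: Fg tgt.Cmp_in_Hom)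
      show "lift (?g x) (?g z) (Cmp D x y z h f) \<in> Hom C (?g x) (?g z)"
        using c S by (simp only: lift_in_Hom Fg)
      show "amap F (?g x) (?g z) (lift (?g x) (?g z) (Cmp D x y z h f)) = amap F (?g x) (?g z)
          (Cmp C (?g x) (?g y) (?g z) (lift (?g y) (?g z) h) (lift (?g x) (?g y) f))"
        using f h S c by (simp only: amap_Cmp[OF lf lh] amap_lift Fg)
    qed
    then show "amap ?G x z (Cmp ?D x y z h f) =
        Cmp C (omap ?G x) (omap ?G y) (omap ?G z) (amap ?G y z h) (amap ?G x y f)"
      by (simp add: full_subcategory_def)
  next
    fix x assume "x \<in> Ob ?D"
    then have x: "x \<in> ?S" by (simp add: full_subcategory_def)
    then show "omap ?G x \<in> Ob C" using Fg(2)[OF x] by simp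
    have "lift (?g x) (?g x) (Ident D x) = Ident C (?g x)"
      using lift_amap[OF src.Ident_in_Hom[OF Fg(2)[OF x]]] amap_Ident[OF Fg(2)[OF x]] Fg(1)[OF x] by simp
    then show "amap ?G x x (Ident ?D x) = Ident C (omap ?G x)" by (simp add: full_subcategory_def)
  next
    fix x y f assume "f \<in> Hom ?D x y"
    then have "x \<in> ?S" "y \<in> ?S" "f \<in> Hom D x y"
      by (auto simp: full_subcategory_def split: if_splits)
    then show "amap ?G x y f \<in> Hom C (omap ?G x) (omap ?G y)"
      by (simp only: functor_data.simps lift_in_Hom Fg)
  qed
  have "functor_eq C (functor_comp ?G F) functor_id"
    by (auto simp: functor_eq_def functor_comp_def functor_id_def gF lift_amap)
  moreover have "functor_eq ?D (functor_comp F ?G) functor_id"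
    unfolding functor_eq_def functor_comp_def functor_id_def functor_data.simps
  proof (intro conjI ballI)
    fix x assume "x \<in> Ob ?D"
    then show "omap F (?g x) = x" by (simp only: full_subcategory_def category.simps Fg)
  next
    fix x y f assume "f \<in> Hom ?D x y"
    then have "x \<in> ?S" "y \<in> ?S" "f \<in> Hom D x y"
      by (auto simp: full_subcategory_def split: if_splits)
    then show "amap F (?g x) (?g y) (lift (?g x) (?g y) f) = f"
      by (simp only: amap_lift Fg)
  qed
  ultimately have "category_isomorphism C ?D F"
    unfolding category_isomorphism_def using F G by blast
  moreover have "functor_eq C F (functor_comp functor_id F)"
    by (simp add: functor_eq_def functor_comp_def functor_id_def)
  ultimately show ?thesis
    unfolding full_subcategory_inclusion_upto_iso_def
    using S cat_functor_axioms by blast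
qed

text \<open>Full faithfulness reflects isomorphisms: the inverse is lifted as well, and both
  equations hold because they hold after applying \<open>F\<close>.\<close>

lemma iso_arrow_lift:
  assumes e: "iso_arrow D (omap F x) (omap F y) e" and x: "x \<in> Ob C" and y: "y \<in> Ob C"
  shows "iso_arrow C x y (lift x y e)"
proof -
  from e obtain e' where e1: "e \<in> Hom D (omap F x) (omap F y)"
    and e2: "e' \<in> Hom D (omap F y) (omap F x)"
    and e3: "Cmp D (omap F x) (omap F y) (omap F x) e' e = Ident D (omap F x)"
    and e4: "Cmp D (omap F y) (omap F x) (omap F y) e e' = Ident D (omap F y)"
    unfolding iso_arrow_def by blast
  have l: "lift x y e \<in> Hom C x y" "lift y x e' \<in> Hom C y x"
    using e1 e2 x y by (auto intro: lift_in_Hom)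
  have "Cmp C x y x (lift y x e') (lift x y e) = Ident C x"
    by (rule amap_inject[OF _ src.Cmp_in_Hom[OF l] src.Ident_in_Hom[OF x]])
      (simp add: amap_Cmp[OF l] amap_lift e1 e2 e3 x y amap_Ident)
  moreover have "Cmp C y x y (lift x y e) (lift y x e') = Ident C y"
    by (rule amap_inject[OF _ src.Cmp_in_Hom[OF l(2,1)] src.Ident_in_Hom[OF y]])
      (simp add: amap_Cmp[OF l(2,1)] amap_lift e1 e2 e4 x y amap_Ident)
  ultimately show ?thesis unfolding iso_arrow_def using l by blast
qed

text \<open>The quasi-inverse picks for each object \<open>d\<close> some \<open>c d\<close> whose
  image is isomorphic to \<open>d\<close>, transports arrows along the chosen isomorphisms and lifts
  the result.\<close>

lemma equivalence_if_essentially_surjective: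
  assumes "essentially_surjective C D F"
  shows "equivalence_of_categories C D F"
proof -
  have "\<forall>d\<in>Ob D. \<exists>c e e'. c \<in> Ob C \<and> e \<in> Hom D (omap F c) d \<and> e' \<in> Hom D d (omap F c) \<and>
      Cmp D (omap F c) d (omap F c) e' e = Ident D (omap F c) \<and>
      Cmp D d (omap F c) d e e' = Ident D d"
    using assms unfolding essentially_surjective_def isomorphic_objects_def iso_arrow_def by blast
  then obtain c e e' where c: "\<And>d. d \<in> Ob D \<Longrightarrow> c d \<in> Ob C"
    and e: "\<And>d. d \<in> Ob D \<Longrightarrow> e d \<in> Hom D (omap F (c d)) d"
    and e': "\<And>d. d \<in> Ob D \<Longrightarrow> e' d \<in> Hom D d (omap F (c d))"
    and e'e: "\<And>d. d \<in> Ob D \<Longrightarrow> Cmp D (omap F (c d)) d (omap F (c d)) (e' d) (e d) = Ident D (omap F (c d))"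
    and ee': "\<And>d. d \<in> Ob D \<Longrightarrow> Cmp D d (omap F (c d)) d (e d) (e' d) = Ident D d"
    by metis
  \<comment> \<open>\<open>k x y f\<close> is \<open>f\<close> conjugated by the chosen
    isomorphisms; it runs between objects in the image of \<open>F\<close>, so it has a
    lift.\<close>
  define k where "k x y f = Cmp D (omap F (c x)) y (omap F (c y)) (e' y) (Cmp D (omap F (c x)) x y f (e x))" for x y f
  define G where "G = \<lparr>omap = c, amap = (\<lambda>x y f. lift (c x) (c y) (k x y f))\<rparr>"
  have kH: "k x y f \<in> Hom D (omap F (c x)) (omap F (c y))" if "f \<in> Hom D x y" for x y f
    unfolding k_def using that tgt.Hom_Ob[OF that] by (intro tgt.Cmp_in_Hom e e') auto
  \<comment> \<open>Naturality of \<open>e\<close>, which becomes the counit. The analogous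
    \<open>ke'\<close> serves both the composition law of \<open>k\<close> and the unit.\<close>
  have ek: "Cmp D (omap F (c x)) (omap F (c y)) y (e y) (k x y f) = Cmp D (omap F (c x)) x y f (e x)"
    if "f \<in> Hom D x y" for x y f
  proof -
    have o: "x \<in> Ob D" "y \<in> Ob D" using tgt.Hom_Ob[OF that] by auto
    show ?thesis unfolding k_def
      using o that by (simp add: tgt.Cmp_assoc[symmetric, OF tgt.Cmp_in_Hom[OF e that] e' e]
        ee' tgt.Cmp_Ident_left tgt.Cmp_in_Hom[OF e])
  qed
  have ke': "Cmp D x (omap F (c x)) (omap F (c y)) (k x y f) (e' x) = Cmp D x y (omap F (c y)) (e' y) f"
    if f: "f \<in> Hom D x y" for x y f
  proof -
    have o: "x \<in> Ob D" "y \<in> Ob D" using tgt.Hom_Ob[OF f] by auto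
    have "Cmp D x (omap F (c x)) (omap F (c y)) (k x y f) (e' x) =
      Cmp D x y (omap F (c y)) (e' y) (Cmp D x (omap F (c x)) y (Cmp D (omap F (c x)) x y f (e x)) (e' x))"
      unfolding k_def using o by (intro tgt.Cmp_assoc tgt.Cmp_in_Hom f e e') auto
    also have "Cmp D x (omap F (c x)) y (Cmp D (omap F (c x)) x y f (e x)) (e' x) = f"
      using o f by (simp add: tgt.Cmp_assoc[OF e' e f] ee' tgt.Cmp_Ident_right)
    finally show ?thesis .
  qed
  have kC: "k x z (Cmp D x y z g f) = Cmp D (omap F (c x)) (omap F (c y)) (omap F (c z)) (k y z g) (k x y f)"
    if f: "f \<in> Hom D x y" and g: "g \<in> Hom D y z" for x y z f g
  proof -
    have o: "x \<in> Ob D" "y \<in> Ob D" "z \<in> Ob D" using tgt.Hom_Ob[OF f] tgt.Hom_Ob[OF g] by auto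
    note ex = e[OF o(1)] and ey' = e'[OF o(2)] and fe = tgt.Cmp_in_Hom[OF e[OF o(1)] f]
    have "Cmp D (omap F (c x)) (omap F (c y)) (omap F (c z)) (k y z g) (k x y f) =
      Cmp D (omap F (c x)) y (omap F (c z))
        (Cmp D y (omap F (c y)) (omap F (c z)) (k y z g) (e' y)) (Cmp D (omap F (c x)) x y f (e x))"
      by (subst (2) k_def) (rule tgt.Cmp_assoc[symmetric, OF fe ey' kH[OF g]])
    also have "\<dots> = Cmp D (omap F (c x)) y (omap F (c z)) (Cmp D y z (omap F (c z)) (e' z) g)
        (Cmp D (omap F (c x)) x y f (e x))"
      by (simp add: ke'[OF g])
    also have "\<dots> = Cmp D (omap F (c x)) z (omap F (c z)) (e' z)
        (Cmp D (omap F (c x)) y z g (Cmp D (omap F (c x)) x y f (e x)))"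
      by (rule tgt.Cmp_assoc[OF fe g e'[OF o(3)]])
    also have "\<dots> = k x z (Cmp D x y z g f)"
      unfolding k_def by (simp add: tgt.Cmp_assoc[OF ex f g])
    finally show ?thesis by simp
  qed
  have kI: "k x x (Ident D x) = Ident D (omap F (c x))" if "x \<in> Ob D" for x
    unfolding k_def using that by (simp add: tgt.Cmp_Ident_left[OF e] e'e)
  have GH: "lift (c x) (c y) (k x y f) \<in> Hom C (c x) (c y)" if "f \<in> Hom D x y" for x y f
    using that tgt.Hom_Ob[OF that] by (auto intro: lift_in_Hom kH c)
  have FG: "amap F (c x) (c y) (lift (c x) (c y) (k x y f)) = k x y f" if "f \<in> Hom D x y" for x y f
    using that tgt.Hom_Ob[OF that] by (auto intro: amap_lift kH c)
  have G: "cat_functor D C G"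
  proof (intro cat_functor.intro src.category_axioms tgt.category_axioms cat_functor_axioms.intro)
    fix x y z f g assume f: "f \<in> Hom D x y" and g: "g \<in> Hom D y z"
    note fg = tgt.Cmp_in_Hom[OF f g]
    have "lift (c x) (c z) (k x z (Cmp D x y z g f)) =
      Cmp C (c x) (c y) (c z) (lift (c y) (c z) (k y z g)) (lift (c x) (c y) (k x y f))"
      by (rule amap_inject[OF _ GH[OF fg] src.Cmp_in_Hom[OF GH[OF f] GH[OF g]]])
        (simp add: amap_Cmp[OF GH[OF f] GH[OF g]] FG f g fg kC[OF f g, symmetric])
    then show "amap G x z (Cmp D x y z g f) = Cmp C (omap G x) (omap G y) (omap G z) (amap G y z g) (amap G x y f)"
      by (simp add: G_def)
  next
    fix x assume x: "x \<in> Ob D"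
    have "lift (c x) (c x) (Ident D (omap F (c x))) = Ident C (c x)"
      using lift_amap[OF src.Ident_in_Hom[OF c[OF x]]] amap_Ident[OF c[OF x]] by simp
    with x show "amap G x x (Ident D x) = Ident C (omap G x)" by (simp add: G_def kI)
  qed (auto simp: G_def c GH)
  have "iso_arrow D (omap F (c d)) d (e d)" if "d \<in> Ob D" for d
    unfolding iso_arrow_def using that e e' e'e ee' by blast
  then have "naturally_isomorphic D D (functor_comp F G) functor_id"
    unfolding naturally_isomorphic_def nat_trans_def
    by (intro exI[of _ e]) (auto simp: functor_comp_def functor_id_def G_def FG ek e)
  moreover have "naturally_isomorphic C C functor_id (functor_comp G F)"
  proof -
    \<comment> \<open>The unit is the lift of \<open>e'\<close> at the image of \<open>x\<close>;
      applying \<open>F\<close> turns its naturality square into \<open>ke'\<close>.\<close>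
    define u where "u x = lift x (c (omap F x)) (e' (omap F x))" for x
    have iso_e': "iso_arrow D d (omap F (c d)) (e' d)" if "d \<in> Ob D" for d
      unfolding iso_arrow_def using that e e' e'e ee' by blast
    have iso_u: "iso_arrow C x (c (omap F x)) (u x)" if "x \<in> Ob C" for x
      unfolding u_def using that by (intro iso_arrow_lift iso_e' omap_Ob c)
    then have uH: "u x \<in> Hom C x (c (omap F x))" if "x \<in> Ob C" for x
      using that unfolding iso_arrow_def by blast
    have Fu: "amap F x (c (omap F x)) (u x) = e' (omap F x)" if "x \<in> Ob C" for x
      unfolding u_def using that by (intro amap_lift e' c omap_Ob)
    have "Cmp C x y (c (omap F y)) (u y) f = Cmp C x (c (omap F x)) (c (omap F y))
        (lift (c (omap F x)) (c (omap F y)) (k (omap F x) (omap F y) (amap F x y f))) (u x)"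
      if f: "f \<in> Hom C x y" for x y f
    proof -
      have o: "x \<in> Ob C" "y \<in> Ob C" using src.Hom_Ob[OF f] by auto
      note Ff = amap_Hom[OF f]
      show ?thesis
        by (rule amap_inject[OF _ src.Cmp_in_Hom[OF f uH[OF o(2)]] src.Cmp_in_Hom[OF uH[OF o(1)] GH[OF Ff]]])
          (simp add: amap_Cmp[OF f uH[OF o(2)]] amap_Cmp[OF uH[OF o(1)] GH[OF Ff]] Fu o FG[OF Ff] ke'[OF Ff])
    qed
    then show ?thesis
      unfolding naturally_isomorphic_def nat_trans_def
      by (intro exI[of _ u]) (auto simp: functor_comp_def functor_id_def G_def uH iso_u)
  qed
  ultimately show ?thesis
    unfolding equivalence_of_categories_def using cat_functor_axioms G by blast
qed

end

section \<open>Filtered colimits of hom-sets\<close>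

lemma equiv_generated_equiv: "equiv S (generated_equiv S R)"
proof -
  define Q where "Q = R \<inter> S \<times> S"
  have "sym ((Q \<union> Q\<inverse>)\<^sup>*)" by (rule sym_rtrancl) (auto simp: sym_def)
  then have "equiv S ((Q \<union> Q\<inverse>)\<^sup>* \<inter> S \<times> S)"
    by (auto intro!: equivI refl_onI symI transI elim: symE)
  then show ?thesis by (simp add: generated_equiv_def Q_def Let_def)
qed

lemma generated_equivI: "\<lbrakk>(x, y) \<in> R; x \<in> S; y \<in> S\<rbrakk> \<Longrightarrow> (x, y) \<in> generated_equiv S R"
  by (auto simp: generated_equiv_def Let_def)

text \<open>Bounds a generated relation by an explicit equivalence relation containing the
  generators. Both the colimit relation and the connected components of pre morphisms are determined
  in this way.\<close>

lemma generated_equiv_least: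
  assumes E: "equiv S E" and R: "R \<inter> S \<times> S \<subseteq> E"
  shows "generated_equiv S R \<subseteq> E"
proof -
  define Q where "Q = R \<inter> S \<times> S"
  have QE: "Q \<union> Q\<inverse> \<subseteq> E" using R E by (auto simp: Q_def equiv_def sym_def)
  have "(x, y) \<in> E" if "(x, y) \<in> (Q \<union> Q\<inverse>)\<^sup>*" "x \<in> S" for x y
    using that
  proof (induction rule: rtrancl_induct)
    case base
    then show ?case using E by (simp add: equiv_def refl_on_def)
  next
    case (step y z)
    then show ?case using QE E unfolding equiv_def trans_def by blast
  qed
  then show ?thesis by (auto simp: generated_equiv_def Q_def Let_def)
qed

section \<open>Colimits over directed index categories\<close>

locale directed_diagram = cat_functor I C X
  for I :: "('u, 'u) category" and C :: "('o, 'm) category" and X +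
  assumes directed: "directed_category I"
begin

abbreviation pull :: "'o \<Rightarrow> 'u \<Rightarrow> 'u \<Rightarrow> 'm \<Rightarrow> 'u \<Rightarrow> 'm" where
  "pull y t' t f h \<equiv> Cmp C (omap X t') (omap X t) y f (amap X t' t h)"

abbreviation points :: "'o \<Rightarrow> ('u \<times> 'm) set" where
  "points \<equiv> colim_points C I X"

abbreviation cls :: "'o \<Rightarrow> 'u \<Rightarrow> 'm \<Rightarrow> ('u \<times> 'm) set" where
  "cls \<equiv> colim_class C I X"

lemma ex_span:
  assumes "s \<in> Ob I" "t \<in> Ob I"
  obtains u h k where "h \<in> Hom I u s" "k \<in> Hom I u t"
  using directed assms unfolding directed_category_def by (metis all_not_in_conv)

lemma ex_equalizing:
  assumes "f \<in> Hom I s t" "g \<in> Hom I s t"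
  obtains u h where "h \<in> Hom I u s" "Cmp I u s t f h = Cmp I u s t g h"
  using directed assms src.Hom_Ob[OF assms(1)] unfolding directed_category_def by metis

lemma points_iff: "(t, f) \<in> points y \<longleftrightarrow> t \<in> Ob I \<and> f \<in> Hom C (omap X t) y"
  by (simp add: colim_points_def)

lemma pull_in_Hom:
  "\<lbrakk>f \<in> Hom C (omap X t) y; h \<in> Hom I t' t\<rbrakk> \<Longrightarrow> pull y t' t f h \<in> Hom C (omap X t') y"
  by (intro tgt.Cmp_in_Hom amap_Hom)

lemma pull_in_points:
  "\<lbrakk>f \<in> Hom C (omap X t) y; h \<in> Hom I t' t\<rbrakk> \<Longrightarrow> (t', pull y t' t f h) \<in> points y"
  using src.Hom_Ob by (auto simp: points_iff pull_in_Hom)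

lemma pull_pull:
  assumes "f \<in> Hom C (omap X t) y" "h \<in> Hom I t' t" "k \<in> Hom I t'' t'"
  shows "pull y t'' t' (pull y t' t f h) k = pull y t'' t f (Cmp I t'' t' t h k)"
  using assms by (simp add: amap_Cmp tgt.Cmp_assoc[OF amap_Hom amap_Hom])

lemma post_pull:
  assumes "f \<in> Hom C (omap X t) y" "h \<in> Hom I t' t" "g \<in> Hom C y y'"
  shows "Cmp C (omap X t') y y' g (pull y t' t f h) = pull y' t' t (Cmp C (omap X t) y y' g f) h"
  using assms by (simp add: tgt.Cmp_assoc[OF amap_Hom])

text \<open>The standard description of a filtered colimit: representatives are related iff they
  agree after restriction to a common index. The two legs form a span in \<open>I\<close>, which
  becomes a cospan of hom-sets because Hom into \<open>y\<close> is contravariant.\<close>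

definition cospan_rel :: "'o \<Rightarrow> ('u \<times> 'm) rel" where
  "cospan_rel y = {((t, f), (t', f')) | t f t' f'. (t, f) \<in> points y \<and> (t', f') \<in> points y \<and>
    (\<exists>u. \<exists>h\<in>Hom I u t. \<exists>h'\<in>Hom I u t'. pull y u t f h = pull y u t' f' h')}"

lemma equiv_cospan_rel: "equiv (points y) (cospan_rel y)"
proof (rule equivI)
  show "cospan_rel y \<subseteq> points y \<times> points y" by (auto simp: cospan_rel_def)
  show "refl_on (points y) (cospan_rel y)"
    unfolding refl_on_def cospan_rel_def by (auto simp: points_iff) (blast intro: src.Ident_in_Hom)
  show "sym (cospan_rel y)"
    by (rule symI) (simp add: cospan_rel_def split_paired_all, metis)
  show "trans (cospan_rel y)"
  proof (rule transI)
    fix p p' p'' assume "(p, p') \<in> cospan_rel y" "(p', p'') \<in> cospan_rel y"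
    moreover obtain t f t' f' t'' f'' where p: "p = (t, f)" "p' = (t', f')" "p'' = (t'', f'')"
      by (metis prod.exhaust)
    ultimately obtain u h h' v k k' where P: "(t, f) \<in> points y" "(t', f') \<in> points y" "(t'', f'') \<in> points y"
      and h: "h \<in> Hom I u t" "h' \<in> Hom I u t'" "pull y u t f h = pull y u t' f' h'"
      and k: "k \<in> Hom I v t'" "k' \<in> Hom I v t''" "pull y v t' f' k = pull y v t'' f'' k'"
      unfolding cospan_rel_def by blast
    have f: "f \<in> Hom C (omap X t) y" "f' \<in> Hom C (omap X t') y" "f'' \<in> Hom C (omap X t'') y"
      using P by (auto simp: points_iff)
    obtain w a b where a: "a \<in> Hom I w u" and b: "b \<in> Hom I w v"
      using ex_span h(1) k(1) src.Hom_Ob by metis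
    \<comment> \<open>The composites from \<open>w\<close> to \<open>t'\<close> through
      \<open>u\<close> and through \<open>v\<close> may differ. An arrow equalizing them allows the
      two agreements at \<open>t'\<close> to be chained.\<close>
    obtain x e where e: "e \<in> Hom I x w"
      and eq: "Cmp I x w t' (Cmp I w u t' h' a) e = Cmp I x w t' (Cmp I w v t' k b) e"
      using ex_equalizing[OF src.Cmp_in_Hom[OF a h(2)] src.Cmp_in_Hom[OF b k(1)]] by metis
    have *: "pull y x w (pull y w u' (pull y u' t0 f0 h0) a0) e =
        pull y x t0 f0 (Cmp I x w t0 (Cmp I w u' t0 h0 a0) e)"
      if "f0 \<in> Hom C (omap X t0) y" "h0 \<in> Hom I u' t0" "a0 \<in> Hom I w u'" for u' t0 f0 h0 a0
      using that e by (simp add: pull_pull pull_in_Hom src.Cmp_in_Hom)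
    have "pull y x t f (Cmp I x w t (Cmp I w u t h a) e) =
        pull y x t'' f'' (Cmp I x w t'' (Cmp I w v t'' k' b) e)"
      using *[OF f(1) h(1) a] *[OF f(2) h(2) a] *[OF f(2) k(1) b] *[OF f(3) k(2) b] h(3) k(3) eq
      by simp
    moreover have "Cmp I x w t (Cmp I w u t h a) e \<in> Hom I x t"
      "Cmp I x w t'' (Cmp I w v t'' k' b) e \<in> Hom I x t''"
      using h k a b e by (auto intro: src.Cmp_in_Hom)
    ultimately show "(p, p'') \<in> cospan_rel y"
      unfolding cospan_rel_def using p P by blast
  qed
qed

text \<open>A generator is a common restriction one of whose legs is an identity; conversely, a
  common restriction is reached from each end by one generator.\<close>

lemma colim_equiv_eq: "colim_equiv C I X y = cospan_rel y"
proof
  let ?R = "{((t, f), (t', pull y t' t f h)) | t f t' h. f \<in> Hom C (omap X t) y \<and> h \<in> Hom I t' t}"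
  show "colim_equiv C I X y \<subseteq> cospan_rel y"
    unfolding colim_equiv_def
  proof (rule generated_equiv_least[OF equiv_cospan_rel], clarify)
    fix t f t' h
    assume *: "(t, f) \<in> points y" "(t', pull y t' t f h) \<in> points y"
      "f \<in> Hom C (omap X t) y" "h \<in> Hom I t' t"
    have i: "Ident I t' \<in> Hom I t' t'" using * by (auto simp: points_iff src.Ident_in_Hom)
    have "pull y t' t f h = pull y t' t' (pull y t' t f h) (Ident I t')"
      using * i by (simp add: pull_pull src.Cmp_Ident_right)
    then show "((t, f), (t', pull y t' t f h)) \<in> cospan_rel y"
      unfolding cospan_rel_def using * i by blast
  qed
  show "cospan_rel y \<subseteq> colim_equiv C I X y"
  proof
    fix z assume "z \<in> cospan_rel y"
    then obtain t f t' f' u h h' where z: "z = ((t, f), (t', f'))"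
      and P: "(t, f) \<in> points y" "(t', f') \<in> points y"
      and h: "h \<in> Hom I u t" "h' \<in> Hom I u t'" and eq: "pull y u t f h = pull y u t' f' h'"
      unfolding cospan_rel_def by auto
    have *: "((t, f), (u, pull y u t f h)) \<in> colim_equiv C I X y"
      if "(t, f) \<in> points y" "h \<in> Hom I u t" for t f h
      unfolding colim_equiv_def
      using that pull_in_points by (intro generated_equivI) (auto simp: points_iff)
    have e: "sym (colim_equiv C I X y)" "trans (colim_equiv C I X y)"
      unfolding colim_equiv_def using equiv_generated_equiv by (auto simp: equiv_def)
    have "((u, pull y u t f h), (t', f')) \<in> colim_equiv C I X y"
      unfolding eq by (rule symD[OF e(1) *[OF P(2) h(2)]])
    with *[OF P(1) h(1)] show "z \<in> colim_equiv C I X y"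
      unfolding z by (rule transD[OF e(2)])
  qed
qed

lemma equiv_colim_equiv: "equiv (points y) (colim_equiv C I X y)"
  unfolding colim_equiv_eq by (rule equiv_cospan_rel)

lemma cls_eq_iff:
  assumes "(t, f) \<in> points y" "(t', f') \<in> points y"
  shows "cls y t f = cls y t' f' \<longleftrightarrow>
    (\<exists>u. \<exists>h\<in>Hom I u t. \<exists>h'\<in>Hom I u t'. pull y u t f h = pull y u t' f' h')"
proof -
  have "cls y t f = cls y t' f' \<longleftrightarrow> ((t, f), (t', f')) \<in> cospan_rel y"
    unfolding colim_class_def using eq_equiv_class_iff[OF equiv_colim_equiv assms]
    by (simp add: colim_equiv_eq)
  then show ?thesis using assms by (simp add: cospan_rel_def)
qed

lemma cls_in_colim_Hom: "(t, f) \<in> points y \<Longrightarrow> cls y t f \<in> colim_Hom C I X y"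
  unfolding colim_class_def colim_Hom_def by (rule quotientI)

lemma colim_HomE:
  assumes "c \<in> colim_Hom C I X y"
  obtains t f where "(t, f) \<in> points y" "c = cls y t f"
  using assms unfolding colim_class_def colim_Hom_def by (force elim: quotientE)

lemma mem_cls: "(t, f) \<in> points y \<Longrightarrow> (t, f) \<in> cls y t f"
  unfolding colim_class_def using equiv_class_self[OF equiv_colim_equiv] by blast

lemma mem_colim_Hom:
  assumes "c \<in> colim_Hom C I X y" "(t, f) \<in> c"
  shows "(t, f) \<in> points y" "c = cls y t f"
proof -
  obtain t' f' where c: "(t', f') \<in> points y" "c = cls y t' f'"
    using assms(1) by (rule colim_HomE)
  then have *: "((t', f'), (t, f)) \<in> colim_equiv C I X y"
    using assms(2) by (simp add: colim_class_def)
  then show "(t, f) \<in> points y" by (auto simp: colim_equiv_eq cospan_rel_def)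
  show "c = cls y t f"
    unfolding c(2) colim_class_def by (rule equiv_class_eq[OF equiv_colim_equiv *])
qed

lemma cls_pull:
  assumes "f \<in> Hom C (omap X t) y" "h \<in> Hom I t' t"
  shows "cls y t' (pull y t' t f h) = cls y t f"
proof -
  have i: "Ident I t' \<in> Hom I t' t'" using assms src.Hom_Ob src.Ident_in_Hom by blast
  have "(t, f) \<in> points y" using assms src.Hom_Ob by (auto simp: points_iff)
  moreover have "pull y t' t' (pull y t' t f h) (Ident I t') = pull y t' t f h"
    using assms i by (simp add: pull_pull src.Cmp_Ident_right)
  ultimately show ?thesis
    using cls_eq_iff[OF pull_in_points[OF assms]] assms(2) i by blast
qed

text \<open>Restriction commutes with postcomposition, so all representatives of a class give the
  same value and the union in \<open>colim_post\<close> collapses.\<close>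

lemma colim_post_cls:
  assumes p: "(t, f) \<in> points y" and g: "g \<in> Hom C y y'"
  shows "colim_post C I X y y' g (cls y t f) = cls y' t (Cmp C (omap X t) y y' g f)"
proof -
  have "cls y' t' (Cmp C (omap X t') y y' g f') = cls y' t (Cmp C (omap X t) y y' g f)"
    if m: "(t', f') \<in> cls y t f" for t' f'
  proof -
    note c = mem_colim_Hom[OF cls_in_colim_Hom[OF p] m]
    obtain u h h' where h: "h \<in> Hom I u t" "h' \<in> Hom I u t'"
      and eq: "pull y u t f h = pull y u t' f' h'"
      using c(2) cls_eq_iff[OF p c(1)] by metis
    have f: "f \<in> Hom C (omap X t) y" "f' \<in> Hom C (omap X t') y"
      using p c(1) by (auto simp: points_iff)
    have gf: "Cmp C (omap X t) y y' g f \<in> Hom C (omap X t) y'"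
      "Cmp C (omap X t') y y' g f' \<in> Hom C (omap X t') y'"
      using f g by (auto intro: tgt.Cmp_in_Hom)
    show ?thesis
      using cls_pull[OF gf(1) h(1)] cls_pull[OF gf(2) h(2)] post_pull[OF f(1) h(1) g]
        post_pull[OF f(2) h(2) g] eq by simp
  qed
  then have "\<forall>(t', f')\<in>cls y t f. cls y' t' (Cmp C (omap X t') y y' g f') = cls y' t (Cmp C (omap X t) y y' g f)"
    by blast
  then show ?thesis
    unfolding colim_post_def using mem_cls[OF p] by fast
qed

lemma colim_post_in:
  assumes "c \<in> colim_Hom C I X y" "g \<in> Hom C y y'"
  shows "colim_post C I X y y' g c \<in> colim_Hom C I X y'"
  using assms(1)
  by (rule colim_HomE)
    (use assms(2) in \<open>auto simp: colim_post_cls points_iff intro!: cls_in_colim_Hom tgt.Cmp_in_Hom\<close>)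

lemma colim_post_post:
  assumes "c \<in> colim_Hom C I X y" "g \<in> Hom C y y'" "g' \<in> Hom C y' y''"
  shows "colim_post C I X y' y'' g' (colim_post C I X y y' g c) =
    colim_post C I X y y'' (Cmp C y y' y'' g' g) c"
  using assms(1)
proof (rule colim_HomE)
  fix t f assume tf: "(t, f) \<in> points y" and c: "c = cls y t f"
  then have f: "f \<in> Hom C (omap X t) y" by (simp add: points_iff)
  have "(t, Cmp C (omap X t) y y' g f) \<in> points y'"
    using tf f assms by (auto simp: points_iff intro: tgt.Cmp_in_Hom)
  then show ?thesis
    using tf f assms
    by (simp add: c colim_post_cls tgt.Cmp_in_Hom[OF assms(2,3)] tgt.Cmp_assoc[OF f assms(2,3)])
qed

lemma colim_post_Ident:
  assumes "c \<in> colim_Hom C I X y" "y \<in> Ob C"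
  shows "colim_post C I X y y (Ident C y) c = c"
  using assms(1)
  by (rule colim_HomE) (use assms(2) in
    \<open>simp add: colim_post_cls tgt.Ident_in_Hom points_iff tgt.Cmp_Ident_left\<close>)

end

section \<open>The category of pro-objects\<close>

context directed_diagram begin

lemma pro_Hom_D:
  assumes "p \<in> pro_Hom C (I, X) (J, Y)"
  shows "s \<in> Ob J \<Longrightarrow> p s \<in> colim_Hom C I X (omap Y s)"
    and "\<lbrakk>s \<in> Ob J; s' \<in> Ob J; k \<in> Hom J s s'\<rbrakk> \<Longrightarrow>
      colim_post C I X (omap Y s) (omap Y s') (amap Y s s' k) (p s) = p s'"
    and "p \<in> extensional (Ob J)"
  using assms unfolding pro_Hom_def by (auto simp: PiE_iff)

lemma pro_Hom_ext:
  assumes "p \<in> pro_Hom C (I, X) (J, Y)" "q \<in> pro_Hom C (I, X) (J, Y)"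
    and "\<And>s. s \<in> Ob J \<Longrightarrow> p s = q s"
  shows "p = q"
  using extensionalityI[OF pro_Hom_D(3)[OF assms(1)] pro_Hom_D(3)[OF assms(2)]] assms(3) .

lemma pro_Hom_repE:
  assumes "p \<in> pro_Hom C (I, X) (J, Y)" "s \<in> Ob J"
  obtains t f where "t \<in> Ob I" "f \<in> Hom C (omap X t) (omap Y s)" "p s = cls (omap Y s) t f"
  using colim_HomE[OF pro_Hom_D(1)[OF assms]] points_iff by metis

lemma pro_Ident_in_pro_Hom: "pro_Ident C (I, X) \<in> pro_Hom C (I, X) (I, X)"
proof -
  have "colim_post C I X (omap X s) (omap X s') (amap X s s' k) (cls (omap X s) s (Ident C (omap X s))) =
      cls (omap X s') s' (Ident C (omap X s'))"
    if "s \<in> Ob I" "s' \<in> Ob I" and k: "k \<in> Hom I s s'" for s s' k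
  proof -
    have "cls (omap X s') s (pull (omap X s') s s' (Ident C (omap X s')) k) =
        cls (omap X s') s' (Ident C (omap X s'))"
      using that by (intro cls_pull tgt.Ident_in_Hom omap_Ob)
    then show ?thesis
      using that amap_Hom[OF k]
      by (simp add: colim_post_cls points_iff tgt.Ident_in_Hom omap_Ob
          tgt.Cmp_Ident_left tgt.Cmp_Ident_right)
  qed
  then show ?thesis
    by (auto simp: pro_Hom_def pro_Ident_def points_iff
      intro!: cls_in_colim_Hom tgt.Ident_in_Hom omap_Ob)
qed

text \<open>The union in \<open>pro_Cmp\<close> runs over all representatives of \<open>q r\<close>.
  Restricting \<open>g\<close> along an arrow \<open>h\<close> moves the evaluation to another
  component of \<open>p\<close>, and compatibility of \<open>p\<close> along \<open>h\<close>
  cancels the change, so one representative suffices.\<close>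

lemma pro_Cmp_apply:
  assumes Y: "directed_diagram J C Y" and p: "p \<in> pro_Hom C (I, X) (J, Y)"
    and s: "s \<in> Ob J" and g: "g \<in> Hom C (omap Y s) (omap Z r)" and r: "r \<in> Ob K"
    and q: "q r = colim_class C J Y (omap Z r) s g"
  shows "pro_Cmp C (I, X) (J, Y) (K, Z) q p r = colim_post C I X (omap Y s) (omap Z r) g (p s)"
proof -
  interpret Y: directed_diagram J C Y by fact
  have sg: "(s, g) \<in> Y.points (omap Z r)" using s g by (simp add: Y.points_iff)
  have pull: "colim_post C I X (omap Y u) (omap Z r) (Y.pull (omap Z r) u t f h) (p u) =
      colim_post C I X (omap Y t) (omap Z r) f (p t)"
    if "f \<in> Hom C (omap Y t) (omap Z r)" "h \<in> Hom J u t" for t f u h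
  proof -
    have o: "u \<in> Ob J" "t \<in> Ob J" using that Y.src.Hom_Ob by auto
    show ?thesis
      using colim_post_post[OF pro_Hom_D(1)[OF p o(1)] Y.amap_Hom[OF that(2)] that(1)]
        pro_Hom_D(2)[OF p o that(2)] by simp
  qed
  have "colim_post C I X (omap Y s') (omap Z r) g' (p s') = colim_post C I X (omap Y s) (omap Z r) g (p s)"
    if m: "(s', g') \<in> q r" for s' g'
  proof -
    note c = Y.mem_colim_Hom[OF Y.cls_in_colim_Hom[OF sg] m[unfolded q]]
    have g': "g' \<in> Hom C (omap Y s') (omap Z r)" using c(1) by (simp add: Y.points_iff)
    obtain u h h' where h: "h \<in> Hom J u s" "h' \<in> Hom J u s'"
      and eq: "Y.pull (omap Z r) u s g h = Y.pull (omap Z r) u s' g' h'"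
      using c(2) Y.cls_eq_iff[OF sg c(1)] by metis
    show ?thesis using pull[OF g h(1)] pull[OF g' h(2)] eq by simp
  qed
  then have "\<forall>(s', g')\<in>q r. colim_post C I X (omap Y s') (omap Z r) g' (p s') =
      colim_post C I X (omap Y s) (omap Z r) g (p s)"
    by blast
  then have "(\<Union>(s', g')\<in>q r. colim_post C I X (omap Y s') (omap Z r) g' (p s')) =
      colim_post C I X (omap Y s) (omap Z r) g (p s)"
    using Y.mem_cls[OF sg] q by fast
  then show ?thesis using r by (simp add: pro_Cmp_def)
qed

lemma pro_Cmp_in_pro_Hom:
  assumes Y: "directed_diagram J C Y" and Z: "cat_functor K C Z"
    and p: "p \<in> pro_Hom C (I, X) (J, Y)" and q: "q \<in> pro_Hom C (J, Y) (K, Z)"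
  shows "pro_Cmp C (I, X) (J, Y) (K, Z) q p \<in> pro_Hom C (I, X) (K, Z)"
proof -
  interpret Y: directed_diagram J C Y by fact
  interpret Z: cat_functor K C Z by fact
  let ?c = "pro_Cmp C (I, X) (J, Y) (K, Z) q p"
  have "?c r \<in> colim_Hom C I X (omap Z r)" if r: "r \<in> Ob K" for r
  proof -
    obtain s g where *: "s \<in> Ob J" "g \<in> Hom C (omap Y s) (omap Z r)" "q r = Y.cls (omap Z r) s g"
      using Y.pro_Hom_repE[OF q r] .
    show ?thesis
      using pro_Cmp_apply[where Z = Z and q = q and K = K, OF Y p *(1,2) r *(3)]
        colim_post_in[OF pro_Hom_D(1)[OF p *(1)] *(2)] by simp
  qed
  moreover have "colim_post C I X (omap Z r) (omap Z r') (amap Z r r' k) (?c r) = ?c r'"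
    if r: "r \<in> Ob K" "r' \<in> Ob K" and k: "k \<in> Hom K r r'" for r r' k
  proof -
    obtain s g where *: "s \<in> Ob J" "g \<in> Hom C (omap Y s) (omap Z r)" "q r = Y.cls (omap Z r) s g"
      using Y.pro_Hom_repE[OF q r(1)] .
    note kH = Z.amap_Hom[OF k]
    \<comment> \<open>Compatibility of \<open>q\<close> shows that \<open>g\<close> followed by the
      image of \<open>k\<close> represents the component at \<open>r'\<close>, so both sides of the
      goal are images of the same \<open>p s\<close>.\<close>
    have "q r' = Y.cls (omap Z r') s (Cmp C (omap Y s) (omap Z r) (omap Z r') (amap Z r r' k) g)"
      using Y.pro_Hom_D(2)[OF q r k] * kH by (simp add: Y.colim_post_cls Y.points_iff)
    from pro_Cmp_apply[where Z = Z and q = q and K = K, OF Y p *(1) tgt.Cmp_in_Hom[OF *(2) kH] r(2) this]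
    show ?thesis
      using pro_Cmp_apply[where Z = Z and q = q and K = K, OF Y p *(1,2) r(1) *(3)]
        colim_post_post[OF pro_Hom_D(1)[OF p *(1)] *(2) kH] by simp
  qed
  moreover have "?c \<in> extensional (Ob K)" by (simp add: pro_Cmp_def)
  ultimately show ?thesis
    by (auto simp: pro_Hom_def PiE_iff)
qed

lemma pro_Cmp_Ident_left:
  assumes Y: "directed_diagram J C Y" and p: "p \<in> pro_Hom C (I, X) (J, Y)"
  shows "pro_Cmp C (I, X) (J, Y) (J, Y) (pro_Ident C (J, Y)) p = p"
proof -
  interpret Y: directed_diagram J C Y by fact
  note c = pro_Cmp_in_pro_Hom[OF Y Y.cat_functor_axioms p Y.pro_Ident_in_pro_Hom]
  show ?thesis
  proof (rule pro_Hom_ext[OF c p])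
    fix s assume s: "s \<in> Ob J"
    have "pro_Ident C (J, Y) s = Y.cls (omap Y s) s (Ident C (omap Y s))"
      using s by (simp add: pro_Ident_def)
    from pro_Cmp_apply[where q = "pro_Ident C (J, Y)" and Z = Y and K = J,
        OF Y p s tgt.Ident_in_Hom[OF Y.omap_Ob[OF s]] s this]
    show "pro_Cmp C (I, X) (J, Y) (J, Y) (pro_Ident C (J, Y)) p s = p s"
      using colim_post_Ident[OF pro_Hom_D(1)[OF p s] Y.omap_Ob[OF s]] by simp
  qed
qed

lemma pro_Cmp_Ident_right:
  assumes Y: "cat_functor J C Y" and p: "p \<in> pro_Hom C (I, X) (J, Y)"
  shows "pro_Cmp C (I, X) (I, X) (J, Y) p (pro_Ident C (I, X)) = p"
proof -
  note X = directed_diagram_axioms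
  note c = pro_Cmp_in_pro_Hom[OF X Y pro_Ident_in_pro_Hom p]
  show ?thesis
  proof (rule pro_Hom_ext[OF c p])
    fix s assume s: "s \<in> Ob J"
    obtain t f where *: "t \<in> Ob I" "f \<in> Hom C (omap X t) (omap Y s)" "p s = cls (omap Y s) t f"
      using pro_Hom_repE[OF p s] .
    show "pro_Cmp C (I, X) (I, X) (J, Y) p (pro_Ident C (I, X)) s = p s"
      using pro_Cmp_apply[where q = p and Z = Y and K = J, OF X pro_Ident_in_pro_Hom *(1,2) s *(3)] *
      by (simp add: pro_Ident_def colim_post_cls points_iff tgt.Ident_in_Hom omap_Ob tgt.Cmp_Ident_right)
  qed
qed

text \<open>With representatives \<open>g\<close> of \<open>h r\<close> and \<open>f\<close> of
  \<open>q s\<close>, both bracketings are the image of \<open>p t\<close> under the composite of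
  \<open>f\<close> and \<open>g\<close>.\<close>

lemma pro_Cmp_assoc:
  assumes Y: "directed_diagram J C Y" and Z: "directed_diagram K C Z" and W: "cat_functor L C W"
    and p: "p \<in> pro_Hom C (I, X) (J, Y)" and q: "q \<in> pro_Hom C (J, Y) (K, Z)"
    and h: "h \<in> pro_Hom C (K, Z) (L, W)"
  shows "pro_Cmp C (I, X) (J, Y) (L, W) (pro_Cmp C (J, Y) (K, Z) (L, W) h q) p =
    pro_Cmp C (I, X) (K, Z) (L, W) h (pro_Cmp C (I, X) (J, Y) (K, Z) q p)"
proof -
  interpret Y: directed_diagram J C Y by fact
  interpret Z: directed_diagram K C Z by fact
  note qp = pro_Cmp_in_pro_Hom[OF Y Z.cat_functor_axioms p q]
  note hq = Y.pro_Cmp_in_pro_Hom[OF Z W q h]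
  show ?thesis
  proof (rule pro_Hom_ext[OF pro_Cmp_in_pro_Hom[OF Y W p hq] pro_Cmp_in_pro_Hom[OF Z W qp h]])
    fix r assume r: "r \<in> Ob L"
    obtain s g where *: "s \<in> Ob K" "g \<in> Hom C (omap Z s) (omap W r)" "h r = Z.cls (omap W r) s g"
      using Z.pro_Hom_repE[OF h r] .
    obtain t f where f: "t \<in> Ob J" "f \<in> Hom C (omap Y t) (omap Z s)" "q s = Y.cls (omap Z s) t f"
      using Y.pro_Hom_repE[OF q *(1)] .
    have "pro_Cmp C (J, Y) (K, Z) (L, W) h q r =
        Y.cls (omap W r) t (Cmp C (omap Y t) (omap Z s) (omap W r) g f)"
      using Y.pro_Cmp_apply[where q = h and Z = W and K = L, OF Z q *(1,2) r *(3)] f *(2)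
      by (simp add: Y.colim_post_cls Y.points_iff)
    from pro_Cmp_apply[where q = "pro_Cmp C (J, Y) (K, Z) (L, W) h q" and Z = W and K = L,
        OF Y p f(1) tgt.Cmp_in_Hom[OF f(2) *(2)] r this]
    show "pro_Cmp C (I, X) (J, Y) (L, W) (pro_Cmp C (J, Y) (K, Z) (L, W) h q) p r =
        pro_Cmp C (I, X) (K, Z) (L, W) h (pro_Cmp C (I, X) (J, Y) (K, Z) q p) r"
      using pro_Cmp_apply[where q = h and Z = W and K = L, OF Z qp *(1,2) r *(3)]
        pro_Cmp_apply[where q = q and Z = Z and K = K, OF Y p f(1,2) *(1) f(3)]
        colim_post_post[OF pro_Hom_D(1)[OF p f(1)] f(2) *(2)] by simp
  qed
qed

end

lemma pro_objects_directed_diagram: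
  "(I, X) \<in> pro_objects C \<Longrightarrow> directed_diagram I C X"
  by (simp add: pro_objects_def small_directed_category_def directed_diagram_def
      directed_diagram_axioms_def)

lemma category_Pro:
  fixes C :: "('o, 'm) category"
  shows "category (Pro TYPE('u) C)"
proof
  fix x y z w :: "('u, 'o, 'm) pro_object" and f g h
  obtain I X where x: "x = (I, X)" by (cases x)
  obtain J Y where y: "y = (J, Y)" by (cases y)
  obtain K Z where z: "z = (K, Z)" by (cases z)
  obtain L W where w: "w = (L, W)" by (cases w)
  note defs = Pro_def x y z w
  note dd = pro_objects_directed_diagram[where C = C]
  note cf = directed_diagram.axioms(1)[OF dd]
  show "x \<in> Ob (Pro TYPE('u) C) \<and> y \<in> Ob (Pro TYPE('u) C)" if "f \<in> Hom (Pro TYPE('u) C) x y"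
    using that by (simp add: Pro_def split: if_splits)
  show "Ident (Pro TYPE('u) C) x \<in> Hom (Pro TYPE('u) C) x x" if "x \<in> Ob (Pro TYPE('u) C)"
    using that by (simp add: defs directed_diagram.pro_Ident_in_pro_Hom[OF dd])
  show "Cmp (Pro TYPE('u) C) x y z g f \<in> Hom (Pro TYPE('u) C) x z"
    if "f \<in> Hom (Pro TYPE('u) C) x y" "g \<in> Hom (Pro TYPE('u) C) y z"
    using that by (simp add: defs directed_diagram.pro_Cmp_in_pro_Hom[OF dd dd cf] split: if_splits)
  show "Cmp (Pro TYPE('u) C) x y y (Ident (Pro TYPE('u) C) y) f = f"
    if "f \<in> Hom (Pro TYPE('u) C) x y"
    using that by (simp add: defs directed_diagram.pro_Cmp_Ident_left[OF dd dd] split: if_splits)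
  show "Cmp (Pro TYPE('u) C) x x y f (Ident (Pro TYPE('u) C) x) = f"
    if "f \<in> Hom (Pro TYPE('u) C) x y"
    using that by (simp add: defs directed_diagram.pro_Cmp_Ident_right[OF dd cf] split: if_splits)
  show "Cmp (Pro TYPE('u) C) w x z (Cmp (Pro TYPE('u) C) x y z h g) f =
      Cmp (Pro TYPE('u) C) w y z h (Cmp (Pro TYPE('u) C) w x y g f)"
    if "f \<in> Hom (Pro TYPE('u) C) w x" "g \<in> Hom (Pro TYPE('u) C) x y" "h \<in> Hom (Pro TYPE('u) C) y z"
    using that by (simp add: defs directed_diagram.pro_Cmp_assoc[OF dd dd dd cf] split: if_splits)
qed

section \<open>Restriction along a cofinal functor\<close>

context directed_diagram begin

text \<open>For directed \<open>J\<close>, the conditions \<open>cof\<close> and \<open>equ\<close>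
  make the category of arrows \<open>d a -> s\<close> nonempty and connected for every
  \<open>s\<close>, which is cofinality of \<open>d\<close>. \<open>F\<close> is only required to
  agree with the composite of \<open>X\<close> and \<open>d\<close> on \<open>J\<close>, which
  leaves room for the default values that objects of \<open>ProBar\<close> must have.\<close>

lemma iso_cofinal_restriction:
  assumes J: "directed_category J" and d: "cat_functor J I d"
    and F: "cat_functor J C F" "functor_eq J F (functor_comp X d)"
    and cof: "\<And>s. s \<in> Ob I \<Longrightarrow> \<exists>a\<in>Ob J. Hom I (omap d a) s \<noteq> {}"
    and equ: "\<And>a s f g. \<lbrakk>a \<in> Ob J; f \<in> Hom I (omap d a) s; g \<in> Hom I (omap d a) s\<rbrakk> \<Longrightarrow>
      \<exists>b. \<exists>h\<in>Hom J b a. Cmp I (omap d b) (omap d a) s f (amap d b a h) =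
        Cmp I (omap d b) (omap d a) s g (amap d b a h)"
  obtains p q where "p \<in> pro_Hom C (J, F) (I, X)" "q \<in> pro_Hom C (I, X) (J, F)"
    "pro_Cmp C (J, F) (I, X) (J, F) q p = pro_Ident C (J, F)"
    "pro_Cmp C (I, X) (J, F) (I, X) p q = pro_Ident C (I, X)"
proof -
  interpret d: cat_functor J I d by fact
  interpret F: directed_diagram J C F
    using F(1) J by (simp add: directed_diagram_def directed_diagram_axioms_def)
  have Fo: "omap F a = omap X (omap d a)" if "a \<in> Ob J" for a
    using F(2) that by (simp add: functor_eq_def functor_comp_def)
  have Fa: "amap F a b h = amap X (omap d a) (omap d b) (amap d a b h)" if "h \<in> Hom J a b" for a b h
    using F(2) that d.src.Hom_Ob[OF that] by (simp add: functor_eq_def functor_comp_def)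
  have FX: "amap X (omap d a) s f \<in> Hom C (omap F a) (omap X s)"
    if "a \<in> Ob J" "f \<in> Hom I (omap d a) s" for a s f
    using that by (simp add: Fo amap_Hom)
  then have FP: "(a, amap X (omap d a) s f) \<in> F.points (omap X s)"
    if "a \<in> Ob J" "f \<in> Hom I (omap d a) s" for a s f
    using that by (simp add: F.points_iff)
  have pullF: "F.pull (omap X s) b a (amap X (omap d a) s f) h =
      amap X (omap d b) s (Cmp I (omap d b) (omap d a) s f (amap d b a h))"
    if "f \<in> Hom I (omap d a) s" "h \<in> Hom J b a" for a b s f h
    using that d.src.Hom_Ob[OF that(2)] by (simp add: Fo Fa amap_Cmp[OF d.amap_Hom])
  have clsF: "F.cls (omap X s) b (amap X (omap d b) s (Cmp I (omap d b) (omap d a) s f (amap d b a h))) =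
      F.cls (omap X s) a (amap X (omap d a) s f)"
    if "f \<in> Hom I (omap d a) s" "h \<in> Hom J b a" for a b s f h
    using F.cls_pull[OF FX that(2)] that d.src.Hom_Ob[OF that(2)] by (metis pullF)
  \<comment> \<open>Pulled back to a common index \<open>b\<close>, the two arrows become parallel
    arrows into \<open>s\<close>, and \<open>equ\<close> makes them equal after one more
    step.\<close>
  have indep: "F.cls (omap X s) a (amap X (omap d a) s f) = F.cls (omap X s) a' (amap X (omap d a') s f')"
    if a: "a \<in> Ob J" "a' \<in> Ob J" and f: "f \<in> Hom I (omap d a) s" "f' \<in> Hom I (omap d a') s" for a a' s f f'
  proof -
    obtain b h h' where h: "h \<in> Hom J b a" "h' \<in> Hom J b a'" using F.ex_span[OF a] by metis
    then have b: "b \<in> Ob J" using d.src.Hom_Ob by blast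
    let ?f = "Cmp I (omap d b) (omap d a) s f (amap d b a h)"
    let ?f' = "Cmp I (omap d b) (omap d a') s f' (amap d b a' h')"
    have *: "?f \<in> Hom I (omap d b) s" "?f' \<in> Hom I (omap d b) s"
      using f h by (auto intro: src.Cmp_in_Hom d.amap_Hom)
    obtain b' k where k: "k \<in> Hom J b' b"
      and eq: "Cmp I (omap d b') (omap d b) s ?f (amap d b' b k) = Cmp I (omap d b') (omap d b) s ?f' (amap d b' b k)"
      using equ[OF b *] by blast
    show ?thesis
      using clsF[OF *(1) k] clsF[OF *(2) k] eq clsF[OF f(1) h(1)] clsF[OF f(2) h(2)] by simp
  qed
  have "\<forall>s\<in>Ob I. \<exists>a f. a \<in> Ob J \<and> f \<in> Hom I (omap d a) s" using cof by blast
  then obtain A m where A: "\<And>s. s \<in> Ob I \<Longrightarrow> A s \<in> Ob J" and m: "\<And>s. s \<in> Ob I \<Longrightarrow> m s \<in> Hom I (omap d (A s)) s"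
    by metis
  \<comment> \<open>The arrows \<open>m s\<close> are arbitrary, which is harmless by
    \<open>indep\<close>. The family \<open>q\<close> can be represented by identities because
    \<open>F\<close> at \<open>a\<close> is \<open>X\<close> at \<open>d a\<close>.\<close>
  define p where "p = (\<lambda>s\<in>Ob I. F.cls (omap X s) (A s) (amap X (omap d (A s)) s (m s)))"
  define q where "q = (\<lambda>a\<in>Ob J. cls (omap F a) (omap d a) (Ident C (omap F a)))"
  have p_eq: "p s = F.cls (omap X s) a (amap X (omap d a) s f)" if "a \<in> Ob J" "f \<in> Hom I (omap d a) s" for a s f
    using src.Hom_Ob[OF that(2)] indep[OF A that(1) m that(2)] by (simp add: p_def)
  have pH: "p \<in> pro_Hom C (J, F) (I, X)"
  proof -
    have "colim_post C J F (omap X s) (omap X s') (amap X s s' k) (p s) = p s'"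
      if s: "s \<in> Ob I" "s' \<in> Ob I" and k: "k \<in> Hom I s s'" for s s' k
      using s p_eq[OF A m, OF s(1) s(1)] p_eq[OF A src.Cmp_in_Hom[OF m k], OF s(1) s(1)]
      by (simp add: F.colim_post_cls[OF FP[OF A m] amap_Hom[OF k]] amap_Cmp[OF m k] Fo A)
    moreover have "p \<in> (\<Pi>\<^sub>E s\<in>Ob I. colim_Hom C J F (omap X s))"
      by (auto simp: p_def F.points_iff A FX m intro!: F.cls_in_colim_Hom)
    ultimately show ?thesis by (simp add: pro_Hom_def)
  qed
  have IH: "Ident C (omap F a) \<in> Hom C (omap X (omap d a)) (omap F a)" if "a \<in> Ob J" for a
    using that by (simp add: Fo tgt.Ident_in_Hom omap_Ob d.omap_Ob)
  have IP: "(omap d a, Ident C (omap F a)) \<in> points (omap F a)" if "a \<in> Ob J" for a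
    using that by (simp add: points_iff IH d.omap_Ob)
  have qH: "q \<in> pro_Hom C (I, X) (J, F)"
  proof -
    have "colim_post C I X (omap F a) (omap F a') (amap F a a' k) (q a) = q a'"
      if a: "a \<in> Ob J" "a' \<in> Ob J" and k: "k \<in> Hom J a a'" for a a' k
      using a cls_pull[OF IH[OF a(2)] d.amap_Hom[OF k]] F.amap_Hom[OF k]
      by (simp add: q_def colim_post_cls[OF IP F.amap_Hom[OF k]])
        (simp add: Fa[OF k] Fo tgt.Cmp_Ident_left tgt.Cmp_Ident_right)
    moreover have "q \<in> (\<Pi>\<^sub>E a\<in>Ob J. colim_Hom C I X (omap F a))"
      by (auto simp: q_def intro!: cls_in_colim_Hom IP)
    ultimately show ?thesis by (simp add: pro_Hom_def)
  qed
  note X' = directed_diagram_axioms and F' = F.directed_diagram_axioms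
  have "pro_Cmp C (J, F) (I, X) (J, F) q p = pro_Ident C (J, F)"
  proof (rule F.pro_Hom_ext[OF F.pro_Cmp_in_pro_Hom[OF X' F(1) pH qH] F.pro_Ident_in_pro_Hom])
    fix a assume a: "a \<in> Ob J"
    then have qa: "q a = cls (omap F a) (omap d a) (Ident C (omap F a))" by (simp add: q_def)
    have da: "omap d a \<in> Ob I" using a by (rule d.omap_Ob)
    have "pro_Cmp C (J, F) (I, X) (J, F) q p a = p (omap d a)"
      using F.pro_Cmp_apply[where q = q and Z = F and K = J, OF X' pH da IH[OF a] a qa]
        F.colim_post_Ident[OF F.pro_Hom_D(1)[OF pH da] omap_Ob[OF da]] a by (simp add: Fo)
    also have "\<dots> = pro_Ident C (J, F) a"
      using p_eq[OF a src.Ident_in_Hom[OF da]] a da by (simp add: pro_Ident_def Fo amap_Ident)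
    finally show "pro_Cmp C (J, F) (I, X) (J, F) q p a = pro_Ident C (J, F) a" .
  qed
  moreover have "pro_Cmp C (I, X) (J, F) (I, X) p q = pro_Ident C (I, X)"
  proof (rule pro_Hom_ext[OF pro_Cmp_in_pro_Hom[OF F' cat_functor_axioms qH pH] pro_Ident_in_pro_Hom])
    fix s assume s: "s \<in> Ob I"
    note As = A[OF s] and ms = m[OF s]
    have ps: "p s = F.cls (omap X s) (A s) (amap X (omap d (A s)) s (m s))"
      using s by (simp add: p_def)
    have "pro_Cmp C (I, X) (J, F) (I, X) p q s =
        colim_post C I X (omap F (A s)) (omap X s) (amap X (omap d (A s)) s (m s)) (q (A s))"
      using pro_Cmp_apply[where q = p and Z = X and K = I, OF F' qH As FX[OF As ms] s ps] .
    also have "\<dots> = cls (omap X s) (omap d (A s))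
        (Cmp C (omap X (omap d (A s))) (omap F (A s)) (omap X s)
          (amap X (omap d (A s)) s (m s)) (Ident C (omap F (A s))))"
      using As by (simp add: q_def colim_post_cls[OF IP[OF As] FX[OF As ms]])
    also have "\<dots> = cls (omap X s) (omap d (A s)) (amap X (omap d (A s)) s (m s))"
      using As amap_Hom[OF ms] by (simp add: Fo tgt.Cmp_Ident_right)
    also have "\<dots> = pro_Ident C (I, X) s"
      using cls_pull[OF tgt.Ident_in_Hom[OF omap_Ob[OF s]] ms] s amap_Hom[OF ms]
      by (simp add: pro_Ident_def tgt.Cmp_Ident_left)
    finally show "pro_Cmp C (I, X) (J, F) (I, X) p q s = pro_Ident C (I, X) s" .
  qed
  ultimately show thesis using that pH qH by blast
qed

end

section \<open>Diagrams on cofinite directed sets\<close>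

lemma poset_category_simps [simp]:
  "Ob (poset_category r) = Field r"
  "f \<in> Hom (poset_category r) u v \<longleftrightarrow> (v, u) \<in> r \<and> f = poset_arrow u v"
  "Ident (poset_category r) = (\<lambda>u\<in>Field r. poset_arrow u u)"
  "\<lbrakk>(v, u) \<in> r; (w, v) \<in> r\<rbrakk> \<Longrightarrow>
    Cmp (poset_category r) u v w (poset_arrow v w) (poset_arrow u v) = poset_arrow u w"
  by (simp_all add: poset_category_def)

lemma ex_poset_arrow [simp]:
  "(\<exists>h\<in>Hom (poset_category r) u v. P h) \<longleftrightarrow> (v, u) \<in> r \<and> P (poset_arrow u v)"
  "Hom (poset_category r) u v = {} \<longleftrightarrow> (v, u) \<notin> r"
  by (auto simp: poset_category_def)

lemma category_poset_category:
  assumes "Partial_order r"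
  shows "category (poset_category r)"
proof
  have refl: "\<And>x. x \<in> Field r \<Longrightarrow> (x, x) \<in> r" and trans: "\<And>x y z. (x, y) \<in> r \<Longrightarrow> (y, z) \<in> r \<Longrightarrow> (x, z) \<in> r"
    using assms unfolding partial_order_on_def preorder_on_def refl_on_def trans_def by blast+
  fix x y z w f g h
  show *: "x \<in> Ob (poset_category r) \<and> y \<in> Ob (poset_category r)" if "f \<in> Hom (poset_category r) x y"
    using that by (auto intro: FieldI1 FieldI2)
  show "Ident (poset_category r) x \<in> Hom (poset_category r) x x" if "x \<in> Ob (poset_category r)"
    using that refl by simp
  show "Cmp (poset_category r) x y z g f \<in> Hom (poset_category r) x z"
    if "f \<in> Hom (poset_category r) x y" "g \<in> Hom (poset_category r) y z"
    using that trans by simp blast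
  show "Cmp (poset_category r) x y y (Ident (poset_category r) y) f = f"
    if "f \<in> Hom (poset_category r) x y"
    using that *[OF that] refl by simp
  show "Cmp (poset_category r) x x y f (Ident (poset_category r) x) = f"
    if "f \<in> Hom (poset_category r) x y"
    using that *[OF that] refl by simp
  show "Cmp (poset_category r) w x z (Cmp (poset_category r) x y z h g) f =
      Cmp (poset_category r) w y z h (Cmp (poset_category r) w x y g f)"
    if "f \<in> Hom (poset_category r) w x" "g \<in> Hom (poset_category r) x y" "h \<in> Hom (poset_category r) y z"
    using that trans[of y x w] trans[of z y x] by simp
qed

lemma directed_poset_category:
  assumes "directed_set r"
  shows "directed_category (poset_category r)"
proof -
  have "(x, x) \<in> r" if "x \<in> Field r" for x
    using assms that unfolding directed_set_def partial_order_on_def preorder_on_def refl_on_def by blast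
  then show ?thesis
    using assms unfolding directed_category_def directed_set_def by simp metis
qed

lemma directed_set_finite_bound:
  assumes "directed_set r" "finite A" "A \<subseteq> Field r"
  obtains u where "u \<in> Field r" "\<And>a. a \<in> A \<Longrightarrow> (a, u) \<in> r"
proof -
  have "\<exists>u\<in>Field r. \<forall>a\<in>A. (a, u) \<in> r"
    using assms(2,3)
  proof (induction rule: finite_induct)
    case empty
    then show ?case using assms(1) by (auto simp: directed_set_def)
  next
    case (insert x A)
    then obtain u where u: "u \<in> Field r" "\<forall>a\<in>A. (a, u) \<in> r" by auto
    obtain v where "v \<in> Field r" "(x, v) \<in> r" "(u, v) \<in> r"
      using assms(1) u(1) insert.prems unfolding directed_set_def by blast
    moreover have "trans r"
      using assms(1) by (simp add: directed_set_def partial_order_on_def preorder_on_def)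
    ultimately show ?case using u(2) by (auto elim: transE)
  qed
  then show thesis using that by blast
qed

text \<open>The number of elements below is finite by cofiniteness and strictly monotone, so it
  serves as a measure. The recursion that builds pre morphisms runs along this order.\<close>

lemma wf_strict_cofinite:
  assumes "Partial_order s" "cofinite_poset s"
  shows "wf {(b', b). (b', b) \<in> s \<and> b' \<noteq> b}"
proof (rule wf_subset)
  have refl: "\<And>x. x \<in> Field s \<Longrightarrow> (x, x) \<in> s" and "trans s" and "antisym s"
    using assms unfolding partial_order_on_def preorder_on_def refl_on_def by blast+
  have "card {z \<in> Field s. (z, b') \<in> s} < card {z \<in> Field s. (z, b) \<in> s}"
    if "(b', b) \<in> s" "b' \<noteq> b" for b b'
  proof (rule psubset_card_mono)
    have b: "b \<in> Field s" using that by (auto intro: FieldI2)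
    then show "finite {z \<in> Field s. (z, b) \<in> s}" using assms by (simp add: cofinite_poset_def)
    show "{z \<in> Field s. (z, b') \<in> s} \<subset> {z \<in> Field s. (z, b) \<in> s}"
      using that b refl[OF b] \<open>antisym s\<close> transD[OF \<open>trans s\<close> _ that(1)] antisymD by fastforce
  qed
  then show "{(b', b). (b', b) \<in> s \<and> b' \<noteq> b} \<subseteq> measure (\<lambda>b. card {z \<in> Field s. (z, b) \<in> s})"
    by auto
qed simp

lemma equiv_pre_morphism_equiv: "equiv (pre_morphisms C X Y) (pre_morphism_equiv C X Y)"
  unfolding pre_morphism_equiv_def by (rule equiv_generated_equiv)

text \<open>The action of the functor on a single pre morphism, before any union over a connected
  component is taken.\<close>

definition components ::
  "('o, 'm) category \<Rightarrow> ('u, 'o, 'm) probar_object \<Rightarrow> ('u, 'o, 'm) probar_object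
    \<Rightarrow> ('u, 'm) pre_morphism \<Rightarrow> 'u \<Rightarrow> ('u \<times> 'm) set" where
  "components C = (\<lambda>(r, F) (s, G) (\<alpha>, \<phi>).
    \<lambda>b\<in>Field s. colim_class C (poset_category r) F (omap G b) (\<alpha> b) (\<phi> b))"

locale poset_diagram = cat_functor "poset_category r" C F
  for r :: "'u rel" and C :: "('o, 'm) category" and F +
  assumes directed_set: "directed_set r"
    and cofinite_poset: "cofinite_poset r"
    and infinite_height: "infinite_height r"
begin

sublocale directed_diagram "poset_category r" C F
  by unfold_locales (rule directed_poset_category[OF directed_set])

lemma Partial_order: "Partial_order r"
  using directed_set by (simp add: directed_set_def)

lemma r_refl: "a \<in> Field r \<Longrightarrow> (a, a) \<in> r"
  using Partial_order unfolding partial_order_on_def preorder_on_def refl_on_def by blast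

lemma r_trans: "\<lbrakk>(a, b) \<in> r; (b, c) \<in> r\<rbrakk> \<Longrightarrow> (a, c) \<in> r"
  using Partial_order unfolding partial_order_on_def preorder_on_def trans_def by blast

lemma r_antisym: "\<lbrakk>(a, b) \<in> r; (b, a) \<in> r\<rbrakk> \<Longrightarrow> a = b"
  using Partial_order unfolding partial_order_on_def antisym_def by blast

abbreviation res :: "'o \<Rightarrow> 'u \<Rightarrow> 'u \<Rightarrow> 'm \<Rightarrow> 'm" where
  "res y a' a f \<equiv> pull y a' a f (poset_arrow a' a)"

lemma tr_in_Hom: "(a, a') \<in> r \<Longrightarrow> amap F a' a (poset_arrow a' a) \<in> Hom C (omap F a') (omap F a)"
  by (rule amap_Hom) simp

lemma res_res:
  "\<lbrakk>f \<in> Hom C (omap F a) y; (a, a') \<in> r; (a', a'') \<in> r\<rbrakk> \<Longrightarrow> res y a'' a' (res y a' a f) = res y a'' a f"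
  by (subst pull_pull) auto

lemma post_res:
  "\<lbrakk>f \<in> Hom C (omap F a) y; (a, a') \<in> r; g \<in> Hom C y y'\<rbrakk> \<Longrightarrow>
    Cmp C (omap F a') y y' g (res y a' a f) = res y' a' a (Cmp C (omap F a) y y' g f)"
  by (rule post_pull) auto

lemma res_self: "\<lbrakk>f \<in> Hom C (omap F a) y; a \<in> Field r\<rbrakk> \<Longrightarrow> res y a a f = f"
  using amap_Ident[of a] by (simp add: tgt.Cmp_Ident_right)

lemma cls_res: "\<lbrakk>f \<in> Hom C (omap F a) y; (a, a') \<in> r\<rbrakk> \<Longrightarrow> cls y a' (res y a' a f) = cls y a f"
  by (rule cls_pull) simp_all

lemma cls_eq_iff_res:
  assumes "(a, f) \<in> points y" "(a', f') \<in> points y"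
  shows "cls y a f = cls y a' f' \<longleftrightarrow> (\<exists>u. (a, u) \<in> r \<and> (a', u) \<in> r \<and> res y u a f = res y u a' f')"
  unfolding cls_eq_iff[OF assms] by simp blast

text \<open>Directedness gives a bound, and infinite height allows one more step up, which makes it
  strict. This is what keeps the index function of a constructed pre morphism strictly
  increasing.\<close>

lemma strict_finite_bound:
  assumes "finite A" "A \<subseteq> Field r"
  obtains u where "u \<in> Field r" "\<And>a. a \<in> A \<Longrightarrow> (a, u) \<in> r \<and> a \<noteq> u"
proof -
  obtain v where v: "v \<in> Field r" "\<And>a. a \<in> A \<Longrightarrow> (a, v) \<in> r"
    by (rule directed_set_finite_bound[OF directed_set assms]) blast
  obtain u where "u \<in> Field r" "(v, u) \<in> r" "v \<noteq> u"
    using infinite_height v(1) unfolding infinite_height_def by blast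
  then show thesis using that[of u] v(2) r_trans r_antisym by metis
qed

lemma pre_morphisms_iff:
  "(\<alpha>, \<phi>) \<in> pre_morphisms C (r, F) (s, G) \<longleftrightarrow>
    strictly_increasing s r \<alpha> \<and> \<phi> \<in> extensional (Field s) \<and>
    (\<forall>b\<in>Field s. \<phi> b \<in> Hom C (omap F (\<alpha> b)) (omap G b)) \<and>
    (\<forall>b b'. (b', b) \<in> s \<longrightarrow> res (omap G b') (\<alpha> b) (\<alpha> b') (\<phi> b') =
      Cmp C (omap F (\<alpha> b)) (omap G b) (omap G b') (amap G b b' (poset_arrow b b')) (\<phi> b))"
  by (auto simp: pre_morphisms_def nat_trans_def functor_comp_def poset_functor_def FieldI1 FieldI2)

text \<open>
  A pre morphism is built by recursion along the strict order of \<open>s\<close>: by cofiniteness, only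
  finitely many naturality squares constrain the choice at each index, and they all commute
  after restriction to a large enough index of \<open>r\<close>.
\<close>

lemma ex_pre_morphism:
  assumes s: "Partial_order s" "cofinite_poset s" and G: "cat_functor (poset_category s) C G"
    and p: "p \<in> pro_Hom C (poset_category r, F) (poset_category s, G)"
    and S: "\<And>b. b \<in> Field s \<Longrightarrow> S b \<noteq> {} \<and> S b \<subseteq> p b"
    and closed: "\<And>b a f a'. \<lbrakk>b \<in> Field s; (a, f) \<in> S b; (a, a') \<in> r\<rbrakk> \<Longrightarrow>
      (a', res (omap G b) a' a f) \<in> S b"
  obtains \<alpha> \<phi> where "(\<alpha>, \<phi>) \<in> pre_morphisms C (r, F) (s, G)"
    "\<And>b. b \<in> Field s \<Longrightarrow> (\<alpha> b, \<phi> b) \<in> S b"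
proof -
  interpret G: cat_functor "poset_category s" C G by fact
  let ?arr = "\<lambda>b b'. amap G b b' (poset_arrow b b')"
  have SD: "(a, f) \<in> points (omap G b)" "a \<in> Field r" "f \<in> Hom C (omap F a) (omap G b)"
    "p b = cls (omap G b) a f"
    if "b \<in> Field s" "(a, f) \<in> S b" for b a f
  proof -
    have "p b \<in> colim_Hom C (poset_category r) F (omap G b)" using pro_Hom_D(1)[OF p] that by simp
    moreover have "(a, f) \<in> p b" using S that by blast
    ultimately show *: "(a, f) \<in> points (omap G b)" "p b = cls (omap G b) a f" by (rule mem_colim_Hom)+
    then show "a \<in> Field r" "f \<in> Hom C (omap F a) (omap G b)" by (simp_all add: points_iff)
  qed
  \<comment> \<open>The requirement on a choice \<open>x\<close> of index and arrow at
    \<open>b\<close>: it is taken from \<open>S b\<close>, and against each strict predecessor it is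
    strictly higher and makes the naturality square commute. It consults \<open>g\<close> only
    strictly below \<open>b\<close>, as the recursion demands.\<close>
  define P where "P g b x \<longleftrightarrow> (b \<in> Field s \<longrightarrow> x \<in> S b \<and> (\<forall>b'. (b', b) \<in> s \<and> b' \<noteq> b \<longrightarrow>
    (fst (g b'), fst x) \<in> r \<and> fst (g b') \<noteq> fst x \<and>
    res (omap G b') (fst x) (fst (g b')) (snd (g b')) =
    Cmp C (omap F (fst x)) (omap G b) (omap G b') (?arr b b') (snd x)))"
    for g :: "'u \<Rightarrow> 'u \<times> 'm" and b x
  have "\<exists>g. \<forall>b. P g b (g b)"
  proof (rule dependent_wf_choice[OF wf_strict_cofinite[OF s]])
    show "P g b x = P g' b x" if "\<And>z. (z, b) \<in> {(b', b). (b', b) \<in> s \<and> b' \<noteq> b} \<Longrightarrow> g z = g' z" for g g' b x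
      using that by (auto simp: P_def)
  next
    fix b and g :: "'u \<Rightarrow> 'u \<times> 'm"
    assume IH: "\<And>y. (y, b) \<in> {(b', b). (b', b) \<in> s \<and> b' \<noteq> b} \<Longrightarrow> P g y (g y)"
    show "\<exists>x. P g b x"
    proof (cases "b \<in> Field s")
      case b: True
      define B where "B = {b'. (b', b) \<in> s \<and> b' \<noteq> b}"
      have "finite {z \<in> Field s. (z, b) \<in> s}" using s(2) b by (simp add: cofinite_poset_def)
      then have finB: "finite B" by (rule rev_finite_subset) (auto simp: B_def FieldI1)
      obtain a0 f0 where af: "(a0, f0) \<in> S b" using S[OF b] by fast
      note af' = SD[OF b af]
      \<comment> \<open>Compatibility of \<open>p\<close> says that the earlier choice at
        \<open>b'\<close> and \<open>f0\<close> followed by the arrow \<open>b -> b'\<close>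
        represent the same class \<open>p b'\<close>; hence they agree at some later index.\<close>
      have ex: "\<exists>u. (a0, u) \<in> r \<and> (fst (g b'), u) \<in> r \<and> res (omap G b') u (fst (g b')) (snd (g b')) =
          res (omap G b') u a0 (Cmp C (omap F a0) (omap G b) (omap G b') (?arr b b') f0)"
        if b': "b' \<in> B" for b'
      proof -
        have b'': "b' \<in> Field s" "(b', b) \<in> s" using b' by (auto simp: B_def FieldI1)
        have arr: "?arr b b' \<in> Hom C (omap G b) (omap G b')" using b'' by (auto intro: G.amap_Hom)
        have "(fst (g b'), snd (g b')) \<in> S b'" using IH[of b'] b' b'' by (simp add: P_def B_def)
        note gb = SD[OF b''(1) this]
        have gf: "(a0, Cmp C (omap F a0) (omap G b) (omap G b') (?arr b b') f0) \<in> points (omap G b')"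
          using af' arr by (auto simp: points_iff intro: tgt.Cmp_in_Hom)
        have "cls (omap G b') a0 (Cmp C (omap F a0) (omap G b) (omap G b') (?arr b b') f0) = p b'"
          using pro_Hom_D(2)[OF p, of b b'] b b'' colim_post_cls[OF af'(1) arr] af'(4) by simp
        then show ?thesis using cls_eq_iff_res[OF gf gb(1)] gb(4) by metis
      qed
      then obtain U where U: "\<And>b'. b' \<in> B \<Longrightarrow> (a0, U b') \<in> r" "\<And>b'. b' \<in> B \<Longrightarrow> (fst (g b'), U b') \<in> r"
        and eq: "\<And>b'. b' \<in> B \<Longrightarrow> res (omap G b') (U b') (fst (g b')) (snd (g b')) =
          res (omap G b') (U b') a0 (Cmp C (omap F a0) (omap G b) (omap G b') (?arr b b') f0)"
        by metis
      have "U ` B \<subseteq> Field r" using U by (auto intro: FieldI2)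
      \<comment> \<open>One index strictly beyond the finitely many \<open>U b'\<close>, where all
        squares commute at once. Inserting \<open>a0\<close> makes \<open>f0\<close> restrictable to
        \<open>a\<close> even when \<open>b\<close> has no strict predecessors.\<close>
      then obtain a where a: "a \<in> Field r" "\<And>x. x \<in> insert a0 (U ` B) \<Longrightarrow> (x, a) \<in> r \<and> x \<noteq> a"
        using strict_finite_bound[of "insert a0 (U ` B)"] finB af'(2) by auto
      let ?f = "res (omap G b) a a0 f0"
      have "(fst (g b'), a) \<in> r \<and> fst (g b') \<noteq> a \<and> res (omap G b') a (fst (g b')) (snd (g b')) =
          Cmp C (omap F a) (omap G b) (omap G b') (?arr b b') ?f"
        if b': "b' \<in> B" for b'
      proof -
        have b'': "b' \<in> Field s" "(b', b) \<in> s" using b' by (auto simp: B_def FieldI1)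
        have arr: "?arr b b' \<in> Hom C (omap G b) (omap G b')" using b'' by (auto intro: G.amap_Hom)
        have "(fst (g b'), snd (g b')) \<in> S b'" using IH[of b'] b' b'' by (simp add: P_def B_def)
        note gb = SD[OF b''(1) this]
        have Ua: "(U b', a) \<in> r" "U b' \<noteq> a" "(a0, a) \<in> r" using a(2) b' by auto
        note gf = tgt.Cmp_in_Hom[OF af'(3) arr]
        have "res (omap G b') a (fst (g b')) (snd (g b')) =
            res (omap G b') a a0 (Cmp C (omap F a0) (omap G b) (omap G b') (?arr b b') f0)"
          using res_res[OF gb(3) U(2)[OF b'] Ua(1)] res_res[OF gf U(1)[OF b'] Ua(1)] eq[OF b'] by simp
        moreover have "(fst (g b'), a) \<in> r" using r_trans[OF U(2)[OF b'] Ua(1)] .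
        moreover have "fst (g b') \<noteq> a" using U(2)[OF b'] Ua r_antisym by metis
        ultimately show ?thesis using post_res[OF af'(3) Ua(3) arr] by simp
      qed
      moreover have "(a, ?f) \<in> S b" using closed[OF b af] a(2) by simp
      ultimately have "P g b (a, ?f)" by (auto simp: P_def B_def)
      then show ?thesis ..
    qed (simp add: P_def)
  qed
  then obtain g where g: "\<And>b. P g b (g b)" by blast
  define \<alpha> where "\<alpha> = (\<lambda>b\<in>Field s. fst (g b))"
  define \<phi> where "\<phi> = (\<lambda>b\<in>Field s. snd (g b))"
  have gS: "(\<alpha> b, \<phi> b) \<in> S b" if "b \<in> Field s" for b
    using g[of b] that by (simp add: P_def \<alpha>_def \<phi>_def)
  have lt: "(\<alpha> b', \<alpha> b) \<in> r \<and> \<alpha> b' \<noteq> \<alpha> b \<and> res (omap G b') (\<alpha> b) (\<alpha> b') (\<phi> b') =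
      Cmp C (omap F (\<alpha> b)) (omap G b) (omap G b') (?arr b b') (\<phi> b)"
    if "(b', b) \<in> s" "b' \<noteq> b" for b b'
    using g[of b] that FieldI1[OF that(1)] FieldI2[OF that(1)] by (simp add: P_def \<alpha>_def \<phi>_def)
  \<comment> \<open>The recursion covers strict pairs only; on the diagonal, naturality reduces to
    the identity laws.\<close>
  have "res (omap G b') (\<alpha> b) (\<alpha> b') (\<phi> b') =
      Cmp C (omap F (\<alpha> b)) (omap G b) (omap G b') (?arr b b') (\<phi> b)" if "(b', b) \<in> s" for b b'
  proof (cases "b' = b")
    case True
    then have b: "b \<in> Field s" using that by (auto intro: FieldI1)
    note * = SD(2,3)[OF b gS[OF b]]
    show ?thesis using True res_self[OF *(2,1)] G.amap_Ident[of b] b tgt.Cmp_Ident_left[OF *(2)] by simp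
  qed (use lt that in blast)
  moreover have "strictly_increasing s r \<alpha>"
    using lt SD(2)[OF _ gS] by (auto simp: strictly_increasing_def) (simp add: \<alpha>_def)
  ultimately have "(\<alpha>, \<phi>) \<in> pre_morphisms C (r, F) (s, G)"
    using SD(3)[OF _ gS] by (auto simp: pre_morphisms_iff \<phi>_def)
  then show thesis using that gS by blast
qed

section \<open>Connected components of pre morphisms detected by families of classes\<close>

lemma components_apply: "b \<in> Field s \<Longrightarrow> components C (r, F) (s, G) (\<alpha>, \<phi>) b = cls (omap G b) (\<alpha> b) (\<phi> b)"
  by (simp add: components_def)

lemma pre_morphism_points:
  assumes "(\<alpha>, \<phi>) \<in> pre_morphisms C (r, F) (s, G)" "b \<in> Field s"
  shows "\<alpha> b \<in> Field r" "\<phi> b \<in> Hom C (omap F (\<alpha> b)) (omap G b)" "(\<alpha> b, \<phi> b) \<in> points (omap G b)"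
  using assms by (auto simp: pre_morphisms_iff points_iff strictly_increasing_def)

lemma pre_morphism_mono:
  assumes "(\<alpha>, \<phi>) \<in> pre_morphisms C (r, F) (s, G)" "(b, b') \<in> s"
  shows "(\<alpha> b, \<alpha> b') \<in> r"
  using assms r_refl[OF pre_morphism_points(1)[OF assms(1) FieldI1[OF assms(2)]]]
  unfolding pre_morphisms_iff strictly_increasing_def by metis

lemma components_in_pro_Hom:
  assumes p: "p \<in> pre_morphisms C (r, F) (s, G)" and G: "cat_functor (poset_category s) C G"
  shows "components C (r, F) (s, G) p \<in> pro_Hom C (poset_category r, F) (poset_category s, G)"
proof -
  interpret G: cat_functor "poset_category s" C G by fact
  obtain \<alpha> \<phi> where p': "p = (\<alpha>, \<phi>)" by (cases p)
  note pm = p[unfolded p'] and pt = pre_morphism_points[OF p[unfolded p']]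
  have "colim_post C (poset_category r) F (omap G b) (omap G b') (amap G b b' (poset_arrow b b'))
      (cls (omap G b) (\<alpha> b) (\<phi> b)) = cls (omap G b') (\<alpha> b') (\<phi> b')"
    if b: "b \<in> Field s" "b' \<in> Field s" "(b', b) \<in> s" for b b'
  proof -
    have "amap G b b' (poset_arrow b b') \<in> Hom C (omap G b) (omap G b')"
      using b by (auto intro: G.amap_Hom)
    from colim_post_cls[OF pt(3)[OF b(1)] this]
    have "colim_post C (poset_category r) F (omap G b) (omap G b') (amap G b b' (poset_arrow b b'))
      (cls (omap G b) (\<alpha> b) (\<phi> b)) = cls (omap G b') (\<alpha> b) (res (omap G b') (\<alpha> b) (\<alpha> b') (\<phi> b'))"
      using pm b(3) by (simp add: pre_morphisms_iff)
    then show ?thesis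
      using cls_res[OF pt(2)[OF b(2)] pre_morphism_mono[OF pm b(3)]] by simp
  qed
  then show ?thesis
    unfolding p' by (auto simp: pro_Hom_def components_def intro!: cls_in_colim_Hom pt(3))
qed

text \<open>Restriction does not change a class, so \<open>components\<close> is constant along the
  order and hence on connected components. Conversely, equal families have common restrictions at
  every index, and a coherent choice of these is a single pre morphism above both \<open>p\<close>
  and \<open>q\<close>; no longer zigzag is ever needed.\<close>

lemma pre_morphism_equiv_iff:
  assumes s: "Partial_order s" "cofinite_poset s" and G: "cat_functor (poset_category s) C G"
    and p: "p \<in> pre_morphisms C (r, F) (s, G)" and q: "q \<in> pre_morphisms C (r, F) (s, G)"
  shows "(p, q) \<in> pre_morphism_equiv C (r, F) (s, G) \<longleftrightarrow> components C (r, F) (s, G) p = components C (r, F) (s, G) q"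
    (is "?L \<longleftrightarrow> ?R")
proof
  define E where "E = {(p, q). p \<in> pre_morphisms C (r, F) (s, G) \<and> q \<in> pre_morphisms C (r, F) (s, G) \<and>
    components C (r, F) (s, G) p = components C (r, F) (s, G) q}"
  have "equiv (pre_morphisms C (r, F) (s, G)) E"
    by (auto simp: E_def intro!: equivI refl_onI symI transI)
  moreover have "components C (r, F) (s, G) p = components C (r, F) (s, G) p'"
    if pq: "(p, p') \<in> pre_morphism_le C (r, F) (s, G)" and pm: "p \<in> pre_morphisms C (r, F) (s, G)" for p p'
  proof -
    obtain \<alpha> \<phi> \<alpha>' \<phi>' where [simp]: "p = (\<alpha>, \<phi>)" "p' = (\<alpha>', \<phi>')" by (cases p, cases p')
    have "cls (omap G b) (\<alpha> b) (\<phi> b) = cls (omap G b) (\<alpha>' b) (\<phi>' b)" if "b \<in> Field s" for b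
      using pq that cls_res[OF pre_morphism_points(2)[OF pm[simplified] that]]
      by (simp add: pre_morphism_le_def)
    then show ?thesis by (auto simp: components_def intro: restrict_ext)
  qed
  ultimately have "pre_morphism_equiv C (r, F) (s, G) \<subseteq> E"
    unfolding pre_morphism_equiv_def by (intro generated_equiv_least) (auto simp: E_def)
  then show ?R if ?L using that by (auto simp: E_def)
next
  assume eq: ?R
  obtain \<alpha> \<phi> \<alpha>' \<phi>' where pq: "p = (\<alpha>, \<phi>)" "q = (\<alpha>', \<phi>')" by (cases p, cases q)
  note pt = pre_morphism_points[OF p[unfolded pq]] and qt = pre_morphism_points[OF q[unfolded pq]]
  \<comment> \<open>Simultaneous restrictions of \<open>\<phi> b\<close> and
    \<open>\<phi>' b\<close>. Membership of \<open>(\<beta> b, \<psi> b)\<close> for all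
    \<open>b\<close> is literally the statement that \<open>(\<beta>, \<psi>)\<close> lies above
    \<open>p\<close> and \<open>q\<close>.\<close>
  define S where "S b = {(a, f). (\<alpha> b, a) \<in> r \<and> (\<alpha>' b, a) \<in> r \<and>
    f = res (omap G b) a (\<alpha> b) (\<phi> b) \<and> f = res (omap G b) a (\<alpha>' b) (\<phi>' b)}" for b
  have S1: "S b \<noteq> {} \<and> S b \<subseteq> components C (r, F) (s, G) p b" if b: "b \<in> Field s" for b
  proof
    have "cls (omap G b) (\<alpha> b) (\<phi> b) = cls (omap G b) (\<alpha>' b) (\<phi>' b)"
      using eq b unfolding pq by (metis components_apply)
    then show "S b \<noteq> {}"
      unfolding cls_eq_iff_res[OF pt(3)[OF b] qt(3)[OF b]] by (auto simp: S_def)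
    have "(a, res (omap G b) a (\<alpha> b) (\<phi> b)) \<in> cls (omap G b) (\<alpha> b) (\<phi> b)" if "(\<alpha> b, a) \<in> r" for a
      using mem_cls[OF pull_in_points[OF pt(2)[OF b]], of "poset_arrow a (\<alpha> b)" a]
        cls_res[OF pt(2)[OF b] that] that by simp
    then show "S b \<subseteq> components C (r, F) (s, G) p b"
      using b by (auto simp: S_def pq components_apply)
  qed
  have S2: "(a', res (omap G b) a' a f) \<in> S b" if "b \<in> Field s" "(a, f) \<in> S b" "(a, a') \<in> r" for b a f a'
    using that res_res[OF pt(2)[OF that(1)] _ that(3)] res_res[OF qt(2)[OF that(1)] _ that(3)] r_trans
    unfolding S_def by clarsimp
  obtain \<beta> \<psi> where m: "(\<beta>, \<psi>) \<in> pre_morphisms C (r, F) (s, G)"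
    and mS: "\<And>b. b \<in> Field s \<Longrightarrow> (\<beta> b, \<psi> b) \<in> S b"
    by (rule ex_pre_morphism[OF s G components_in_pro_Hom[OF p G] S1 S2]) blast+
  have "(p, (\<beta>, \<psi>)) \<in> pre_morphism_le C (r, F) (s, G)" "(q, (\<beta>, \<psi>)) \<in> pre_morphism_le C (r, F) (s, G)"
    using mS unfolding pre_morphism_le_def pq S_def mem_Collect_eq case_prod_conv by blast+
  then have *: "(p, (\<beta>, \<psi>)) \<in> pre_morphism_equiv C (r, F) (s, G)"
    "(q, (\<beta>, \<psi>)) \<in> pre_morphism_equiv C (r, F) (s, G)"
    unfolding pre_morphism_equiv_def using p q m by (auto intro: generated_equivI)
  have "sym (pre_morphism_equiv C (r, F) (s, G))" "trans (pre_morphism_equiv C (r, F) (s, G))"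
    using equiv_pre_morphism_equiv[of C "(r, F)" "(s, G)"] by (simp_all add: equiv_def)
  then show ?L using * by (meson symD transD)
qed

lemma pre_morphism_class_eq_iff:
  assumes "Partial_order s" "cofinite_poset s" "cat_functor (poset_category s) C G"
    and "p \<in> pre_morphisms C (r, F) (s, G)" "q \<in> pre_morphisms C (r, F) (s, G)"
  shows "pre_morphism_class C (r, F) (s, G) p = pre_morphism_class C (r, F) (s, G) q \<longleftrightarrow>
    components C (r, F) (s, G) p = components C (r, F) (s, G) q"
  unfolding pre_morphism_class_def pre_morphism_equiv_iff[OF assms, symmetric]
  using eq_equiv_class_iff[OF equiv_pre_morphism_equiv assms(4,5)] by simp

end

section \<open>Identities and composition of pre morphisms\<close>

abbreviation to_pro :: "('u, 'o, 'm) probar_object \<Rightarrow> ('u, 'o, 'm) pro_object" where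
  "to_pro \<equiv> \<lambda>(r, F). (poset_category r, F)"

definition pre_Ident :: "('o, 'm) category \<Rightarrow> ('u, 'o, 'm) probar_object \<Rightarrow> ('u, 'm) pre_morphism" where
  "pre_Ident C = (\<lambda>(r, F). (\<lambda>a\<in>Field r. a, \<lambda>a\<in>Field r. Ident C (omap F a)))"

definition pre_Cmp ::
  "('o, 'm) category \<Rightarrow> ('u, 'o, 'm) probar_object \<Rightarrow> ('u, 'o, 'm) probar_object
    \<Rightarrow> ('u, 'o, 'm) probar_object \<Rightarrow> ('u, 'm) pre_morphism \<Rightarrow> ('u, 'm) pre_morphism
    \<Rightarrow> ('u, 'm) pre_morphism" where
  "pre_Cmp C = (\<lambda>(r, F) (s, G) (t, H) (\<beta>, \<psi>) (\<alpha>, \<phi>).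
    (\<lambda>c\<in>Field t. \<alpha> (\<beta> c),
     \<lambda>c\<in>Field t. Cmp C (omap F (\<alpha> (\<beta> c))) (omap G (\<beta> c)) (omap H c) (\<psi> c) (\<phi> (\<beta> c))))"

context poset_diagram begin

lemma pre_Ident_in_pre_morphisms: "pre_Ident C (r, F) \<in> pre_morphisms C (r, F) (r, F)"
proof -
  have "res (omap F a') a a' (Ident C (omap F a')) =
      Cmp C (omap F a) (omap F a) (omap F a') (amap F a a' (poset_arrow a a')) (Ident C (omap F a))"
    if "(a', a) \<in> r" for a a'
    using tr_in_Hom[OF that] by (simp add: tgt.Cmp_Ident_left tgt.Cmp_Ident_right)
  then show ?thesis
    using omap_Ob
    by (auto simp: pre_Ident_def pre_morphisms_iff strictly_increasing_def tgt.Ident_in_Hom FieldI1 FieldI2)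
qed

lemma components_pre_Ident: "components C (r, F) (r, F) (pre_Ident C (r, F)) = pro_Ident C (poset_category r, F)"
  by (auto simp: components_def pre_Ident_def pro_Ident_def intro!: restrict_ext)

text \<open>Fullness: every representative is admissible, so the recursion is run with the classes
  \<open>p b\<close> themselves, which are closed under restriction.\<close>

lemma ex_components_eq:
  assumes "Partial_order s" "cofinite_poset s" "cat_functor (poset_category s) C G"
    and p: "p \<in> pro_Hom C (poset_category r, F) (poset_category s, G)"
  obtains q where "q \<in> pre_morphisms C (r, F) (s, G)" "components C (r, F) (s, G) q = p"
proof -
  have c: "p b \<in> colim_Hom C (poset_category r) F (omap G b)" if "b \<in> Field s" for b
    using pro_Hom_D(1)[OF p] that by simp
  have "p b \<noteq> {} \<and> p b \<subseteq> p b" if "b \<in> Field s" for b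
    using c[OF that] by (metis colim_HomE mem_cls empty_iff order_refl)
  moreover have "(a', res (omap G b) a' a f) \<in> p b" if "b \<in> Field s" "(a, f) \<in> p b" "(a, a') \<in> r" for b a f a'
  proof -
    note m = mem_colim_Hom[OF c[OF that(1)] that(2)]
    then have f: "f \<in> Hom C (omap F a) (omap G b)" by (simp add: points_iff)
    show ?thesis
      using mem_cls[OF pull_in_points[OF f], of "poset_arrow a' a" a'] that(3) cls_res[OF f that(3)] m(2)
      by simp
  qed
  ultimately obtain \<alpha> \<phi> where q: "(\<alpha>, \<phi>) \<in> pre_morphisms C (r, F) (s, G)"
    and qp: "\<And>b. b \<in> Field s \<Longrightarrow> (\<alpha> b, \<phi> b) \<in> p b"
    using ex_pre_morphism[OF assms, of p] by metis
  have "components C (r, F) (s, G) (\<alpha>, \<phi>) = p"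
    using mem_colim_Hom(2)[OF c qp]
    by (intro pro_Hom_ext[OF components_in_pro_Hom[OF q assms(3)] p]) (simp add: components_apply)
  then show thesis using that q by blast
qed

end

text \<open>Naturality of the composite comes from pasting the square of \<open>\<phi>\<close> for
  \<open>\<beta> c' \<le> \<beta> c\<close> with the square of \<open>\<psi>\<close> for
  \<open>c' \<le> c\<close>.\<close>

lemma pre_Cmp_in_pre_morphisms:
  assumes F: "poset_diagram r C F" and G: "poset_diagram s C G" and H: "poset_diagram t C H"
    and p: "p \<in> pre_morphisms C (r, F) (s, G)" and q: "q \<in> pre_morphisms C (s, G) (t, H)"
  shows "pre_Cmp C (r, F) (s, G) (t, H) q p \<in> pre_morphisms C (r, F) (t, H)"
proof -
  interpret F: poset_diagram r C F by fact
  interpret G: poset_diagram s C G by fact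
  interpret H: poset_diagram t C H by fact
  obtain \<alpha> \<phi> where p': "p = (\<alpha>, \<phi>)" by (cases p)
  obtain \<beta> \<psi> where q': "q = (\<beta>, \<psi>)" by (cases q)
  note pm = p[unfolded p'] and qm = q[unfolded q']
  note pt = F.pre_morphism_points[OF pm] and qt = G.pre_morphism_points[OF qm]
  let ?\<chi> = "\<lambda>c. Cmp C (omap F (\<alpha> (\<beta> c))) (omap G (\<beta> c)) (omap H c) (\<psi> c) (\<phi> (\<beta> c))"
  have "F.res (omap H c') (\<alpha> (\<beta> c)) (\<alpha> (\<beta> c')) (?\<chi> c') =
      Cmp C (omap F (\<alpha> (\<beta> c))) (omap H c) (omap H c') (amap H c c' (poset_arrow c c')) (?\<chi> c)"
    if c: "(c', c) \<in> t" for c c'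
  proof -
    note cF = FieldI1[OF c] FieldI2[OF c]
    note b = G.pre_morphism_mono[OF qm c]
    note a = F.pre_morphism_mono[OF pm b]
    note \<phi> = pt(2)[OF qt(1)[OF cF(1)]] pt(2)[OF qt(1)[OF cF(2)]] and \<psi> = qt(2)[OF cF(1)] qt(2)[OF cF(2)]
    have "F.res (omap H c') (\<alpha> (\<beta> c)) (\<alpha> (\<beta> c')) (?\<chi> c') =
        Cmp C (omap F (\<alpha> (\<beta> c))) (omap G (\<beta> c')) (omap H c') (\<psi> c')
          (F.res (omap G (\<beta> c')) (\<alpha> (\<beta> c)) (\<alpha> (\<beta> c')) (\<phi> (\<beta> c')))"
      by (rule F.post_res[OF \<phi>(1) a \<psi>(1), symmetric])
    also have "\<dots> = Cmp C (omap F (\<alpha> (\<beta> c))) (omap G (\<beta> c)) (omap H c')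
        (G.res (omap H c') (\<beta> c) (\<beta> c') (\<psi> c')) (\<phi> (\<beta> c))"
      using pm b by (simp add: F.pre_morphisms_iff F.tgt.Cmp_assoc[OF \<phi>(2) G.tr_in_Hom[OF b] \<psi>(1)])
    also have "\<dots> = Cmp C (omap F (\<alpha> (\<beta> c))) (omap H c) (omap H c') (amap H c c' (poset_arrow c c')) (?\<chi> c)"
      using qm c by (simp add: G.pre_morphisms_iff F.tgt.Cmp_assoc[OF \<phi>(2) \<psi>(2) H.tr_in_Hom[OF c]])
    finally show ?thesis .
  qed
  moreover have "strictly_increasing t r (\<lambda>c\<in>Field t. \<alpha> (\<beta> c))"
    using pm qm pt(1)[OF qt(1)]
    by (auto simp: F.pre_morphisms_iff G.pre_morphisms_iff strictly_increasing_def FieldI1 FieldI2)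
  moreover have "?\<chi> c \<in> Hom C (omap F (\<alpha> (\<beta> c))) (omap H c)" if "c \<in> Field t" for c
    using pt(2)[OF qt(1)[OF that]] qt(2)[OF that] by (rule F.tgt.Cmp_in_Hom)
  ultimately show ?thesis
    by (auto simp: p' q' pre_Cmp_def F.pre_morphisms_iff FieldI1 FieldI2)
qed

text \<open>The component of \<open>q\<close> at \<open>x\<close> is represented by
  \<open>\<psi> x\<close> at the index \<open>\<beta> x\<close>, and the image of the class of
  \<open>\<phi> (\<beta> x)\<close> under it is the class of the composite.\<close>

lemma components_pre_Cmp:
  assumes F: "poset_diagram r C F" and G: "poset_diagram s C G" and H: "poset_diagram t C H"
    and p: "p \<in> pre_morphisms C (r, F) (s, G)" and q: "q \<in> pre_morphisms C (s, G) (t, H)"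
  shows "components C (r, F) (t, H) (pre_Cmp C (r, F) (s, G) (t, H) q p) =
    pro_Cmp C (poset_category r, F) (poset_category s, G) (poset_category t, H)
      (components C (s, G) (t, H) q) (components C (r, F) (s, G) p)"
proof -
  interpret F: poset_diagram r C F by fact
  interpret G: poset_diagram s C G by fact
  interpret H: poset_diagram t C H by fact
  note cf = G.cat_functor_axioms H.cat_functor_axioms
  note cp = F.components_in_pro_Hom[OF p cf(1)] and cq = G.components_in_pro_Hom[OF q cf(2)]
  note c = F.components_in_pro_Hom[OF pre_Cmp_in_pre_morphisms[OF F G H p q] cf(2)]
  obtain \<alpha> \<phi> where p': "p = (\<alpha>, \<phi>)" by (cases p)
  obtain \<beta> \<psi> where q': "q = (\<beta>, \<psi>)" by (cases q)
  note pt = F.pre_morphism_points[OF p[unfolded p']] and qt = G.pre_morphism_points[OF q[unfolded q']]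
  show ?thesis
  proof (rule F.pro_Hom_ext[OF c F.pro_Cmp_in_pro_Hom[OF G.directed_diagram_axioms cf(2) cp cq]])
    fix x assume "x \<in> Ob (poset_category t)"
    then have x: "x \<in> Ob (poset_category t)" "x \<in> Field t" "\<beta> x \<in> Ob (poset_category s)"
      using qt(1)[of x] by auto
    note \<phi> = pt(3)[OF qt(1)[OF x(2)]] and \<psi> = qt(2)[OF x(2)]
    have "components C (s, G) (t, H) q x = G.cls (omap H x) (\<beta> x) (\<psi> x)"
      using x(2) by (simp add: q' G.components_apply)
    from F.pro_Cmp_apply[where q = "components C (s, G) (t, H) q" and Z = H and K = "poset_category t",
        OF G.directed_diagram_axioms cp x(3) \<psi> x(1) this]
    show "components C (r, F) (t, H) (pre_Cmp C (r, F) (s, G) (t, H) q p) x =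
      pro_Cmp C (poset_category r, F) (poset_category s, G) (poset_category t, H)
        (components C (s, G) (t, H) q) (components C (r, F) (s, G) p) x"
      using qt(1)[OF x(2)] x(2) F.colim_post_cls[OF \<phi> \<psi>]
      by (simp add: p' q' F.components_apply pre_Cmp_def)
  qed
qed

section \<open>The category of diagrams on cofinite directed sets\<close>

lemma probar_objects_poset_diagram: "(r, F) \<in> probar_objects C \<Longrightarrow> poset_diagram r C F"
  by (simp add: probar_objects_def small_cofinite_directed_set_def poset_diagram_def
      poset_diagram_axioms_def)

lemma to_pro_in_pro_objects:
  fixes C :: "('o, 'm) category" and X :: "('u, 'o, 'm) probar_object"
  assumes "X \<in> probar_objects C"
  shows "to_pro X \<in> pro_objects C"
proof -
  obtain r F where X: "X = (r, F)" by (cases X)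
  interpret poset_diagram r C F using assms unfolding X by (rule probar_objects_poset_diagram)
  have sm: "Field r \<prec> (UNIV :: 'u set)" and ext: "extensional_functor (poset_category r) F"
    using assms by (auto simp: X probar_objects_def small_cofinite_directed_set_def small_def)
  \<comment> \<open>A finite carrier would contain an element strictly above all of its elements. An
    infinite carrier is equipotent to its square, which bounds the set of arrows and makes it
    small.\<close>
  have "infinite (Field r)" using strict_finite_bound[of "Field r"] by blast
  then have "Field r \<times> Field r \<approx> Field r"
    unfolding eqpoll_iff_card_of_ordIso by (rule card_of_Times_same_infinite)
  moreover have "arrows (poset_category r) \<subseteq> (\<lambda>(v, u). (u, v, poset_arrow u v)) ` (Field r \<times> Field r)"
    by (auto simp: arrows_def FieldI1 FieldI2 image_iff)
  ultimately have "arrows (poset_category r) \<prec> (UNIV :: 'u set)"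
    using sm by (meson subset_image_lepoll lepoll_trans2 lesspoll_trans1)
  moreover have "extensional_category (poset_category r)"
    by (auto simp: extensional_category_def) (auto simp: poset_category_def)
  ultimately show ?thesis
    using sm ext cat_functor_axioms directed src.category_axioms
    by (simp add: X pro_objects_def small_directed_category_def small_def)
qed

section \<open>Classes of pre morphisms compared with morphisms of pro-objects\<close>

context
  fixes C :: "('o, 'm) category" and X Y :: "('u, 'o, 'm) probar_object"
  assumes X: "X \<in> probar_objects C" and Y: "Y \<in> probar_objects C"
begin

lemma pre_morphism_class_eq_iff_components:
  assumes "p \<in> pre_morphisms C X Y" "q \<in> pre_morphisms C X Y"
  shows "pre_morphism_class C X Y p = pre_morphism_class C X Y q \<longleftrightarrow> components C X Y p = components C X Y q"
proof (cases X, cases Y)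
  fix r F s G assume XY: "X = (r, F)" "Y = (s, G)"
  interpret F: poset_diagram r C F using X unfolding XY by (rule probar_objects_poset_diagram)
  interpret G: poset_diagram s C G using Y unfolding XY by (rule probar_objects_poset_diagram)
  show ?thesis
    using assms F.pre_morphism_class_eq_iff[OF G.Partial_order G.cofinite_poset G.cat_functor_axioms]
    unfolding XY by blast
qed

lemma components_in_Hom_Pro:
  assumes "p \<in> pre_morphisms C X Y"
  shows "components C X Y p \<in> Hom (Pro TYPE('u) C) (to_pro X) (to_pro Y)"
proof (cases X, cases Y)
  fix r F s G assume XY: "X = (r, F)" "Y = (s, G)"
  interpret F: poset_diagram r C F using X unfolding XY by (rule probar_objects_poset_diagram)
  interpret G: poset_diagram s C G using Y unfolding XY by (rule probar_objects_poset_diagram)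
  show ?thesis
    using assms F.components_in_pro_Hom[OF _ G.cat_functor_axioms] to_pro_in_pro_objects[OF X]
      to_pro_in_pro_objects[OF Y]
    unfolding XY by (simp add: Pro_def)
qed

lemma Hom_Pro_componentsE:
  assumes "f \<in> Hom (Pro TYPE('u) C) (to_pro X) (to_pro Y)"
  obtains p where "p \<in> pre_morphisms C X Y" "components C X Y p = f"
proof (cases X, cases Y)
  fix r F s G assume XY: "X = (r, F)" "Y = (s, G)"
  interpret F: poset_diagram r C F using X unfolding XY by (rule probar_objects_poset_diagram)
  interpret G: poset_diagram s C G using Y unfolding XY by (rule probar_objects_poset_diagram)
  have "f \<in> pro_Hom C (poset_category r, F) (poset_category s, G)"
    using assms by (simp add: XY Pro_def split: if_splits)
  then show thesis
    using F.ex_components_eq[OF G.Partial_order G.cofinite_poset G.cat_functor_axioms] that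
    unfolding XY by metis
qed

lemma probar_Hom_repE:
  assumes "P \<in> probar_Hom C X Y"
  obtains p where "p \<in> pre_morphisms C X Y" "P = pre_morphism_class C X Y p"
  using assms unfolding probar_Hom_def pre_morphism_class_def by (auto elim: quotientE)

lemma pre_morphism_class_in_probar_Hom:
  "p \<in> pre_morphisms C X Y \<Longrightarrow> pre_morphism_class C X Y p \<in> probar_Hom C X Y"
  unfolding probar_Hom_def pre_morphism_class_def by (rule quotientI)

lemma mem_pre_morphism_class:
  assumes "q \<in> pre_morphism_class C X Y p"
  shows "q \<in> pre_morphisms C X Y" "components C X Y q = components C X Y p"
proof -
  have *: "(p, q) \<in> pre_morphism_equiv C X Y" using assms by (simp add: pre_morphism_class_def)
  then have "p \<in> pre_morphisms C X Y \<and> q \<in> pre_morphisms C X Y"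
    using equiv_pre_morphism_equiv unfolding equiv_def by blast
  then show "q \<in> pre_morphisms C X Y" "components C X Y q = components C X Y p"
    using pre_morphism_class_eq_iff_components[of p q] equiv_class_eq[OF equiv_pre_morphism_equiv *]
    by (auto simp: pre_morphism_class_def)
qed

lemma self_mem_pre_morphism_class: "p \<in> pre_morphisms C X Y \<Longrightarrow> p \<in> pre_morphism_class C X Y p"
  unfolding pre_morphism_class_def using equiv_class_self[OF equiv_pre_morphism_equiv] .

text \<open>All members of a class share their components, so the union that defines the functor on
  arrows collapses to the family of any one representative.\<close>

lemma amap_pro_incl:
  assumes p: "p \<in> pre_morphisms C X Y"
  shows "amap (pro_incl TYPE('u) C) X Y (pre_morphism_class C X Y p) = components C X Y p"
proof (cases X, cases Y)
  fix r F s G assume XY: "X = (r, F)" "Y = (s, G)"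
  show ?thesis
  proof
    fix b
    have "colim_class C (poset_category r) F (omap G b) (fst q b) (snd q b) = components C X Y p b"
      if "q \<in> pre_morphism_class C X Y p" "b \<in> Field s" for q
      using mem_pre_morphism_class(2)[OF that(1), symmetric] that(2)
      by (cases q) (simp add: XY components_def)
    then have "(\<Union>q\<in>pre_morphism_class C X Y p. colim_class C (poset_category r) F (omap G b) (fst q b) (snd q b))
        = components C X Y p b" if "b \<in> Field s"
      using self_mem_pre_morphism_class[OF p] that by blast
    moreover have "components C X Y p b = undefined" if "b \<notin> Field s"
      using that by (simp add: XY components_def split: prod.split)
    ultimately show "amap (pro_incl TYPE('u) C) X Y (pre_morphism_class C X Y p) b = components C X Y p b"
      unfolding pro_incl_def by (auto simp: XY case_prod_beta)
  qed
qed

end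

lemma pre_Cmp_probar:
  assumes "X \<in> probar_objects C" "Y \<in> probar_objects C" "Z \<in> probar_objects C"
    and "p \<in> pre_morphisms C X Y" "q \<in> pre_morphisms C Y Z"
  shows "pre_Cmp C X Y Z q p \<in> pre_morphisms C X Z"
    and "components C X Z (pre_Cmp C X Y Z q p) =
      Cmp (Pro TYPE('u) C) (to_pro X) (to_pro Y) (to_pro Z) (components C Y Z q) (components C X Y p)"
proof -
  obtain r F s G t H where XYZ: "X = (r, F)" "Y = (s, G)" "Z = (t, H)" by (cases X, cases Y, cases Z)
  note dd = assms(1-3)[unfolded XYZ, THEN probar_objects_poset_diagram]
  show "pre_Cmp C X Y Z q p \<in> pre_morphisms C X Z"
    using assms(4,5) pre_Cmp_in_pre_morphisms[OF dd] unfolding XYZ by blast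
  show "components C X Z (pre_Cmp C X Y Z q p) =
      Cmp (Pro TYPE('u) C) (to_pro X) (to_pro Y) (to_pro Z) (components C Y Z q) (components C X Y p)"
    using components_pre_Cmp[OF dd] assms(4,5) unfolding XYZ by (simp add: Pro_def)
qed

lemma pre_Ident_probar:
  assumes "X \<in> probar_objects C"
  shows "pre_Ident C X \<in> pre_morphisms C X X"
    and "components C X X (pre_Ident C X) = Ident (Pro TYPE('u) C) (to_pro X)"
proof -
  obtain r F where X: "X = (r, F)" by (cases X)
  interpret poset_diagram r C F using assms unfolding X by (rule probar_objects_poset_diagram)
  show "pre_Ident C X \<in> pre_morphisms C X X"
    unfolding X by (rule pre_Ident_in_pre_morphisms)
  show "components C X X (pre_Ident C X) = Ident (Pro TYPE('u) C) (to_pro X)"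
    by (simp add: X components_pre_Ident Pro_def)
qed

lemma probar_Ident_eq: "probar_Ident C X = pre_morphism_class C X X (pre_Ident C X)"
  by (cases X) (simp add: probar_Ident_def pre_Ident_def)

text \<open>Well-definedness comes from \<open>Pro\<close>: the components of a composite depend
  only on the components of its factors, and components determine the class.\<close>

lemma probar_Cmp_class:
  assumes X: "X \<in> probar_objects C" and Y: "Y \<in> probar_objects C" and Z: "Z \<in> probar_objects C"
    and p: "p \<in> pre_morphisms C X Y" and q: "q \<in> pre_morphisms C Y Z"
  shows "probar_Cmp C X Y Z (pre_morphism_class C Y Z q) (pre_morphism_class C X Y p) =
    pre_morphism_class C X Z (pre_Cmp C X Y Z q p)"
proof -
  have "pre_morphism_class C X Z (pre_Cmp C X Y Z q' p') = pre_morphism_class C X Z (pre_Cmp C X Y Z q p)"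
    if "p' \<in> pre_morphism_class C X Y p" "q' \<in> pre_morphism_class C Y Z q" for p' q'
    using mem_pre_morphism_class[OF X Y that(1)] mem_pre_morphism_class[OF Y Z that(2)]
      pre_Cmp_probar[OF X Y Z] p q pre_morphism_class_eq_iff_components[OF X Z] by metis
  then have "(\<Union>p'\<in>pre_morphism_class C X Y p. \<Union>q'\<in>pre_morphism_class C Y Z q.
      pre_morphism_class C X Z (pre_Cmp C X Y Z q' p')) = pre_morphism_class C X Z (pre_Cmp C X Y Z q p)"
    using self_mem_pre_morphism_class[OF X Y p] self_mem_pre_morphism_class[OF Y Z q] by blast
  then show ?thesis
    by (cases X, cases Y, cases Z) (simp add: probar_Cmp_def pre_Cmp_def case_prod_beta)
qed

lemma Hom_ProBar_rep:
  fixes X Y :: "('u, 'o, 'm) probar_object"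
  assumes "P \<in> Hom (ProBar TYPE('u) C) X Y"
  shows "\<exists>p\<in>pre_morphisms C X Y. P = pre_morphism_class C X Y p \<and>
    X \<in> probar_objects C \<and> Y \<in> probar_objects C"
proof -
  have o: "X \<in> probar_objects C" "Y \<in> probar_objects C" and P: "P \<in> probar_Hom C X Y"
    using assms by (auto simp: ProBar_def split: if_splits)
  show ?thesis using probar_Hom_repE[OF o P] o by metis
qed

text \<open>Components separate classes and turn composition and identities into those of
  \<open>Pro\<close>, so each law is inherited from \<open>Pro\<close>.\<close>

lemma category_ProBar:
  fixes C :: "('o, 'm) category"
  shows "category (ProBar TYPE('u) C)"
proof
  interpret Pro: category "Pro TYPE('u) C" by (rule category_Pro)
  let ?B = "ProBar TYPE('u) C"
  fix x y z w :: "('u, 'o, 'm) probar_object" and f g h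
  note rep = Hom_ProBar_rep[where C = C]
  have in_B: "pre_morphism_class C x y p \<in> Hom ?B x y"
    if "x \<in> probar_objects C" "y \<in> probar_objects C" "p \<in> pre_morphisms C x y" for x y p
    using that pre_morphism_class_in_probar_Hom by (simp add: ProBar_def)
  have CmpB: "Cmp ?B = probar_Cmp C" "Ident ?B = probar_Ident C" "Ob ?B = probar_objects C"
    by (simp_all add: ProBar_def)
  show "x \<in> Ob ?B \<and> y \<in> Ob ?B" if "f \<in> Hom ?B x y"
    using that by (simp add: ProBar_def split: if_splits)
  show "Ident ?B x \<in> Hom ?B x x" if "x \<in> Ob ?B"
    using that by (simp add: CmpB probar_Ident_eq in_B pre_Ident_probar)
  show "Cmp ?B x y z g f \<in> Hom ?B x z" if "f \<in> Hom ?B x y" "g \<in> Hom ?B y z"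
    using rep[OF that(1)] rep[OF that(2)] by (auto simp: CmpB probar_Cmp_class in_B pre_Cmp_probar)
  show "Cmp ?B x y y (Ident ?B y) f = f" if f: "f \<in> Hom ?B x y"
  proof -
    obtain p where "p \<in> pre_morphisms C x y" "f = pre_morphism_class C x y p"
      "x \<in> probar_objects C" "y \<in> probar_objects C"
      using rep[OF f] by blast
    then show ?thesis
      by (simp add: CmpB probar_Ident_eq probar_Cmp_class pre_Cmp_probar pre_Ident_probar
          pre_morphism_class_eq_iff_components Pro.Cmp_Ident_left[OF components_in_Hom_Pro])
  qed
  show "Cmp ?B x x y f (Ident ?B x) = f" if f: "f \<in> Hom ?B x y"
  proof -
    obtain p where "p \<in> pre_morphisms C x y" "f = pre_morphism_class C x y p"
      "x \<in> probar_objects C" "y \<in> probar_objects C"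
      using rep[OF f] by blast
    then show ?thesis
      by (simp add: CmpB probar_Ident_eq probar_Cmp_class pre_Cmp_probar pre_Ident_probar
          pre_morphism_class_eq_iff_components Pro.Cmp_Ident_right[OF components_in_Hom_Pro])
  qed
  show "Cmp ?B w x z (Cmp ?B x y z h g) f = Cmp ?B w y z h (Cmp ?B w x y g f)"
    if f: "f \<in> Hom ?B w x" and g: "g \<in> Hom ?B x y" and h: "h \<in> Hom ?B y z"
  proof -
    obtain p q k where "p \<in> pre_morphisms C w x" "f = pre_morphism_class C w x p"
      "q \<in> pre_morphisms C x y" "g = pre_morphism_class C x y q"
      "k \<in> pre_morphisms C y z" "h = pre_morphism_class C y z k"
      "w \<in> probar_objects C" "x \<in> probar_objects C" "y \<in> probar_objects C" "z \<in> probar_objects C"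
      using rep[OF f] rep[OF g] rep[OF h] by blast
    then show ?thesis
      by (simp add: CmpB probar_Cmp_class pre_Cmp_probar pre_morphism_class_eq_iff_components
          Pro.Cmp_assoc[OF components_in_Hom_Pro components_in_Hom_Pro components_in_Hom_Pro])
  qed
qed

lemma fully_faithful_pro_incl:
  fixes C :: "('o, 'm) category"
  shows "fully_faithful_functor (ProBar TYPE('u) C) (Pro TYPE('u) C) (pro_incl TYPE('u) C)"
proof -
  let ?B = "ProBar TYPE('u) C" and ?i = "pro_incl TYPE('u) C"
  have B: "Ob ?B = probar_objects C" "Cmp ?B = probar_Cmp C" "Ident ?B = probar_Ident C"
    "Hom ?B = (\<lambda>X Y. if X \<in> probar_objects C \<and> Y \<in> probar_objects C then probar_Hom C X Y else {})"
    by (simp_all add: ProBar_def)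
  note rep = Hom_ProBar_rep[where C = C]
  have om: "omap ?i = to_pro" by (simp add: pro_incl_def)
  show ?thesis
  proof (intro fully_faithful_functor.intro cat_functor.intro category_ProBar category_Pro
      cat_functor_axioms.intro fully_faithful_functor_axioms.intro, unfold om)
    fix x y :: "('u, 'o, 'm) probar_object"
    show "to_pro x \<in> Ob (Pro TYPE('u) C)" if "x \<in> Ob ?B"
      using that to_pro_in_pro_objects[of x C] by (simp add: B Pro_def)
    show "amap ?i x y f \<in> Hom (Pro TYPE('u) C) (to_pro x) (to_pro y)" if "f \<in> Hom ?B x y" for f
      using rep[OF that] by (auto simp: amap_pro_incl components_in_Hom_Pro)
    show "amap ?i x x (Ident ?B x) = Ident (Pro TYPE('u) C) (to_pro x)" if "x \<in> Ob ?B"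
      using that by (simp add: B probar_Ident_eq amap_pro_incl pre_Ident_probar)
    show "amap ?i x z (Cmp ?B x y z g f) =
        Cmp (Pro TYPE('u) C) (to_pro x) (to_pro y) (to_pro z) (amap ?i y z g) (amap ?i x y f)"
      if "f \<in> Hom ?B x y" "g \<in> Hom ?B y z" for z f g
      using rep[OF that(1)] rep[OF that(2)]
      by (auto simp: B probar_Cmp_class amap_pro_incl pre_Cmp_probar)
    assume "x \<in> Ob ?B" "y \<in> Ob ?B"
    then have o: "x \<in> probar_objects C" "y \<in> probar_objects C" by (simp_all add: B)
    show "bij_betw (amap ?i x y) (Hom ?B x y) (Hom (Pro TYPE('u) C) (to_pro x) (to_pro y))"
      unfolding bij_betw_def
    proof
      show "inj_on (amap ?i x y) (Hom ?B x y)"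
      proof (rule inj_onI)
        fix f f' assume f: "f \<in> Hom ?B x y" and f': "f' \<in> Hom ?B x y" and eq: "amap ?i x y f = amap ?i x y f'"
        obtain p where p: "p \<in> pre_morphisms C x y" "f = pre_morphism_class C x y p"
          using rep[OF f] by blast
        obtain p' where p': "p' \<in> pre_morphisms C x y" "f' = pre_morphism_class C x y p'"
          using rep[OF f'] by blast
        show "f = f'"
          using eq p p' by (simp add: amap_pro_incl[OF o] pre_morphism_class_eq_iff_components[OF o])
      qed
      show "amap ?i x y ` Hom ?B x y = Hom (Pro TYPE('u) C) (to_pro x) (to_pro y)"
      proof
        show "amap ?i x y ` Hom ?B x y \<subseteq> Hom (Pro TYPE('u) C) (to_pro x) (to_pro y)"
        proof
          fix g assume "g \<in> amap ?i x y ` Hom ?B x y"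
          then obtain f where g: "g = amap ?i x y f" and f: "f \<in> Hom ?B x y" by blast
          obtain p where "p \<in> pre_morphisms C x y" "f = pre_morphism_class C x y p"
            using rep[OF f] by blast
          then show "g \<in> Hom (Pro TYPE('u) C) (to_pro x) (to_pro y)"
            unfolding g by (simp add: amap_pro_incl[OF o] components_in_Hom_Pro[OF o])
        qed
        show "Hom (Pro TYPE('u) C) (to_pro x) (to_pro y) \<subseteq> amap ?i x y ` Hom ?B x y"
        proof
          fix f assume "f \<in> Hom (Pro TYPE('u) C) (to_pro x) (to_pro y)"
          then obtain p where p: "p \<in> pre_morphisms C x y" "components C x y p = f"
            by (rule Hom_Pro_componentsE[OF o])
          then show "f \<in> amap ?i x y ` Hom ?B x y"
            using o amap_pro_incl[OF o p(1)] pre_morphism_class_in_probar_Hom[OF o p(1)]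
            by (intro image_eqI[where x = "pre_morphism_class C x y p"]) (simp_all add: B)
        qed
      qed
    qed
  qed
qed

text \<open>An order is recovered from its poset category by asking which hom-sets are
  nonempty.\<close>

lemma inj_on_omap_pro_incl:
  fixes C :: "('o, 'm) category"
  shows "inj_on (omap (pro_incl TYPE('u) C)) (Ob (ProBar TYPE('u) C))"
proof (rule inj_onI)
  fix X Y :: "('u, 'o, 'm) probar_object"
  assume eq: "omap (pro_incl TYPE('u) C) X = omap (pro_incl TYPE('u) C) Y"
  obtain r F s G where XY: "X = (r, F)" "Y = (s, G)" by (cases X, cases Y)
  have "poset_category r = poset_category s" "F = G"
    using eq by (simp_all add: XY pro_incl_def)
  moreover have "r = {(v, u). Hom (poset_category r) u v \<noteq> {}}" for r :: "'u rel" by simp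
  ultimately show "X = Y" unfolding XY by metis
qed

section \<open>Cofinal functors from cofinite directed sets\<close>

text \<open>Hom-sets need not be disjoint, so the label of an arrow carries its endpoints. They also
  make it possible to test whether an arrow starts at a previously chosen object.\<close>

type_synonym ('o, 'm) label = "('o \<times> 'o \<times> 'm) + nat"

section \<open>Cones over finite diagrams in a directed category\<close>

context category begin

lemma directed_finite_span:
  assumes "directed_category C" "finite V" "d ` V \<subseteq> Ob C"
  shows "\<exists>u\<in>Ob C. \<exists>c. \<forall>v\<in>V. c v \<in> Hom C u (d v)"
  using assms(2,3)
proof (induction rule: finite_induct)
  case empty
  then show ?case using assms(1) by (auto simp: directed_category_def)
next
  case (insert x V)
  then obtain u c where u: "u \<in> Ob C" and c: "\<forall>v\<in>V. c v \<in> Hom C u (d v)" by auto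
  obtain w h k where w: "w \<in> Ob C" "h \<in> Hom C w u" "k \<in> Hom C w (d x)"
    using assms(1) u insert.prems unfolding directed_category_def
    by (metis all_not_in_conv image_insert insert_subset)
  let ?c = "\<lambda>v. if v = x then k else Cmp C w u (d v) (c v) h"
  have "\<forall>v\<in>insert x V. ?c v \<in> Hom C w (d v)"
    using w c Cmp_in_Hom[OF w(2)] by auto
  then show ?case using w(1) by (intro bexI[of _ w] exI[of _ ?c])
qed

text \<open>Parallel pairs out of \<open>u\<close> are equalized one at a time; equalities already
  achieved survive precomposition with a further arrow.\<close>

lemma directed_finite_equalizer:
  assumes "directed_category C" "finite Q" "u \<in> Ob C"
    and "\<And>t f g. (t, f, g) \<in> Q \<Longrightarrow> f \<in> Hom C u t \<and> g \<in> Hom C u t"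
  shows "\<exists>w. \<exists>h\<in>Hom C w u. \<forall>(t, f, g)\<in>Q. Cmp C w u t f h = Cmp C w u t g h"
  using assms(2,4)
proof (induction rule: finite_induct)
  case empty
  then show ?case using Ident_in_Hom[OF assms(3)] by blast
next
  case (insert x Q)
  obtain t0 f0 g0 where x: "x = (t0, f0, g0)" by (metis prod.exhaust)
  have "\<exists>w. \<exists>h\<in>Hom C w u. \<forall>(t, f, g)\<in>Q. Cmp C w u t f h = Cmp C w u t g h"
    using insert.prems by (intro insert.IH) blast
  then obtain w h where h: "h \<in> Hom C w u" "\<forall>(t, f, g)\<in>Q. Cmp C w u t f h = Cmp C w u t g h"
    by blast
  have fg: "f0 \<in> Hom C u t0" "g0 \<in> Hom C u t0" using insert.prems x by auto
  obtain z k where k: "k \<in> Hom C z w"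
    "Cmp C z w t0 (Cmp C w u t0 f0 h) k = Cmp C z w t0 (Cmp C w u t0 g0 h) k"
    using assms(1) Cmp_in_Hom[OF h(1) fg(1)] Cmp_in_Hom[OF h(1) fg(2)] Hom_Ob
    unfolding directed_category_def by metis
  have hk: "Cmp C z w u h k \<in> Hom C z u" using k(1) h(1) by (rule Cmp_in_Hom)
  have "Cmp C z u t f (Cmp C z w u h k) = Cmp C z u t g (Cmp C z w u h k)"
    if "(t, f, g) \<in> insert x Q" for t f g
  proof -
    have "f \<in> Hom C u t" "g \<in> Hom C u t" using insert.prems that by auto
    then show ?thesis
      using that h(2) k(2) x Cmp_assoc[OF k(1) h(1), symmetric] by auto
  qed
  then show ?case using hk by blast
qed

text \<open>A vertex \<open>v\<close> is only a name for the object \<open>d v\<close>, so an object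
  may occur several times. A family of arrows from \<open>u\<close> to all vertices yields one
  parallel pair per edge, and precomposing with an arrow that equalizes these finitely many pairs
  gives the cone.\<close>

lemma directed_finite_cone:
  assumes dir: "directed_category C" and V: "finite V" "d ` V \<subseteq> Ob C"
    and E: "finite E" "\<And>v w f. (v, w, f) \<in> E \<Longrightarrow> v \<in> V \<and> w \<in> V \<and> f \<in> Hom C (d v) (d w)"
  obtains u c where "u \<in> Ob C" "\<And>v. v \<in> V \<Longrightarrow> c v \<in> Hom C u (d v)"
    "\<And>v w f. (v, w, f) \<in> E \<Longrightarrow> Cmp C u (d v) (d w) f (c v) = c w"
proof -
  obtain u c where u: "u \<in> Ob C" and c: "\<And>v. v \<in> V \<Longrightarrow> c v \<in> Hom C u (d v)"
    using directed_finite_span[OF dir V] by blast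
  let ?Q = "(\<lambda>(v, w, f). (d w, Cmp C u (d v) (d w) f (c v), c w)) ` E"
  have "\<exists>w. \<exists>h\<in>Hom C w u. \<forall>(t, f, g)\<in>?Q. Cmp C w u t f h = Cmp C w u t g h"
  proof (rule directed_finite_equalizer[OF dir _ u])
    show "finite ?Q" using E(1) by (rule finite_imageI)
    fix t f g assume "(t, f, g) \<in> ?Q"
    then obtain v x e where *: "(v, x, e) \<in> E" and tfg: "t = d x" "f = Cmp C u (d v) (d x) e (c v)" "g = c x"
      by auto
    have "v \<in> V" "x \<in> V" "e \<in> Hom C (d v) (d x)" using E(2)[OF *] by auto
    then show "f \<in> Hom C u t \<and> g \<in> Hom C u t" using c Cmp_in_Hom[OF c] unfolding tfg by simp
  qed
  then obtain w h where h: "h \<in> Hom C w u"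
    and hQ: "\<forall>(t, f, g)\<in>?Q. Cmp C w u t f h = Cmp C w u t g h"
    by blast
  have eq: "Cmp C w u (d x) (Cmp C u (d v) (d x) e (c v)) h = Cmp C w u (d x) (c x) h"
    if "(v, x, e) \<in> E" for v x e
    using bspec[OF hQ imageI[OF that]] by simp
  show thesis
  proof
    show "w \<in> Ob C" using Hom_Ob[OF h] by simp
    show "Cmp C w u (d v) (c v) h \<in> Hom C w (d v)" if "v \<in> V" for v
      using h c[OF that] by (rule Cmp_in_Hom)
    show "Cmp C w (d v) (d x) f (Cmp C w u (d v) (c v) h) = Cmp C w u (d x) (c x) h"
      if "(v, x, f) \<in> E" for v x f
    proof -
      have "Cmp C w u (d x) (Cmp C u (d v) (d x) f (c v)) h = Cmp C w u (d x) (c x) h"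
        using that by (rule eq)
      then show ?thesis using E(2)[OF that] c Cmp_assoc[OF h c[of v], of f "d x"] by simp
    qed
  qed
qed

text \<open>
  The objects \<open>D T\<close> are chosen by recursion on the finite set \<open>T\<close>, as cones over the finite
  diagram of all choices for proper subsets together with the arrows of the category that occur
  in \<open>T\<close>. The summand \<open>nat\<close> provides the elements that make every finite set a
  proper subset of another one.
\<close>

lemma ex_cofinal_family:
  assumes dir: "directed_category C"
  obtains D :: "('o, 'm) label set \<Rightarrow> 'o" and M where
    "\<And>T. T \<in> Fpow (arrows C <+> UNIV) \<Longrightarrow> D T \<in> Ob C"
    "\<And>T T'. \<lbrakk>T \<in> Fpow (arrows C <+> UNIV); T' \<subset> T\<rbrakk> \<Longrightarrow> M T T' \<in> Hom C (D T) (D T')"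
    "\<And>T T' T''. \<lbrakk>T \<in> Fpow (arrows C <+> UNIV); T' \<subset> T; T'' \<subset> T'\<rbrakk> \<Longrightarrow>
      Cmp C (D T) (D T') (D T'') (M T' T'') (M T T') = M T T''"
    "\<And>T T' s f g. \<lbrakk>T \<in> Fpow (arrows C <+> UNIV); T' \<subset> T; Inl (D T', s, f) \<in> T; Inl (D T', s, g) \<in> T\<rbrakk> \<Longrightarrow>
      Cmp C (D T) (D T') s f (M T T') = Cmp C (D T) (D T') s g (M T T')"
    "\<And>T s t f. \<lbrakk>T \<in> Fpow (arrows C <+> UNIV); Inl (s, t, f) \<in> T\<rbrakk> \<Longrightarrow> Hom C (D T) s \<noteq> {}"
proof -
  let ?S = "arrows C <+> (UNIV :: nat set)"
  \<comment> \<open>The pair \<open>x\<close> consists of the object chosen for \<open>T\<close> and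
    the arrows to the objects chosen for its proper subsets; \<open>G\<close> is relevant only at
    those subsets. Outside \<open>Fpow ?S\<close> there is no constraint.\<close>
  define P where "P G T x \<longleftrightarrow> (T \<in> Fpow ?S \<longrightarrow> fst x \<in> Ob C \<and>
    (\<forall>T'. T' \<subset> T \<longrightarrow> snd x T' \<in> Hom C (fst x) (fst (G T'))) \<and>
    (\<forall>T' T''. T' \<subset> T \<and> T'' \<subset> T' \<longrightarrow>
      Cmp C (fst x) (fst (G T')) (fst (G T'')) (snd (G T') T'') (snd x T') = snd x T'') \<and>
    (\<forall>T' s f g. T' \<subset> T \<and> Inl (fst (G T'), s, f) \<in> T \<and> Inl (fst (G T'), s, g) \<in> T \<longrightarrow>
      Cmp C (fst x) (fst (G T')) s f (snd x T') = Cmp C (fst x) (fst (G T')) s g (snd x T')) \<and>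
    (\<forall>s t f. Inl (s, t, f) \<in> T \<longrightarrow> Hom C (fst x) s \<noteq> {}))"
    for G :: "('o, 'm) label set \<Rightarrow> 'o \<times> (('o, 'm) label set \<Rightarrow> 'm)" and T x
  have P_D: "fst x \<in> Ob C"
      "\<And>T'. T' \<subset> T \<Longrightarrow> snd x T' \<in> Hom C (fst x) (fst (G T'))"
      "\<And>T' T''. \<lbrakk>T' \<subset> T; T'' \<subset> T'\<rbrakk> \<Longrightarrow>
        Cmp C (fst x) (fst (G T')) (fst (G T'')) (snd (G T') T'') (snd x T') = snd x T''"
      "\<And>T' s f g. \<lbrakk>T' \<subset> T; Inl (fst (G T'), s, f) \<in> T; Inl (fst (G T'), s, g) \<in> T\<rbrakk> \<Longrightarrow>
        Cmp C (fst x) (fst (G T')) s f (snd x T') = Cmp C (fst x) (fst (G T')) s g (snd x T')"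
      "\<And>s t f. Inl (s, t, f) \<in> T \<Longrightarrow> Hom C (fst x) s \<noteq> {}"
    if "P G T x" "T \<in> Fpow ?S" for G T x
  proof -
    note Q = that(1)[unfolded P_def, THEN mp, OF that(2)]
    show "fst x \<in> Ob C" by (rule conjunct1[OF Q])
    note Q = conjunct2[OF Q]
    show "\<And>T'. T' \<subset> T \<Longrightarrow> snd x T' \<in> Hom C (fst x) (fst (G T'))"
      using conjunct1[OF Q] by iprover
    note Q = conjunct2[OF Q]
    show "\<And>T' T''. \<lbrakk>T' \<subset> T; T'' \<subset> T'\<rbrakk> \<Longrightarrow>
        Cmp C (fst x) (fst (G T')) (fst (G T'')) (snd (G T') T'') (snd x T') = snd x T''"
      using conjunct1[OF Q] by iprover
    note Q = conjunct2[OF Q]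
    show "\<And>T' s f g. \<lbrakk>T' \<subset> T; Inl (fst (G T'), s, f) \<in> T; Inl (fst (G T'), s, g) \<in> T\<rbrakk> \<Longrightarrow>
        Cmp C (fst x) (fst (G T')) s f (snd x T') = Cmp C (fst x) (fst (G T')) s g (snd x T')"
      using conjunct1[OF Q] by iprover
    show "\<And>s t f. Inl (s, t, f) \<in> T \<Longrightarrow> Hom C (fst x) s \<noteq> {}"
      using conjunct2[OF Q] by iprover
  qed
  have P_cong: "P G' T x" if P: "P G T x" and eq: "\<And>T'. \<lbrakk>T \<in> Fpow ?S; T' \<subset> T\<rbrakk> \<Longrightarrow> G T' = G' T'"
    for G G' T x
    unfolding P_def
  proof (intro impI conjI allI)
    assume T: "T \<in> Fpow ?S"
    note D = P_D[OF P T] and eq = eq[OF T]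
    show "fst x \<in> Ob C" by (rule D(1))
    show "snd x T' \<in> Hom C (fst x) (fst (G' T'))" if "T' \<subset> T" for T'
      using D(2)[OF that] eq[OF that] by simp
    show "Cmp C (fst x) (fst (G' T')) (fst (G' T'')) (snd (G' T') T'') (snd x T') = snd x T''"
      if "T' \<subset> T \<and> T'' \<subset> T'" for T' T''
      using D(3)[of T' T''] eq[of T'] eq[of T''] that psubset_trans[of T'' T' T] by simp
    show "Cmp C (fst x) (fst (G' T')) s f (snd x T') = Cmp C (fst x) (fst (G' T')) s g (snd x T')"
      if "T' \<subset> T \<and> Inl (fst (G' T'), s, f) \<in> T \<and> Inl (fst (G' T'), s, g) \<in> T" for T' s f g
      using D(4)[of T' s f g] eq[of T'] that by metis
    show "Hom C (fst x) s \<noteq> {}" if "Inl (s, t, f) \<in> T" for s t f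
      using D(5) that .
  qed
  have "\<exists>G. \<forall>T. P G T (G T)"
  proof (rule dependent_wf_choice[OF wf_finite_psubset])
    fix G G' :: "('o, 'm) label set \<Rightarrow> 'o \<times> (('o, 'm) label set \<Rightarrow> 'm)" and T x
    assume "\<And>T'. (T', T) \<in> finite_psubset \<Longrightarrow> G T' = G' T'"
    then have eq: "G T' = G' T'" if "T \<in> Fpow ?S" "T' \<subset> T" for T'
      using that by (simp add: Fpow_def finite_psubset_def)
    show "P G T x = P G' T x"
      using P_cong[of G T x G'] P_cong[of G' T x G] eq by metis
  next
    fix T and G :: "('o, 'm) label set \<Rightarrow> 'o \<times> (('o, 'm) label set \<Rightarrow> 'm)"
    assume IH: "\<And>T'. (T', T) \<in> finite_psubset \<Longrightarrow> P G T' (G T')"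
    show "\<exists>x. P G T x"
    proof (cases "T \<in> Fpow ?S")
      case T: True
      then have finT: "finite T" and TS: "T \<subseteq> ?S" by (auto simp: Fpow_def)
      have IH': "P G T' (G T')" "T' \<in> Fpow ?S" if "T' \<subset> T" for T'
        using IH[of T'] that finT TS finite_subset[of T' T] by (auto simp: Fpow_def finite_psubset_def)
      note D = P_D[OF IH']
      have arr: "f \<in> Hom C s t" "s \<in> Ob C" "t \<in> Ob C" if "Inl (s, t, f) \<in> T" for s t f
      proof -
        show "f \<in> Hom C s t" using TS that by (auto simp: arrows_def)
        then show "s \<in> Ob C" "t \<in> Ob C" using Hom_Ob by auto
      qed
      let ?A = "Inl -` T" and ?Q = "{T'. T' \<subset> T}"
      \<comment> \<open>One vertex for each proper subset and one for each endpoint of an arrow in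
        \<open>T\<close>. The tags keep the two kinds apart even when they name the same
        object.\<close>
      let ?V = "Inl ` ?Q \<union> Inr ` (fst ` ?A \<union> (\<lambda>(s, t, f). t) ` ?A)"
      let ?d = "case_sum (\<lambda>T'. fst (G T')) (\<lambda>s. s)"
      \<comment> \<open>The edges in \<open>?E1\<close> enforce compatibility with earlier choices.
        Those in \<open>?E2\<close> do the equalizing: all arrows of \<open>T\<close> from the
        object of \<open>T'\<close> to \<open>s\<close> are edges between the same two vertices, so
        composing the leg at \<open>T'\<close> with any of them gives the leg at
        \<open>s\<close>.\<close>
      let ?E1 = "{(Inl T', Inl T'', snd (G T') T'') | T' T''. T' \<subset> T \<and> T'' \<subset> T'}"
      let ?E2 = "{(Inl T', Inr s, f) | T' s f. T' \<subset> T \<and> Inl (fst (G T'), s, f) \<in> T}"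
      have finA: "finite ?A" using finT by (intro finite_vimageI) auto
      have finQ: "finite ?Q"
        using finT by (auto intro: rev_finite_subset[of "Pow T"])
      have "?E1 \<subseteq> (\<lambda>(T', T''). (Inl T', Inl T'', snd (G T') T'')) ` (?Q \<times> ?Q)"
      proof
        fix z assume "z \<in> ?E1"
        then obtain T' T'' where "z = (Inl T', Inl T'', snd (G T') T'')" "T' \<subset> T" "T'' \<subset> T'" by blast
        then show "z \<in> (\<lambda>(T', T''). (Inl T', Inl T'', snd (G T') T'')) ` (?Q \<times> ?Q)"
          using psubset_trans[of T'' T' T] by (intro image_eqI[of _ _ "(T', T'')"]) simp_all
      qed
      then have finE1: "finite ?E1" by (rule finite_subset) (intro finite_imageI finite_cartesian_product finQ)
      have "?E2 \<subseteq> (\<lambda>(T', (_, s, f)). (Inl T', Inr s, f)) ` (?Q \<times> ?A)"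
      proof
        fix z assume "z \<in> ?E2"
        then obtain T' s f where "z = (Inl T', Inr s, f)" "T' \<subset> T" "Inl (fst (G T'), s, f) \<in> T" by blast
        then show "z \<in> (\<lambda>(T', (_, s, f)). (Inl T', Inr s, f)) ` (?Q \<times> ?A)"
          by (intro image_eqI[of _ _ "(T', fst (G T'), s, f)"]) simp_all
      qed
      then have finE2: "finite ?E2" by (rule finite_subset) (intro finite_imageI finite_cartesian_product finQ finA)
      have V: "finite ?V" "?d ` ?V \<subseteq> Ob C"
      proof -
        show "finite ?V" using finA finQ by simp
        have "\<forall>T'\<in>?Q. fst (G T') \<in> Ob C" using D(1) by simp
        moreover have "\<forall>x\<in>?A. fst x \<in> Ob C \<and> (\<lambda>(s, t, f). t) x \<in> Ob C"
          using arr(2,3) by (simp add: split_paired_all)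
        ultimately show "?d ` ?V \<subseteq> Ob C"
          unfolding image_Un image_image sum.case by blast
      qed
      have E: "v \<in> ?V \<and> w \<in> ?V \<and> f \<in> Hom C (?d v) (?d w)" if vwf: "(v, w, f) \<in> ?E1 \<union> ?E2" for v w f
      proof -
        consider T' T'' where "v = Inl T'" "w = Inl T''" "f = snd (G T') T''" "T' \<subset> T" "T'' \<subset> T'"
          | T' s where "v = Inl T'" "w = Inr s" "T' \<subset> T" "Inl (fst (G T'), s, f) \<in> T"
          using vwf by blast
        then show ?thesis
        proof cases
          case 1
          then show ?thesis using D(2)[of T' T''] psubset_trans[of T'' T' T] by simp
        next
          case 2
          then have "s \<in> (\<lambda>(s, t, f). t) ` ?A" by (intro image_eqI[of _ _ "(fst (G T'), s, f)"]) auto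
          then show ?thesis using 2 arr(1) by simp
        qed
      qed
      have finE: "finite (?E1 \<union> ?E2)" using finE1 finE2 by (rule finite_UnI)
      obtain u c where u: "u \<in> Ob C" and c: "\<And>v. v \<in> ?V \<Longrightarrow> c v \<in> Hom C u (?d v)"
        and cE: "\<And>v w f. (v, w, f) \<in> ?E1 \<union> ?E2 \<Longrightarrow> Cmp C u (?d v) (?d w) f (c v) = c w"
        by (rule directed_finite_cone[OF dir V finE E]) blast+
      have "P G T (u, \<lambda>T'. c (Inl T'))"
        unfolding P_def fst_conv snd_conv
      proof (intro impI conjI allI)
        show "u \<in> Ob C" by (rule u)
        show "c (Inl T') \<in> Hom C u (fst (G T'))" if "T' \<subset> T" for T'
          using c[of "Inl T'"] that by simp
        show "Cmp C u (fst (G T')) (fst (G T'')) (snd (G T') T'') (c (Inl T')) = c (Inl T'')"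
          if "T' \<subset> T \<and> T'' \<subset> T'" for T' T''
          using cE[of "Inl T'" "Inl T''" "snd (G T') T''"] that by simp
        have "Cmp C u (fst (G T')) s f (c (Inl T')) = c (Inr s)"
          if "T' \<subset> T" "Inl (fst (G T'), s, f) \<in> T" for T' s f
          using cE[of "Inl T'" "Inr s" f] that by simp
        then show "Cmp C u (fst (G T')) s f (c (Inl T')) = Cmp C u (fst (G T')) s g (c (Inl T'))"
          if "T' \<subset> T \<and> Inl (fst (G T'), s, f) \<in> T \<and> Inl (fst (G T'), s, g) \<in> T" for T' s f g
          using that by metis
        \<comment> \<open>Sources of arrows are vertices for this reason: the leg of the cone at
          \<open>s\<close> is the required arrow.\<close>
        show "Hom C u s \<noteq> {}" if "Inl (s, t, f) \<in> T" for s t f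
        proof -
          have "s \<in> fst ` ?A" using that by (intro image_eqI[of _ _ "(s, t, f)"]) auto
          then have "c (Inr s) \<in> Hom C u s" using c[of "Inr s"] by simp
          then show ?thesis by blast
        qed
      qed
      then show ?thesis by blast
    qed (simp add: P_def)
  qed
  then obtain G where G: "\<And>T. P G T (G T)" by blast
  show thesis
    by (rule that[of "\<lambda>T. fst (G T)" "\<lambda>T. snd (G T)"]) (fact P_D[OF G])+
qed

end

section \<open>Realization of the cofinal index poset inside the universe\<close>

lemma lesspoll_iff_ordLess: "A \<prec> B \<longleftrightarrow> ordLess2 (card_of A) (card_of B)"
  unfolding lesspoll_def eqpoll_iff_card_of_ordIso lepoll_def card_of_ordLeq
  by (metis not_ordLess_ordIso ordLeq_iff_ordLess_or_ordIso)

text \<open>Index posets live on \<open>'u\<close>, so the inclusion order on finite sets of labels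
  is copied along an injection \<open>e\<close> with inverse \<open>k\<close>. The last two
  conclusions are the cofinality conditions under which restriction along \<open>d\<close> preserves
  a pro-object up to isomorphism.\<close>

lemma ex_cofinal_cofinite_directed_set:
  fixes I :: "('u, 'u) category"
  assumes I: "category I" "directed_category I" and sm: "small TYPE('u) (arrows I)"
    and unc: "uncountable (UNIV :: 'u set)"
  obtains r d where "small_cofinite_directed_set (r :: 'u rel)" "cat_functor (poset_category r) I d"
    "\<And>s. s \<in> Ob I \<Longrightarrow> \<exists>a\<in>Field r. Hom I (omap d a) s \<noteq> {}"
    "\<And>a s f g. \<lbrakk>a \<in> Field r; f \<in> Hom I (omap d a) s; g \<in> Hom I (omap d a) s\<rbrakk> \<Longrightarrow>
      \<exists>b. (a, b) \<in> r \<and>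
        Cmp I (omap d b) (omap d a) s f (amap d b a (poset_arrow b a)) =
        Cmp I (omap d b) (omap d a) s g (amap d b a (poset_arrow b a))"
proof -
  interpret category I by fact
  let ?S = "arrows I <+> (UNIV :: nat set)"
  let ?P = "Fpow ?S"
  have infS: "infinite ?S" by simp
  have infU: "infinite (UNIV :: 'u set)" using unc countable_finite by blast
  \<comment> \<open>Smallness means cardinality below that of \<open>'u\<close>, so this is where
    uncountability enters. The sum with the small set of arrows stays small, and passing to finite
    subsets of an infinite set keeps the cardinality.\<close>
  have "(UNIV :: nat set) \<prec> (UNIV :: 'u set)"
    using infU unc by (meson countable_eqpoll eqpoll_sym infinite_le_lepoll lepoll_iff_leqpoll
      uncountable_def countableI_type)
  then have "?S \<prec> (UNIV :: 'u set)"
    using sm card_of_Plus_ordLess_infinite[OF infU] by (simp add: small_def lesspoll_iff_ordLess)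
  then have Psm: "?P \<prec> (UNIV :: 'u set)"
    using eqpoll_Fpow[OF infS] by (rule eq_lesspoll_trans[rotated])
  then obtain e :: "('u, 'u) label set \<Rightarrow> 'u" where e: "inj_on e ?P"
    by (meson lesspoll_imp_lepoll lepoll_def)
  obtain D M where D: "\<And>T. T \<in> ?P \<Longrightarrow> D T \<in> Ob I"
    and M: "\<And>T T'. \<lbrakk>T \<in> ?P; T' \<subset> T\<rbrakk> \<Longrightarrow> M T T' \<in> Hom I (D T) (D T')"
    and MM: "\<And>T T' T''. \<lbrakk>T \<in> ?P; T' \<subset> T; T'' \<subset> T'\<rbrakk> \<Longrightarrow>
      Cmp I (D T) (D T') (D T'') (M T' T'') (M T T') = M T T''"
    and Meq: "\<And>T T' s f g. \<lbrakk>T \<in> ?P; T' \<subset> T; Inl (D T', s, f) \<in> T; Inl (D T', s, g) \<in> T\<rbrakk> \<Longrightarrow>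
      Cmp I (D T) (D T') s f (M T T') = Cmp I (D T) (D T') s g (M T T')"
    and DH: "\<And>T s t f. \<lbrakk>T \<in> ?P; Inl (s, t, f) \<in> T\<rbrakk> \<Longrightarrow> Hom I (D T) s \<noteq> {}"
    by (rule ex_cofinal_family[OF I(2)]) (rule that)
  define r where "r = {(e T', e T) | T' T. T' \<in> ?P \<and> T \<in> ?P \<and> T' \<subseteq> T}"
  define k where "k = inv_into ?P e"
  \<comment> \<open>\<open>M\<close> is specified for proper inclusions only, so the identities on
    the diagonal are inserted by hand.\<close>
  define d where "d = \<lparr>omap = (\<lambda>a. D (k a)),
    amap = (\<lambda>a b (_ :: 'u). if k a = k b then Ident I (D (k a)) else M (k a) (k b))\<rparr>"
  have ke: "k (e T) = T" if "T \<in> ?P" for T using e that by (simp add: k_def)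
  have Fr: "Field r = e ` ?P" unfolding Field_def r_def by blast
  have kP: "k a \<in> ?P" "e (k a) = a" if "a \<in> Field r" for a
    using that unfolding Fr k_def by (rule inv_into_into f_inv_into_f)+
  have eF: "e T \<in> Field r" if "T \<in> ?P" for T using that by (simp add: Fr)
  have r_iff: "(a, b) \<in> r \<longleftrightarrow> a \<in> Field r \<and> b \<in> Field r \<and> k a \<subseteq> k b" for a b
  proof
    assume "(a, b) \<in> r"
    then obtain T' T where "a = e T'" "b = e T" "T' \<in> ?P" "T \<in> ?P" "T' \<subseteq> T"
      unfolding r_def by blast
    then show "a \<in> Field r \<and> b \<in> Field r \<and> k a \<subseteq> k b" by (simp only: eF ke simp_thms)
  next
    assume ab: "a \<in> Field r \<and> b \<in> Field r \<and> k a \<subseteq> k b"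
    then have "(e (k a), e (k b)) \<in> r" using kP(1) unfolding r_def by blast
    then show "(a, b) \<in> r" using ab by (simp only: kP(2))
  qed
  have PO: "Partial_order r"
    unfolding partial_order_on_def preorder_on_def
  proof (intro conjI)
    show "r \<subseteq> Field r \<times> Field r" by (auto intro: FieldI1 FieldI2)
    show "refl_on (Field r) r" by (rule refl_onI) (simp add: r_iff)
    show "trans r" by (rule transI) (use r_iff in blast)
    show "antisym r"
    proof (rule antisymI)
      fix a b assume "(a, b) \<in> r" "(b, a) \<in> r"
      then have "a \<in> Field r" "b \<in> Field r" "k a = k b" unfolding r_iff by blast+
      then show "a = b" using kP(2) by metis
    qed
  qed
  have PI: "insert x T \<in> ?P" if "T \<in> ?P" "x \<in> ?S" for T x using that by (simp add: Fpow_def)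
  have fresh: "\<exists>x\<in>?S. x \<notin> T" if "T \<in> ?P" for T
  proof (rule ccontr)
    assume "\<not> ?thesis"
    then have "?S \<subseteq> T" by blast
    moreover have "finite T" using that by (simp add: Fpow_def)
    ultimately show False using infS finite_subset by blast
  qed
  have UP: "T \<union> T' \<in> ?P" if "T \<in> ?P" "T' \<in> ?P" for T T' using that by (simp add: Fpow_def)
  have "directed_set r"
    unfolding directed_set_def
  proof (intro conjI ballI PO)
    show "Field r \<noteq> {}" by (simp add: Fr Fpow_not_empty)
    fix x y assume xy: "x \<in> Field r" "y \<in> Field r"
    have "k x \<union> k y \<in> ?P" using xy kP UP by blast
    then show "\<exists>z\<in>Field r. (x, z) \<in> r \<and> (y, z) \<in> r"
      using xy by (intro bexI[of _ "e (k x \<union> k y)"]) (auto simp: r_iff ke eF)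
  qed
  moreover have "cofinite_poset r"
    unfolding cofinite_poset_def
  proof
    fix x assume x: "x \<in> Field r"
    have "{z \<in> Field r. (z, x) \<in> r} \<subseteq> e ` Pow (k x)"
      using kP by (auto simp: r_iff image_iff) (metis Pow_iff)
    moreover have "finite (Pow (k x))" using kP(1)[OF x] by (simp add: Fpow_def)
    ultimately show "finite {z \<in> Field r. (z, x) \<in> r}" by (meson finite_imageI finite_subset)
  qed
  moreover have "infinite_height r"
    unfolding infinite_height_def
  proof
    fix a assume a: "a \<in> Field r"
    obtain x where x: "x \<in> ?S" "x \<notin> k a" using fresh[OF kP(1)[OF a]] by blast
    note i = PI[OF kP(1)[OF a] x(1)]
    have "a \<noteq> e (insert x (k a))" using ke[OF i] x(2) by (metis insertI1)
    then show "\<exists>a'\<in>Field r. (a, a') \<in> r \<and> a \<noteq> a'"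
      using a by (intro bexI[of _ "e (insert x (k a))"]) (auto simp: r_iff ke[OF i] eF[OF i])
  qed
  moreover have "small TYPE('u) (Field r)"
    using Psm e unfolding small_def Fr by simp
  ultimately have "small_cofinite_directed_set r"
    by (simp add: small_cofinite_directed_set_def)
  moreover have "cat_functor (poset_category r) I d"
  proof (intro cat_functor.intro I category_poset_category PO cat_functor_axioms.intro)
    show "omap d a \<in> Ob I" if "a \<in> Ob (poset_category r)" for a
      using that D kP by (simp add: d_def)
    show "amap d a b f \<in> Hom I (omap d a) (omap d b)" if "f \<in> Hom (poset_category r) a b" for a b f
      using that D[OF kP(1)] M[OF kP(1)] by (auto simp: d_def r_iff Ident_in_Hom)
    show "amap d a a (Ident (poset_category r) a) = Ident I (omap d a)" if "a \<in> Ob (poset_category r)" for a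
      by (simp add: d_def)
    show "amap d x z (Cmp (poset_category r) x y z g f) =
        Cmp I (omap d x) (omap d y) (omap d z) (amap d y z g) (amap d x y f)"
      if "f \<in> Hom (poset_category r) x y" "g \<in> Hom (poset_category r) y z" for x y z f g
    proof -
      have xyz: "k x \<in> ?P" "k y \<in> ?P" "k z \<in> ?P" "k y \<subseteq> k x" "k z \<subseteq> k y"
        using that kP by (auto simp: r_iff)
      \<comment> \<open>The composition law of \<open>M\<close> concerns two strict inclusions; the
        cases with an identity factor are treated separately.\<close>
      consider "k x = k y" | "k y = k z" "k x \<noteq> k y" | "k x \<noteq> k y" "k y \<noteq> k z" "k x \<noteq> k z"
        using xyz by blast
      then show ?thesis
      proof cases
        case 1
        then show ?thesis
          using xyz Cmp_Ident_right[OF M[of "k y" "k z"]] Cmp_Ident_right[OF Ident_in_Hom[OF D[of "k y"]]]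
          by (auto simp: d_def)
      next
        case 2
        then show ?thesis
          using xyz Cmp_Ident_left[OF M[of "k x" "k y"]] by (auto simp: d_def)
      next
        case 3
        then show ?thesis using xyz MM[of "k x" "k y" "k z"] by (auto simp: d_def)
      qed
    qed
  qed
  moreover have "\<exists>a\<in>Field r. Hom I (omap d a) s \<noteq> {}" if s: "s \<in> Ob I" for s
  proof -
    \<comment> \<open>The identity arrow stands for the object \<open>s\<close>: its label
      guarantees an arrow from \<open>D ?T\<close> to its source.\<close>
    let ?T = "{Inl (s, s, Ident I s)} :: ('u, 'u) label set"
    have T: "?T \<in> ?P" using Ident_in_Hom[OF s] by (simp add: Fpow_def arrows_def InlI)
    then show ?thesis using DH[OF T] by (intro bexI[of _ "e ?T"]) (simp_all add: d_def ke eF)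
  qed
  moreover have "\<exists>b. (a, b) \<in> r \<and>
        Cmp I (omap d b) (omap d a) s f (amap d b a (poset_arrow b a)) =
        Cmp I (omap d b) (omap d a) s g (amap d b a (poset_arrow b a))"
    if a: "a \<in> Field r" and f: "f \<in> Hom I (omap d a) s" and g: "g \<in> Hom I (omap d a) s" for a s f g
  proof -
    obtain x where x: "x \<in> ?S" "x \<notin> k a" using fresh[OF kP(1)[OF a]] by blast
    \<comment> \<open>The labels of \<open>f\<close> and \<open>g\<close> make the transition from
      \<open>?T\<close> to \<open>k a\<close> equalize them. The fresh \<open>x\<close> keeps the
      inclusion proper even if both labels already lie in \<open>k a\<close>.\<close>
    let ?T = "insert x (insert (Inl (D (k a), s, f)) (insert (Inl (D (k a), s, g)) (k a)))"
    have T: "?T \<in> ?P" using kP(1)[OF a] x f g by (intro PI) (auto simp: arrows_def d_def)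
    have sub: "k a \<subset> ?T" using x by blast
    then have "(a, e ?T) \<in> r" using T a by (auto simp: r_iff ke eF)
    then show ?thesis
      using Meq[OF T sub, of s f g] sub by (intro exI[of _ "e ?T"]) (auto simp: d_def ke[OF T])
  qed
  ultimately show thesis by (rule that)
qed

section \<open>Essential surjectivity\<close>

lemma essentially_surjective_pro_incl:
  fixes C :: "('o, 'm) category"
  assumes unc: "uncountable (UNIV :: 'u set)"
  shows "essentially_surjective (ProBar TYPE('u) C) (Pro TYPE('u) C) (pro_incl TYPE('u) C)"
  unfolding essentially_surjective_def
proof
  fix Y :: "('u, 'o, 'm) pro_object" assume "Y \<in> Ob (Pro TYPE('u) C)"
  then obtain I X where Y: "Y = (I, X)" and IX: "(I, X) \<in> pro_objects C"
    by (cases Y) (simp add: Pro_def)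
  interpret directed_diagram I C X by (rule pro_objects_directed_diagram[OF IX])
  have "small TYPE('u) (arrows I)" using IX by (simp add: pro_objects_def small_directed_category_def)
  then obtain r d where r: "small_cofinite_directed_set (r :: 'u rel)" and d: "cat_functor (poset_category r) I d"
    and cof: "\<And>s. s \<in> Ob I \<Longrightarrow> \<exists>a\<in>Field r. Hom I (omap d a) s \<noteq> {}"
    and equ: "\<And>a s f g. \<lbrakk>a \<in> Field r; f \<in> Hom I (omap d a) s; g \<in> Hom I (omap d a) s\<rbrakk> \<Longrightarrow>
      \<exists>b. (a, b) \<in> r \<and>
        Cmp I (omap d b) (omap d a) s f (amap d b a (poset_arrow b a)) =
        Cmp I (omap d b) (omap d a) s g (amap d b a (poset_arrow b a))"
    using ex_cofinal_cofinite_directed_set[OF src.category_axioms directed _ unc] by blast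
  interpret d: cat_functor "poset_category r" I d by fact
  let ?J = "poset_category r"
  \<comment> \<open>The composite of \<open>X\<close> and \<open>d\<close>, with the default values
    outside the carrier that membership in \<open>probar_objects\<close> requires.\<close>
  define F where "F = \<lparr>omap = (\<lambda>a\<in>Field r. omap X (omap d a)),
    amap = (\<lambda>a b h. if h \<in> Hom ?J a b then amap X (omap d a) (omap d b) (amap d a b h) else undefined)\<rparr>"
  have F: "cat_functor ?J C F"
  proof (intro cat_functor.intro d.src.category_axioms tgt.category_axioms cat_functor_axioms.intro)
    show "omap F a \<in> Ob C" if "a \<in> Ob ?J" for a
      using that by (simp add: F_def omap_Ob d.omap_Ob[simplified])
    show "amap F a b f \<in> Hom C (omap F a) (omap F b)" if "f \<in> Hom ?J a b" for a b f
      using that d.src.Hom_Ob[OF that] amap_Hom[OF d.amap_Hom[OF that]] by (simp add: F_def)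
    show "amap F a a (Ident ?J a) = Ident C (omap F a)" if "a \<in> Ob ?J" for a
      using that d.src.Ident_in_Hom[OF that] d.amap_Ident[OF that] amap_Ident[OF d.omap_Ob[OF that]]
      by (simp add: F_def)
    show "amap F a c (Cmp ?J a b c g f) = Cmp C (omap F a) (omap F b) (omap F c) (amap F b c g) (amap F a b f)"
      if "f \<in> Hom ?J a b" "g \<in> Hom ?J b c" for a b c f g
      using that d.src.Hom_Ob[OF that(1)] d.src.Hom_Ob[OF that(2)] d.src.Cmp_in_Hom[OF that]
        d.amap_Cmp[OF that] amap_Cmp[OF d.amap_Hom[OF that(1)] d.amap_Hom[OF that(2)]]
      by (simp add: F_def del: poset_category_simps(2,4))
  qed
  have "extensional_functor ?J F"
    by (auto simp: extensional_functor_def F_def)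
  with r F have rF: "(r, F) \<in> probar_objects C" by (simp add: probar_objects_def)
  have eq: "functor_eq ?J F (functor_comp X d)"
    by (auto simp: functor_eq_def functor_comp_def F_def)
  have J: "directed_category ?J"
    using r by (simp add: small_cofinite_directed_set_def directed_poset_category)
  have cof': "\<exists>a\<in>Ob ?J. Hom I (omap d a) s \<noteq> {}" if "s \<in> Ob I" for s
    using cof[OF that] by simp
  have equ': "\<exists>b. \<exists>h\<in>Hom ?J b a. Cmp I (omap d b) (omap d a) s f (amap d b a h) =
      Cmp I (omap d b) (omap d a) s g (amap d b a h)"
    if "a \<in> Ob ?J" "f \<in> Hom I (omap d a) s" "g \<in> Hom I (omap d a) s" for a s f g
    using equ[of a f s g] that by simp
  obtain p q where "p \<in> pro_Hom C (?J, F) (I, X)" "q \<in> pro_Hom C (I, X) (?J, F)"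
    "pro_Cmp C (?J, F) (I, X) (?J, F) q p = pro_Ident C (?J, F)"
    "pro_Cmp C (I, X) (?J, F) (I, X) p q = pro_Ident C (I, X)"
    by (rule iso_cofinal_restriction[OF J d F eq cof' equ'])
  then have "iso_arrow (Pro TYPE('u) C) (?J, F) (I, X) p"
    using IX to_pro_in_pro_objects[OF rF] by (auto simp: iso_arrow_def Pro_def)
  then show "\<exists>c\<in>Ob (ProBar TYPE('u) C). isomorphic_objects (Pro TYPE('u) C) (omap (pro_incl TYPE('u) C) c) Y"
    using rF unfolding Y isomorphic_objects_def
    by (intro bexI[of _ "(r, F)"]) (auto simp: pro_incl_def ProBar_def)
qed

theorem corollary4p9:
  fixes C :: "('o, 'm) category"
  assumes "category C"
    and "uncountable (UNIV :: 'u set)"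
  shows "full_subcategory_inclusion_upto_iso (ProBar TYPE('u) C) (Pro TYPE('u) C) (pro_incl TYPE('u) C)
    \<and> essentially_surjective (ProBar TYPE('u) C) (Pro TYPE('u) C) (pro_incl TYPE('u) C)
    \<and> equivalence_of_categories (ProBar TYPE('u) C) (Pro TYPE('u) C) (pro_incl TYPE('u) C)"
proof -
  interpret fully_faithful_functor "ProBar TYPE('u) C" "Pro TYPE('u) C" "pro_incl TYPE('u) C"
    by (rule fully_faithful_pro_incl)
  show ?thesis
    using full_subcategory_inclusion_upto_iso_if_inj[OF inj_on_omap_pro_incl]
      essentially_surjective_pro_incl[OF assms(2), of C]
      equivalence_if_essentially_surjective by blast
qed

end
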